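(* Take $g=k=1$. For every $n\ge 1$ the following two identities hold: $$\mathbb H^{[n]}(0,w)=\mathbb H_{(n-1,1)}(0,w),\qquad \mathbb H^{[n]}(w^{-1},w)=\mathbb H_{(n-1,1)}(w^{-1},w),$$ where $\mathbb H^{[n]}(z,w)$ is defined by $$\sum_{n\ge 0}\mathbb H^{[n]}(z,w)T^n=\prod_{n\ge 1}\frac{(1-zwT^n)^2}{(1-z^2T^n)(1-w^2T^n)}$$ and $\mathbb H_{(n-1,1)}(z,w)\in\mathbb Q(z,w)$ is the rational function attached to the partition $(n-1,1)$ in the context.
   Context: Here $g=1$ and $k=1$. For a partition $\lambda$ and a cell $s\in\lambda$ let $a(s),l(s)$ be the arm and leg lengths, and put $$\mathcal H_\lambda(z,w)=\prod_{s\in\lambda}\frac{(z^{2a(s)+1}-w^{2l(s)+1})^{2}}{(z^{2a(s)+2}-w^{2l(s)})(z^{2a(s)}-w^{2l(s)+2})}.$$ Let $\tilde H_\lambda(\mathbf x;q,t)$ be the modified Macdonald symmetric function (Garsia–Haiman), $\tilde H_\lambda=\sum_\nu\tilde K_{\nu\lambda}(q,t)s_\nu$; it is characterized by: $\tilde H_\lambda[X(1-q)]\in\mathrm{span}\{s_\nu:\nu\trianglerighteq\lambda\}$, $\tilde H_\lambda[X(1-t)]\in\mathrm{span}\{s_\nu:\nu\trianglerighteq\lambda'\}$, $\langle\tilde H_\lambda,s_{(|\lambda|)}\rangle=1$, where $f[X(1-a)]$ is the image of $f$ under $p_r\mapsto(1-a^r)p_r$. Put $\Omega(z,w)=\sum_\lambda\mathcal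 H_\lambda(z,w)\tilde H_\lambda(\mathbf x;z^2,w^2)$, sum over all partitions including the empty one. The Adams operation $\psi_d$ replaces every variable ($z$, $w$ and all $x_i$) by its $d$-th power; for a series $F$ with constant term $1$, $\mathrm{Log}(F)=\sum_{m\ge1}\frac{\mu(m)}{m}\psi_m(\log F)$ with $\mu$ the Möbius function. With the Hall pairing $\langle\cdot,\cdot\rangle$ and $h_\mu$ the complete symmetric functions, for a partition $\mu$ set $$\mathbb H_\mu(z,w)=(z^2-1)(1-w^2)\langle\mathrm{Log}\,\Omega(z,w),h_\mu(\mathbf x)\rangle .$$ For $n=1$, $(n-1,1)$ is understood as the partition $(1)$. *)

theory Defs
  imports
    "HOL-Analysis.Infinite_Products"
    "HOL-Computational_Algebra.Computational_Algebra"
    "Jordan_Normal_Form.Determinant"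
begin

section \<open>Partitions\<close>

text \<open>A partition is the weakly decreasing list of its positive parts; indices start at 0.\<close>

definition is_partition :: "nat list \<Rightarrow> bool" where
  "is_partition l \<longleftrightarrow> sorted_wrt (\<ge>) l \<and> 0 \<notin> set l"

definition conj_part :: "nat list \<Rightarrow> nat list" where
  "conj_part l = map (\<lambda>j. length (filter (\<lambda>r. j < r) l)) [0..<(case l of [] \<Rightarrow> 0 | r # _ \<Rightarrow> r)]"

definition dominates :: "nat list \<Rightarrow> nat list \<Rightarrow> bool" (infix \<open>\<unrhd>\<^sub>d\<close> 50) where
  "n \<unrhd>\<^sub>d l \<longleftrightarrow> is_partition n \<and> is_partition l \<and> sum_list n = sum_list l \<and>
     (\<forall>k. sum_list (take k l) \<le> sum_list (take k n))"

definition cells :: "nat list \<Rightarrow> (nat \<times> nat) set" where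
  "cells l = {(i, j). i < length l \<and> j < l ! i}"

definition arm :: "nat list \<Rightarrow> nat \<times> nat \<Rightarrow> nat" where
  "arm l = (\<lambda>(i, j). l ! i - (j + 1))"

definition leg :: "nat list \<Rightarrow> nat \<times> nat \<Rightarrow> nat" where
  "leg l = (\<lambda>(i, j). conj_part l ! j - (i + 1))"

definition row_part :: "nat \<Rightarrow> nat list" where
  "row_part n = (if n = 0 then [] else [n])"


section \<open>Formal power series in the variables $x_0, x_1, x_2, \ldots$\<close>

text \<open>A monomial is the multiset of the indices of its variables, so that its total degree is the
  size of the multiset and multiplication of monomials is addition of multisets.\<close>

typedef 'a xps = "UNIV :: (nat multiset \<Rightarrow> 'a) set"
  morphisms xcoeff Abs_xps by simp

setup_lifting type_definition_xps

lemma xps_eqI: "(\<And>m. xcoeff f m = xcoeff g m) \<Longrightarrow> f = g"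
  by (simp add: xcoeff_inject[symmetric] fun_eq_iff)

lemma finite_submultisets: "finite {a. a \<subseteq># (m :: 'b multiset)}"
proof (induction m)
  case (add x m)
  have "{a. a \<subseteq># add_mset x m} \<subseteq> {a. a \<subseteq># m} \<union> add_mset x ` {a. a \<subseteq># m}"
  proof
    fix a assume "a \<in> {a. a \<subseteq># add_mset x m}"
    hence a: "a \<subseteq># add_mset x m" by simp
    show "a \<in> {a. a \<subseteq># m} \<union> add_mset x ` {a. a \<subseteq># m}"
    proof (cases "x \<in># a")
      case True
      then obtain b where "a = add_mset x b" by (meson multi_member_split)
      with a show ?thesis by auto
    next
      case False
      hence "a - {#x#} = a" by simp
      with a have "a \<subseteq># m" by (metis add_mset_add_single subset_eq_diff_conv)
      thus ?thesis by simp
    qed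
  qed
  with add show ?case by (meson finite_UnI finite_imageI finite_subset)
qed simp

lemma finite_antidiagonal: "finite {(a, b). a + b = (m :: 'b multiset)}"
proof (rule finite_subset)
  show "{(a, b). a + b = m} \<subseteq> {a. a \<subseteq># m} \<times> {a. a \<subseteq># m}" by auto
qed (simp add: finite_submultisets)

lemma finite_antidiagonal': "finite {p. fst p + snd p = (m :: 'b multiset)}"
  using finite_antidiagonal[of m] by (simp add: case_prod_unfold)

instantiation xps :: (comm_ring_1) comm_ring_1
begin

lift_definition zero_xps :: "'a xps" is "\<lambda>_. 0" .
lift_definition one_xps :: "'a xps" is "\<lambda>m. if m = {#} then 1 else 0" .
lift_definition plus_xps :: "'a xps \<Rightarrow> 'a xps \<Rightarrow> 'a xps" is "\<lambda>f g m. f m + g m" .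
lift_definition uminus_xps :: "'a xps \<Rightarrow> 'a xps" is "\<lambda>f m. - f m" .
lift_definition minus_xps :: "'a xps \<Rightarrow> 'a xps \<Rightarrow> 'a xps" is "\<lambda>f g m. f m - g m" .
lift_definition times_xps :: "'a xps \<Rightarrow> 'a xps \<Rightarrow> 'a xps" is
  "\<lambda>f g m. \<Sum>(a, b) | a + b = m. f a * g b" .

instance
proof
  fix f g h :: "'a xps"
  show "f * g * h = f * (g * h)"
  proof (rule xps_eqI)
    fix m
    have L: "xcoeff (f * g * h) m =
        (\<Sum>((e, c), (a, b)) \<in> Sigma {(e, c). e + c = m} (\<lambda>(e, c). {(a, b). a + b = e}).
           xcoeff f a * xcoeff g b * xcoeff h c)"
      by (subst sum.Sigma[symmetric])
        (auto simp: times_xps.rep_eq finite_antidiagonal' sum_distrib_right case_prod_unfold)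
    have R: "xcoeff (f * (g * h)) m =
        (\<Sum>((a, e), (b, c)) \<in> Sigma {(a, e). a + e = m} (\<lambda>(a, e). {(b, c). b + c = e}).
           xcoeff f a * xcoeff g b * xcoeff h c)"
      by (subst sum.Sigma[symmetric])
        (auto simp: times_xps.rep_eq finite_antidiagonal' sum_distrib_left case_prod_unfold mult.assoc)
    show "xcoeff (f * g * h) m = xcoeff (f * (g * h)) m"
      unfolding L R
      by (rule sum.reindex_bij_witness[where
            i = "\<lambda>((a, e), (b, c)). ((a + b, c), (a, b))" and
            j = "\<lambda>((e, c), (a, b)). ((a, b + c), (b, c))"])
        (auto simp: add.assoc)
  qed
  show "f * g = g * f"
  proof (rule xps_eqI)
    fix m
    show "xcoeff (f * g) m = xcoeff (g * f) m"
      unfolding times_xps.rep_eq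
      by (rule sum.reindex_bij_witness[where i = prod.swap and j = prod.swap])
        (auto simp: add.commute mult.commute)
  qed
  show "1 * f = f"
  proof (rule xps_eqI)
    fix m
    have "xcoeff (1 * f) m = (\<Sum>(a, b) \<in> {({#}, m)}. xcoeff 1 a * xcoeff f b)"
      unfolding times_xps.rep_eq
      by (rule sum.mono_neutral_right) (auto simp: finite_antidiagonal one_xps.rep_eq split: if_splits)
    thus "xcoeff (1 * f) m = xcoeff f m" by (simp add: one_xps.rep_eq)
  qed
  show "(f + g) * h = f * h + g * h"
    by (rule xps_eqI)
      (simp add: times_xps.rep_eq plus_xps.rep_eq case_prod_unfold distrib_right sum.distrib)
  show "(0 :: 'a xps) \<noteq> 1"
  proof
    assume "(0 :: 'a xps) = 1"
    hence "xcoeff (0 :: 'a xps) {#} = xcoeff (1 :: 'a xps) {#}" by simp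
    thus False by (simp add: zero_xps.rep_eq one_xps.rep_eq)
  qed
qed (rule xps_eqI; simp add: plus_xps.rep_eq zero_xps.rep_eq uminus_xps.rep_eq
       minus_xps.rep_eq algebra_simps)+

end

definition xscale :: "'a::comm_ring_1 \<Rightarrow> 'a xps \<Rightarrow> 'a xps" where
  "xscale c f = Abs_xps (\<lambda>m. c * xcoeff f m)"

definition xmap :: "('a \<Rightarrow> 'b) \<Rightarrow> 'a xps \<Rightarrow> 'b xps" where
  "xmap \<phi> f = Abs_xps (\<lambda>m. \<phi> (xcoeff f m))"

text \<open>The monomial $x_0^{\lambda_0} x_1^{\lambda_1} \cdots$.\<close>

definition xmonomial :: "nat list \<Rightarrow> nat multiset" where
  "xmonomial l = (\<Sum>i<length l. replicate_mset (l ! i) i)"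


section \<open>Symmetric functions\<close>

definition power_sum :: "nat \<Rightarrow> 'a::comm_ring_1 xps" where
  "power_sum r = Abs_xps (\<lambda>m. if \<exists>i. m = replicate_mset r i then 1 else 0)"

definition complete_sym :: "nat \<Rightarrow> 'a::comm_ring_1 xps" where
  "complete_sym r = Abs_xps (\<lambda>m. if size m = r then 1 else 0)"

definition psum_part :: "nat list \<Rightarrow> 'a::comm_ring_1 xps" where
  "psum_part l = prod_list (map power_sum l)"

definition h_part :: "nat list \<Rightarrow> 'a::comm_ring_1 xps" where
  "h_part l = prod_list (map complete_sym l)"

text \<open>Schur functions, $s_\lambda = \det (h_{\lambda_i - i + j})_{i,j}$ with $h_r = 0$ for $r < 0$.\<close>

definition schur :: "nat list \<Rightarrow> 'a::comm_ring_1 xps" where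
  "schur l = det (mat (length l) (length l)
     (\<lambda>(i, j). if i \<le> l ! i + j then complete_sym (l ! i + j - i) else 0))"

text \<open>\<open>expands b f c\<close>: the finite linear combination $\sum_\lambda c_\lambda b_\lambda$ over partitions
  equals \<open>f\<close>. The families used below are bases of the ring of symmetric functions over a field
  of characteristic 0, hence there the coefficients are unique.\<close>

definition expands :: "(nat list \<Rightarrow> 'a::comm_ring_1 xps) \<Rightarrow> 'a xps \<Rightarrow> (nat list \<Rightarrow> 'a) \<Rightarrow> bool" where
  "expands b f c \<longleftrightarrow> finite {l. c l \<noteq> 0} \<and> (\<forall>l. c l \<noteq> 0 \<longrightarrow> is_partition l) \<and>
     f = (\<Sum>l | c l \<noteq> 0. xscale (c l) (b l))"

definition coeffs_in :: "(nat list \<Rightarrow> 'a::comm_ring_1 xps) \<Rightarrow> 'a xps \<Rightarrow> nat list \<Rightarrow> 'a" where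
  "coeffs_in b f = (THE c. expands b f c)"

definition schur_span :: "nat list set \<Rightarrow> 'a::comm_ring_1 xps set" where
  "schur_span A = {f. \<exists>c. expands schur f c \<and> (\<forall>l. c l \<noteq> 0 \<longrightarrow> l \<in> A)}"

text \<open>$f[X(1-a)]$: the image of \<open>f\<close> under the algebra endomorphism $p_r \mapsto (1 - a^r) p_r$.\<close>

definition pleth_one_minus :: "'a::field \<Rightarrow> 'a xps \<Rightarrow> 'a xps" where
  "pleth_one_minus a f = (let c = coeffs_in psum_part f in
     \<Sum>l | c l \<noteq> 0. xscale (c l) (prod_list (map (\<lambda>r. xscale (1 - a ^ r) (power_sum r)) l)))"

text \<open>The Hall pairing is determined by $\langle m_\lambda, h_\mu\rangle = \delta_{\lambda\mu}$, and the
  coefficient of the monomial symmetric function $m_\mu$ in \<open>f\<close> is the coefficient of the monomial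
  $x^\mu$. The first argument may be a series with components in infinitely many degrees.\<close>

definition hall :: "'a::field xps \<Rightarrow> 'a xps \<Rightarrow> 'a" where
  "hall f g = (let c = coeffs_in h_part g in \<Sum>l | c l \<noteq> 0. c l * xcoeff f (xmonomial l))"

definition is_modified_macdonald :: "'a::field \<Rightarrow> 'a \<Rightarrow> nat list \<Rightarrow> 'a xps \<Rightarrow> bool" where
  "is_modified_macdonald q t l H \<longleftrightarrow>
     H \<in> schur_span {n. is_partition n} \<and>
     pleth_one_minus q H \<in> schur_span {n. n \<unrhd>\<^sub>d l} \<and>
     pleth_one_minus t H \<in> schur_span {n. n \<unrhd>\<^sub>d conj_part l} \<and>
     hall H (schur (row_part (sum_list l))) = 1"


section \<open>Rational functions in two variables\<close>

instance fract :: ("{idom, ring_char_0}") field_char_0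
proof
  show "inj (of_nat :: nat \<Rightarrow> 'a fract)"
    by (rule injI) (simp add: of_nat_fract eq_fract)
qed

text \<open>$\mathbb{Q}(z,w)$ is the fraction field of $\mathbb{Q}[w][z]$; the field $\mathbb{Q}(q,t)$ of the
  Macdonald functions is the same type, with $q$ and $t$ in the places of $z$ and $w$.\<close>

type_synonym ratfun = "rat poly poly fract"

definition var_z :: ratfun where "var_z = Fract [:0, 1:] 1"
definition var_w :: ratfun where "var_w = Fract [:[:0, 1:]:] 1"

text \<open>The variable of $\mathbb{Q}(w)$.\<close>

definition var_w1 :: "rat poly fract" where "var_w1 = Fract [:0, 1:] 1"

definition poly2 :: "rat poly poly \<Rightarrow> 'a::field_char_0 \<Rightarrow> 'a \<Rightarrow> 'a" where
  "poly2 P a b = poly (map_poly (\<lambda>c. poly (map_poly of_rat c) b) P) a"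

definition has_value :: "ratfun \<Rightarrow> 'a::field_char_0 \<Rightarrow> 'a \<Rightarrow> 'a \<Rightarrow> bool" where
  "has_value F a b v \<longleftrightarrow>
     (\<exists>P Q. F = Fract P Q \<and> poly2 Q a b \<noteq> 0 \<and> v = poly2 P a b / poly2 Q a b)"

definition regular_at :: "ratfun \<Rightarrow> 'a::field_char_0 \<Rightarrow> 'a \<Rightarrow> bool" where
  "regular_at F a b \<longleftrightarrow> (\<exists>v. has_value F a b v)"

text \<open>The value $F(a,b)$; it is meaningful when \<open>F\<close> is regular at $(a,b)$.\<close>

definition rat_at :: "ratfun \<Rightarrow> 'a::field_char_0 \<Rightarrow> 'a \<Rightarrow> 'a" where
  "rat_at F a b = (THE v. has_value F a b v)"


section \<open>Adams operations and the plethystic logarithm\<close>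

definition moebius :: "nat \<Rightarrow> int" where
  "moebius n = (if squarefree n then (- 1) ^ card (prime_factors n) else 0)"

text \<open>$\psi_d$ sends $c(z,w)\,x^m$ to $c(z^d,w^d)\,x^{dm}$. For $d \ge 1$ the sum has at most one term.\<close>

definition adams :: "nat \<Rightarrow> ratfun xps \<Rightarrow> ratfun xps" where
  "adams d F = Abs_xps (\<lambda>m. \<Sum>m' | repeat_mset d m' = m. rat_at (xcoeff F m') (var_z ^ d) (var_w ^ d))"

text \<open>$\log F = \sum_{k \ge 1} \frac{(-1)^{k-1}}{k} (F-1)^k$ for \<open>F\<close> with constant term 1. Here $(F-1)^k$
  has no terms of degree below \<open>k\<close>, so the coefficientwise sum stops at the degree of the monomial.\<close>

definition xlog :: "ratfun xps \<Rightarrow> ratfun xps" where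
  "xlog F = Abs_xps (\<lambda>m. \<Sum>k = 1..size m. (- 1) ^ (k - 1) / of_nat k * xcoeff ((F - 1) ^ k) m)"

text \<open>$\mathrm{Log}\,F = \sum_{d \ge 1} \frac{\mu(d)}{d} \psi_d (\log F)$. The series $\log F$ has no constant
  term, so only $d$ up to the degree of the monomial contribute.\<close>

definition xLog :: "ratfun xps \<Rightarrow> ratfun xps" where
  "xLog F = Abs_xps (\<lambda>m. \<Sum>d = 1..size m. of_int (moebius d) / of_nat d * xcoeff (adams d (xlog F)) m)"


section \<open>The generating series for genus 1 and one puncture\<close>

definition hook_fun :: "nat list \<Rightarrow> ratfun" where
  "hook_fun l = (\<Prod>s\<in>cells l.
     (var_z ^ (2 * arm l s + 1) - var_w ^ (2 * leg l s + 1)) ^ 2 /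
     ((var_z ^ (2 * arm l s + 2) - var_w ^ (2 * leg l s)) *
      (var_z ^ (2 * arm l s) - var_w ^ (2 * leg l s + 2))))"

definition macdonald_H :: "nat list \<Rightarrow> ratfun xps" where
  "macdonald_H l = (THE H. is_modified_macdonald var_z var_w l H)"

text \<open>$\tilde H_\lambda(\mathbf{x}; z^2, w^2)$.\<close>

definition macdonald_H_sq :: "nat list \<Rightarrow> ratfun xps" where
  "macdonald_H_sq l = xmap (\<lambda>c. rat_at c (var_z ^ 2) (var_w ^ 2)) (macdonald_H l)"

text \<open>$\tilde H_\lambda$ is homogeneous of degree $|\lambda|$, so each coefficient is a finite sum.\<close>

definition Omega :: "ratfun xps" where
  "Omega = Abs_xps (\<lambda>m. \<Sum>l | is_partition l \<and> xcoeff (macdonald_H_sq l) m \<noteq> 0.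
     hook_fun l * xcoeff (macdonald_H_sq l) m)"

definition HH_part :: "nat list \<Rightarrow> ratfun" where
  "HH_part \<mu> = (var_z ^ 2 - 1) * (1 - var_w ^ 2) * hall (xLog Omega) (h_part \<mu>)"

definition near_row :: "nat \<Rightarrow> nat list" where
  "near_row n = (if n = 1 then [1] else [n - 1, 1])"

text \<open>The infinite product is taken in the $T$-adic topology; the factor with index \<open>i\<close> belongs to
  $T^{i+1}$.\<close>

definition HH_genfun :: "ratfun fps" where
  "HH_genfun = (\<Prod>i. (1 - fps_const (var_z * var_w) * fps_X ^ Suc i) ^ 2 /
     ((1 - fps_const (var_z ^ 2) * fps_X ^ Suc i) * (1 - fps_const (var_w ^ 2) * fps_X ^ Suc i)))"

definition HH_hilb :: "nat \<Rightarrow> ratfun" where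
  "HH_hilb n = fps_nth HH_genfun n"

end

theory Submission
  imports Defs "HOL-Library.Poly_Mapping" "Jordan_Normal_Form.Char_Poly"
begin

text \<open>Pairing with $h_{(n-1,1)}$ reads off the coefficient of $x_0^{n-1} x_1$. So of each Macdonald function
  only two numbers matter: its coefficients at $x_0^{|\lambda|}$ and at $x_0^{|\lambda|-1} x_1$. They are
  $1$ and $B_\lambda(q,t) = \sum_{(i,j)\in\lambda} q^j t^i$. As $x_1$ occurs to the first power, the
  Adams operations $\psi_d$ with $d \ge 2$ contribute nothing, and modulo $x_1^2$ the logarithm of
  $u + v x_1$ is $\log u + (v/u) x_1$. Hence, for $n \ge 1$, the number
  $\mathbb H_{(n-1,1)}$ is the coefficient of $T^n$ in
  $$(z^2-1)(1-w^2)\,\frac{\sum_\lambda \mathcal H_\lambda B_\lambda(z^2,w^2) T^{|\lambda|}}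
    {\sum_\lambda \mathcal H_\lambda T^{|\lambda|}},$$
  which is lemma \<open>HH_part_near_row\<close>.

  The value $B_\lambda$ comes from Macdonald's operator
  $D f = $ constant term in $y$ of $f[X + (1-q)(1-t)y]\,\sum_k (-1/y)^k e_k$. In the single variable
  $x_0 = 1$ the last factor is $1 - 1/y$, so an eigenvector with eigenvalue
  $1 - (1-q)(1-t)B_\lambda$, normalised to have the coefficient $1$ at $x_0^n$, has the coefficient
  $B_\lambda$ at $x_0^{n-1}x_1$ (\<open>ev1_D0\<close>). The characterisation of $\tilde H_\lambda$ by
  triangularity is turned into this eigenvalue equation as follows. After $f \mapsto f[X(1-q)]$ the
  operator is triangular in the basis $h_\mu$ with respect to dominance, with the said eigenvalues on the
  diagonal (\<open>Tq_spn\<close>), and these are distinct. The Jacobi-Trudi formula makes spans of $h_\mu$ and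
  spans of $s_\mu$ over an upper set of the dominance order equal. Since $D$ is symmetric in $q$ and $t$,
  the same eigenvector satisfies the triangularity condition for $t$ and the conjugate partition
  (\<open>joint_eigenvector\<close>). It is the only function that satisfies both, because conjugation
  reverses dominance (\<open>mac_unique\<close>). That its coefficient at $x_0^n$ does not vanish follows by
  letting $t \to 1$: the off-diagonal entries of the operator are divisible by $(1-t)^2$ and the
  differences of the eigenvalues only by $1-t$, so the triangular eigenvector tends to $h_\lambda$
  (\<open>evq_evec_nonzero\<close>).

  It remains to sum over partitions. Write $K$ for the denominator above and $G - K$ for the numerator,
  prefactors included.

  At $z = 0$ only the last cell of each row contributes to $\mathcal H_\lambda$. With $u = w^{-2}$ and
  $m_k$ the number of parts $k$, this gives $\mathcal H_\lambda = \prod_k 1/(u;u)_{m_k}$. Moreover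
  $(1-w^2) B_\lambda(0,w^2) = 1 - w^{2\ell(\lambda)}$, so $G$ is $K$ with the extra weight
  $w^{2\ell(\lambda)}$. Both are products over $k$ of the series $F(y) = \sum_m y^m/(u;u)_m$, at
  $y = w^2T^k$ and $y = T^k$, and $F(w^2 y)(1 - w^2 y) = F(y)$ gives
  $G/K = \prod_k 1/(1 - w^2T^k)$ (\<open>zero_identity\<close>).

  At $zw = 1$ every $\mathcal H_\lambda$ equals $1$. Then $K = \prod_k 1/(1-T^k)$ and, with $q = w^{-2}$
  and $t = w^2$, $G = \sum_\lambda (1-(1-q)(1-t)B_\lambda)T^{|\lambda|}$. Summing $B_\lambda$ column by
  column, a telescoping sum and the $q$-binomial theorem give
  $G = \prod_k (1-T^k)/((1-qT^k)(1-tT^k))$ (\<open>dval_series\<close>). In both cases $G/K$ is the value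
  of the infinite product.\<close>

section \<open>Polynomials in the complete symmetric functions\<close>

text \<open>The ring of symmetric functions is modelled as the polynomial ring in $h_1, h_2, \ldots$: here
  homomorphisms can be defined by free choice of the images of the $h_k$, and triangularity statements
  concern coefficients of monomials in the $h_k$. The map \<open>iota\<close> below compares this model with series
  in the variables $x_i$.\<close>

type_synonym 'a sym = "nat multiset \<Rightarrow>\<^sub>0 'a"

abbreviation mcoeff :: "('b \<Rightarrow>\<^sub>0 'a::zero) \<Rightarrow> 'b \<Rightarrow> 'a" where "mcoeff \<equiv> Poly_Mapping.lookup"
abbreviation supp :: "('b \<Rightarrow>\<^sub>0 'a::zero) \<Rightarrow> 'b set" where "supp \<equiv> Poly_Mapping.keys"

definition cst :: "'a::comm_ring_1 \<Rightarrow> 'a sym" where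
  "cst c = Poly_Mapping.single {#} c"

text \<open>The index \<open>k\<close> in a monomial stands for $h_{k+1}$, since $h_0 = 1$ is not a variable.\<close>

definition hvar :: "nat \<Rightarrow> 'a::comm_ring_1 sym" where
  "hvar k = (if k = 0 then 1 else Poly_Mapping.single {#k - 1#} 1)"

text \<open>The homomorphism with $h_k \mapsto \varphi(k)$ for $k \ge 1$ that acts on the constants as \<open>c\<close>.\<close>

definition hsubst :: "('a \<Rightarrow> 'b) \<Rightarrow> (nat \<Rightarrow> 'b) \<Rightarrow> 'a::comm_ring_1 sym \<Rightarrow> 'b::comm_ring_1" where
  "hsubst c \<phi> F = (\<Sum>m\<in>supp F. c (mcoeff F m) * (\<Prod>k\<in>#m. \<phi> (Suc k)))"

lemma cst_hom: "comm_ring_hom (cst :: 'a::comm_ring_1 \<Rightarrow> 'a sym)"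
  by unfold_locales (auto simp: cst_def single_add mult_single)

interpretation cst: comm_ring_hom "cst :: 'a::comm_ring_1 \<Rightarrow> 'a sym" by (rule cst_hom)

lemma lookup_cst_mult: "mcoeff (cst c * F) m = c * mcoeff F m"
proof -
  have "cst c * F = Poly_Mapping.map ((*) c) F"
    by (simp add: cst_def mult_map_scale_conv_mult)
  thus ?thesis by (simp add: Poly_Mapping.map.rep_eq when_def)
qed

lemma single_eq_cst: "Poly_Mapping.single m c = cst c * Poly_Mapping.single m 1"
  by (simp add: cst_def mult_single)

lemma sym_sum_singles: "F = (\<Sum>m\<in>supp F. Poly_Mapping.single m (mcoeff F m))"
  by (rule poly_mapping_eqI)
    (auto simp: lookup_sum lookup_single when_def in_keys_iff sum.delta[OF finite_keys])

lemma hsubst_superset: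
  assumes "comm_ring_hom c" "finite A" "supp F \<subseteq> A"
  shows "hsubst c \<phi> F = (\<Sum>m\<in>A. c (mcoeff F m) * (\<Prod>k\<in>#m. \<phi> (Suc k)))"
proof -
  interpret comm_ring_hom c by fact
  show ?thesis unfolding hsubst_def using assms(2,3)
    by (intro sum.mono_neutral_left) (auto simp: in_keys_iff)
qed

lemma hsubst_single:
  assumes "comm_ring_hom c"
  shows "hsubst c \<phi> (Poly_Mapping.single m x) = c x * (\<Prod>k\<in>#m. \<phi> (Suc k))"
proof -
  interpret comm_ring_hom c by fact
  show ?thesis by (subst hsubst_superset[OF assms, of "{m}"]) auto
qed

lemma hsubst_add:
  assumes "comm_ring_hom c"
  shows "hsubst c \<phi> (F + G) = hsubst c \<phi> F + hsubst c \<phi> G"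
proof -
  interpret comm_ring_hom c by fact
  let ?A = "supp F \<union> supp G"
  have "supp (F + G) \<subseteq> ?A" by (rule keys_add)
  thus ?thesis
    by (simp add: hsubst_superset[OF assms, of ?A] lookup_add hom_distribs distrib_right sum.distrib)
qed

lemma hsubst_sum:
  assumes "comm_ring_hom c"
  shows "hsubst c \<phi> (\<Sum>i\<in>A. F i) = (\<Sum>i\<in>A. hsubst c \<phi> (F i))"
  by (induction A rule: infinite_finite_induct)
    (simp_all add: hsubst_add[OF assms] hsubst_def[of _ _ 0])

lemma hsubst_mult:
  assumes "comm_ring_hom c"
  shows "hsubst c \<phi> (F * G) = hsubst c \<phi> F * hsubst c \<phi> G"
proof -
  interpret comm_ring_hom c by fact
  have "F * G = (\<Sum>m\<in>supp F. Poly_Mapping.single m (mcoeff F m)) *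
      (\<Sum>m\<in>supp G. Poly_Mapping.single m (mcoeff G m))"
    using sym_sum_singles[of F] sym_sum_singles[of G] by simp
  also have "\<dots> = (\<Sum>m\<in>supp F. \<Sum>n\<in>supp G.
      Poly_Mapping.single (m + n) (mcoeff F m * mcoeff G n))"
    by (simp add: sum_product mult_single)
  finally have "hsubst c \<phi> (F * G) = (\<Sum>m\<in>supp F. \<Sum>n\<in>supp G.
      c (mcoeff F m * mcoeff G n) * (\<Prod>k\<in>#m + n. \<phi> (Suc k)))"
    by (simp only: hsubst_sum[OF assms] hsubst_single[OF assms])
  also have "\<dots> = hsubst c \<phi> F * hsubst c \<phi> G"
    unfolding hsubst_def sum_product by (intro sum.cong refl) (simp add: hom_mult mult_ac)
  finally show ?thesis .
qed

lemma hsubst_hom: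
  assumes "comm_ring_hom c"
  shows "comm_ring_hom (hsubst c \<phi>)"
proof -
  interpret comm_ring_hom c by fact
  have one: "hsubst c \<phi> 1 = 1"
    using hsubst_single[OF assms, of \<phi> "{#}" 1] by simp
  show ?thesis
    by unfold_locales (auto simp: hsubst_add[OF assms] hsubst_mult[OF assms] one hsubst_def[of _ _ 0])
qed

lemma hsubst_cst:
  assumes "comm_ring_hom c"
  shows "hsubst c \<phi> (cst x) = c x"
  by (simp add: cst_def hsubst_single[OF assms])

lemma hsubst_hvar:
  assumes "comm_ring_hom c" "\<phi> 0 = 1"
  shows "hsubst c \<phi> (hvar k) = \<phi> k"
proof -
  interpret comm_ring_hom c by fact
  interpret h: comm_ring_hom "hsubst c \<phi>" by (rule hsubst_hom) fact
  show ?thesis by (simp add: hvar_def hsubst_single[OF assms(1)] assms(2))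
qed

lemma hom_hsubst:
  assumes "comm_ring_hom \<psi>"
  shows "\<psi> (hsubst c \<phi> F) = hsubst (\<lambda>x. \<psi> (c x)) (\<lambda>k. \<psi> (\<phi> k)) F"
proof -
  interpret comm_ring_hom \<psi> by fact
  show ?thesis by (simp add: hsubst_def hom_distribs hom_prod_mset image_mset.compositionality o_def)
qed

lemma hsubst_cong:
  assumes "\<And>k. \<phi> (Suc k) = \<phi>' (Suc k)" "\<And>x. c x = c' x"
  shows "hsubst c \<phi> F = hsubst c' \<phi>' F"
  using assms by (simp add: hsubst_def)

lemma prod_list_map_eq_mset: "prod_list (map (f :: _ \<Rightarrow> 'b::comm_monoid_mult) l) = (\<Prod>k\<in>#mset l. f k)"
  by (simp add: prod_mset_prod_list flip: mset_map)

section \<open>Generating series and plethysm\<close>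

definition fps_dil :: "'a::comm_ring_1 \<Rightarrow> 'a fps \<Rightarrow> 'a fps" where
  "fps_dil a f = Abs_fps (\<lambda>n. a ^ n * fps_nth f n)"

definition fps_map :: "('a \<Rightarrow> 'b) \<Rightarrow> 'a fps \<Rightarrow> 'b fps" where
  "fps_map \<psi> f = Abs_fps (\<lambda>n. \<psi> (fps_nth f n))"

lemma fps_dil_nth [simp]: "fps_nth (fps_dil a f) n = a ^ n * fps_nth f n"
  by (simp add: fps_dil_def)

lemma fps_map_nth [simp]: "fps_nth (fps_map \<psi> f) n = \<psi> (fps_nth f n)"
  by (simp add: fps_map_def)

lemma fps_dil_hom: "comm_ring_hom (fps_dil a)"
proof
  fix f g
  show "fps_dil a (f * g) = fps_dil a f * fps_dil a g"
  proof (rule fps_ext)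
    fix n
    have "a ^ n * (fps_nth f i * fps_nth g (n - i)) = a ^ i * fps_nth f i * (a ^ (n - i) * fps_nth g (n - i))"
      if "i \<in> {0..n}" for i
    proof -
      from that have "a ^ n = a ^ i * a ^ (n - i)" by (simp flip: power_add)
      thus ?thesis by (simp add: mult_ac)
    qed
    thus "fps_nth (fps_dil a (f * g)) n = fps_nth (fps_dil a f * fps_dil a g) n"
      by (auto simp: fps_mult_nth sum_distrib_left intro!: sum.cong)
  qed
qed (auto simp: fps_eq_iff algebra_simps)

lemma fps_map_hom:
  assumes "comm_ring_hom \<psi>"
  shows "comm_ring_hom (fps_map \<psi>)"
proof -
  interpret comm_ring_hom \<psi> by fact
  show ?thesis
    by unfold_locales (auto simp: fps_eq_iff hom_distribs fps_mult_nth)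
qed

lemma fps_map_dil:
  assumes "comm_ring_hom \<psi>"
  shows "fps_map \<psi> (fps_dil a f) = fps_dil (\<psi> a) (fps_map \<psi> f)"
proof -
  interpret comm_ring_hom \<psi> by fact
  show ?thesis by (simp add: fps_eq_iff hom_distribs)
qed

text \<open>$H(T) = \sum_k h_k T^k$; its inverse is $\sum_k (-1)^k e_k T^k$.\<close>

definition hgen :: "'a::comm_ring_1 sym fps" where "hgen = Abs_fps hvar"
definition hinv :: "'a::comm_ring_1 sym fps" where "hinv = fps_right_inverse hgen 1"

lemma hvar_0 [simp]: "hvar 0 = 1" by (simp add: hvar_def)

lemma hgen_nth [simp]: "fps_nth hgen n = hvar n" by (simp add: hgen_def)

lemma hgen_hinv: "hgen * hinv = 1"
  unfolding hinv_def by (rule fps_right_inverse) simp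

lemma hinv_0 [simp]: "fps_nth hinv 0 = 1"
  by (simp add: hinv_def)

text \<open>The plethysm $f[X(1-a)]$: its effect on the generating series is $H(T) \mapsto H(T)/H(aT)$. That it
  multiplies $p_r$ by $1 - a^r$ is proved in \<open>theta_psym\<close>.\<close>

definition theta :: "'a::comm_ring_1 \<Rightarrow> 'a sym \<Rightarrow> 'a sym" where
  "theta a = hsubst cst (\<lambda>k. fps_nth (hgen * fps_dil (cst a) hinv) k)"

lemma theta_hom: "comm_ring_hom (theta a)"
  unfolding theta_def by (rule hsubst_hom[OF cst_hom])

lemma theta_cst [simp]: "theta a (cst c) = cst c"
  by (simp add: theta_def hsubst_cst[OF cst_hom])

lemma theta_hvar: "theta a (hvar k) = fps_nth (hgen * fps_dil (cst a) hinv) k"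
  unfolding theta_def by (rule hsubst_hvar[OF cst_hom]) simp

lemma theta_hgen: "fps_map (theta a) hgen = hgen * fps_dil (cst a) hinv"
  by (simp add: fps_eq_iff theta_hvar)

lemma theta_hinv: "fps_map (theta a) hinv = fps_dil (cst a) hgen * hinv"
proof -
  interpret m: comm_ring_hom "fps_map (theta a)" by (rule fps_map_hom[OF theta_hom])
  interpret d: comm_ring_hom "fps_dil (cst a :: 'a sym)" by (rule fps_dil_hom)
  have 1: "(hgen * fps_dil (cst a) hinv) * fps_map (theta a) hinv = 1"
    using arg_cong[OF hgen_hinv, of "fps_map (theta a)"] by (simp add: m.hom_mult theta_hgen)
  have 2: "fps_dil (cst a) hgen * fps_dil (cst a) hinv = 1"
    using arg_cong[OF hgen_hinv, of "fps_dil (cst a)"] by (simp add: d.hom_mult)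
  have "fps_map (theta a) hinv =
      (hgen * hinv) * (fps_dil (cst a) hgen * fps_dil (cst a) hinv) * fps_map (theta a) hinv"
    by (simp add: 2 hgen_hinv)
  also have "\<dots> = fps_dil (cst a) hgen * hinv *
      ((hgen * fps_dil (cst a) hinv) * fps_map (theta a) hinv)"
    by (simp add: mult_ac)
  finally show ?thesis using 1 by simp
qed

section \<open>Macdonald's operator\<close>

text \<open>For $\omega = \sum_j h_j[A] T^j$ this is the translation $f \mapsto f[X + Ay]$, a polynomial in \<open>y\<close>,
  since $h_k[X + Ay] = \sum_j h_j[A]\, y^j h_{k-j}[X]$.\<close>

definition tau :: "'a::comm_ring_1 fps \<Rightarrow> 'a sym \<Rightarrow> 'a sym poly" where
  "tau \<omega> = hsubst (\<lambda>c. [:cst c:]) (\<lambda>k. \<Sum>j\<le>k. monom (cst (fps_nth \<omega> j) * hvar (k - j)) j)"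

lemma const_poly_hom: "comm_ring_hom (\<lambda>c :: 'b::comm_ring_1. [:c:])"
  by unfold_locales (auto simp: one_pCons)

lemma hom_comp: "comm_ring_hom f \<Longrightarrow> comm_ring_hom g \<Longrightarrow> comm_ring_hom (\<lambda>x. g (f x))"
proof -
  assume "comm_ring_hom f" "comm_ring_hom g"
  then interpret f: comm_ring_hom f + g: comm_ring_hom g .
  show ?thesis by unfold_locales (auto simp: f.hom_add f.hom_mult g.hom_add g.hom_mult)
qed

lemma cst_poly_hom: "comm_ring_hom (\<lambda>c :: 'a::comm_ring_1. [:cst c:])"
  by (rule hom_comp[OF cst_hom const_poly_hom])

lemma tau_hom: "comm_ring_hom (tau \<omega>)"
  unfolding tau_def by (rule hsubst_hom[OF cst_poly_hom])

lemma tau_cst [simp]: "tau \<omega> (cst c) = [:cst c:]"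
  by (simp add: tau_def hsubst_cst[OF cst_poly_hom])

lemma tau_hvar:
  assumes "fps_nth \<omega> 0 = 1"
  shows "tau \<omega> (hvar k) = (\<Sum>j\<le>k. monom (cst (fps_nth \<omega> j) * hvar (k - j)) j)"
  unfolding tau_def by (rule hsubst_hvar[OF cst_poly_hom]) (simp add: assms)

text \<open>$\omega(yT)$, as a series in \<open>T\<close>. In this form the translation multiplies the generating series
  $H(T)$ by a factor.\<close>

definition graded_gen :: "'a::comm_ring_1 fps \<Rightarrow> 'a sym poly fps" where
  "graded_gen \<omega> = Abs_fps (\<lambda>j. monom (cst (fps_nth \<omega> j)) j)"

lemma monom_sum: "monom (\<Sum>i\<in>A. f i) n = (\<Sum>i\<in>A. monom (f i) n)"
  by (induction A rule: infinite_finite_induct) (simp_all flip: add_monom)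

lemma graded_gen_mult: "graded_gen (f * g) = graded_gen f * graded_gen g"
  by (auto simp: fps_eq_iff graded_gen_def fps_mult_nth mult_monom cst.hom_sum cst.hom_mult monom_sum
      intro!: sum.cong)

lemma graded_gen_dil:
  "graded_gen (fps_dil a f) = fps_dil [:cst a:] (graded_gen f)"
  by (simp add: fps_eq_iff graded_gen_def cst.hom_mult cst.hom_power smult_monom poly_const_pow)

lemma tau_hgen:
  assumes "fps_nth \<omega> 0 = 1"
  shows "fps_map (tau \<omega>) hgen = fps_map (\<lambda>c. [:c:]) hgen * graded_gen \<omega>"
proof (rule fps_ext)
  fix n
  have "(\<Sum>j\<le>n. monom (cst (fps_nth \<omega> j) * hvar (n - j)) j) =
      (\<Sum>i=0..n. [:hvar i:] * monom (cst (fps_nth \<omega> (n - i))) (n - i))"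
    by (rule sum.reindex_bij_witness[of _ "\<lambda>i. n - i" "\<lambda>i. n - i"]) (auto simp: smult_monom mult_ac)
  thus "fps_nth (fps_map (tau \<omega>) hgen) n = fps_nth (fps_map (\<lambda>c. [:c:]) hgen * graded_gen \<omega>) n"
    by (simp add: tau_hvar assms fps_mult_nth graded_gen_def)
qed

text \<open>Put $y = 1/v$. Then \<open>pairing g k P\<close> is the coefficient of $v^{-k}$ in the Laurent series
  $g(v)\,P(1/v)$, and \<open>shifted g k\<close> is the sequence of the coefficients of \<open>g\<close> that enter.\<close>

definition shifted :: "'a::zero fps \<Rightarrow> nat \<Rightarrow> nat \<Rightarrow> 'a" where
  "shifted g k s = (if k \<le> s then fps_nth g (s - k) else 0)"

definition pairing :: "'a::comm_ring_1 fps \<Rightarrow> nat \<Rightarrow> 'a poly \<Rightarrow> 'a" where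
  "pairing g k P = (\<Sum>s\<le>degree P. shifted g k s * coeff P s)"

lemma pairing_bound:
  assumes "degree P \<le> N"
  shows "pairing g k P = (\<Sum>s\<le>N. shifted g k s * coeff P s)"
  unfolding pairing_def using assms
  by (intro sum.mono_neutral_left) (auto simp: coeff_eq_0)

lemma pairing_add: "pairing g k (P + Q) = pairing g k P + pairing g k Q"
proof -
  let ?N = "max (degree P) (degree Q)"
  have "degree (P + Q) \<le> ?N" by (rule degree_add_le_max)
  thus ?thesis
    by (simp add: pairing_bound[of _ ?N] algebra_simps sum.distrib)
qed

lemma pairing_0 [simp]: "pairing g k 0 = 0" by (simp add: pairing_def)

lemma pairing_sum: "pairing g k (\<Sum>i\<in>A. P i) = (\<Sum>i\<in>A. pairing g k (P i))"
  by (induction A rule: infinite_finite_induct) (simp_all add: pairing_add)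

lemma pairing_monom: "pairing g k (monom c n) = shifted g k n * c"
proof -
  have "pairing g k (monom c n) = (\<Sum>s\<le>n. shifted g k s * (if s = n then c else 0))"
    by (subst pairing_bound[of _ n]) (auto simp: degree_monom_le intro!: sum.cong)
  thus ?thesis by (simp add: sum.delta if_distrib cong: if_cong)
qed

lemma pairing_smult: "pairing g k ([:c:] * P) = c * pairing g k P"
  by (subst pairing_bound[of _ "degree P"])
    (auto simp: degree_smult_le pairing_def sum_distrib_left mult_ac)

lemma pairing_mult:
  assumes "degree A \<le> a" "degree P \<le> N"
  shows "pairing g k (A * P) = (\<Sum>s\<le>N. (\<Sum>j\<le>a. coeff A j * shifted g k (s + j)) * coeff P s)"
proof -
  have "A * P = (\<Sum>j\<le>a. monom (coeff A j) j) * (\<Sum>s\<le>N. monom (coeff P s) s)"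
    using assms by (simp add: poly_as_sum_of_monoms')
  also have "\<dots> = (\<Sum>s\<le>N. \<Sum>j\<le>a. monom (coeff A j * coeff P s) (j + s))"
    by (subst sum.swap) (simp add: sum_product mult_monom)
  finally show ?thesis
    by (simp add: pairing_sum pairing_monom sum_distrib_right sum_distrib_left mult_ac add_ac)
qed

lemma (in comm_ring_hom) hom_pairing:
  "hom (pairing g k P) = pairing (fps_map hom g) k (map_poly hom P)"
proof -
  have "degree (map_poly hom P) \<le> degree P" by (rule degree_le) (simp add: coeff_eq_0)
  thus ?thesis
    by (simp add: pairing_bound[of "map_poly hom P" "degree P"])
      (auto simp: pairing_def hom_distribs shifted_def intro!: sum.cong)
qed

text \<open>The generating series $\sum_j h_j[A]T^j$ for $A = 1-t$; the next definition is the one for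
  $A = (1-q)(1-t)$.\<close>

definition omega1 :: "'a::field \<Rightarrow> 'a fps" where
  "omega1 t = (1 - fps_const t * fps_X) * inverse (1 - fps_X)"

definition omega2 :: "'a::field \<Rightarrow> 'a \<Rightarrow> 'a fps" where
  "omega2 q t = omega1 t * inverse (fps_dil q (omega1 t))"

text \<open>Macdonald's operator: the constant term of $f[X + (1-q)(1-t)/v]\,\sum_k (-v)^k e_k$.\<close>

definition D0 :: "'a::field \<Rightarrow> 'a \<Rightarrow> 'a sym \<Rightarrow> 'a sym" where
  "D0 q t F = pairing hinv 0 (tau (omega2 q t) F)"

definition gser :: "'a::field \<Rightarrow> 'a sym fps" where
  "gser q = fps_dil (cst q) hgen * hinv"

text \<open>The conjugate of Macdonald's operator under $f \mapsto f[X(1-q)]$. The factor $1-q$ disappears from the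
  translation and enters the series instead, which becomes $H(qv)/H(v)$.\<close>

definition Dq :: "'a::field \<Rightarrow> 'a \<Rightarrow> 'a sym \<Rightarrow> 'a sym" where
  "Dq q t F = pairing (gser q) 0 (tau (omega1 t) F)"

lemma fps_dil_const [simp]: "fps_dil q (fps_const c) = fps_const c"
  by (auto simp: fps_eq_iff)

lemma fps_dil_X: "fps_dil q fps_X = fps_const q * (fps_X :: 'a::comm_ring_1 fps)"
  by (auto simp: fps_eq_iff fps_X_def)

lemma fps_dil_inverse:
  fixes f :: "'a::field fps"
  assumes "fps_nth f 0 \<noteq> 0"
  shows "fps_dil q (inverse f) = inverse (fps_dil q f)"
proof -
  interpret d: comm_ring_hom "fps_dil q" by (rule fps_dil_hom)
  have "fps_dil q (inverse f) * fps_dil q f = 1"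
    using inverse_mult_eq_1[OF assms] by (metis d.hom_mult d.hom_one)
  thus ?thesis using fps_inverse_unique by (metis mult.commute)
qed

lemma omega1_0 [simp]: "fps_nth (omega1 t) 0 = 1"
  by (simp add: omega1_def)

lemma omega1_Suc: "fps_nth (omega1 t) j = (if j = 0 then 1 else 1 - t)"
proof -
  have "inverse (1 - fps_X :: 'a fps) = Abs_fps (\<lambda>_. 1)"
    using fps_inverse_gp' by (metis fps_inverse_idempotent fps_nth_Abs_fps one_neq_zero)
  thus ?thesis by (cases j) (simp_all add: omega1_def left_diff_distrib mult.assoc)
qed

lemma omega2_0 [simp]: "fps_nth (omega2 q t) 0 = 1"
  by (simp add: omega2_def)

lemma omega2_eq:
  "omega2 q t = (1 - fps_const q * fps_X) * (1 - fps_const t * fps_X) *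
     inverse ((1 - fps_X) * (1 - fps_const (q * t) * fps_X))"
proof -
  interpret d: comm_ring_hom "fps_dil q" by (rule fps_dil_hom)
  have "fps_dil q (omega1 t) = (1 - fps_const (q * t) * fps_X) * inverse (1 - fps_const q * fps_X)"
    by (simp add: omega1_def d.hom_mult fps_dil_inverse d.hom_minus fps_dil_X mult_ac
        flip: fps_const_mult)
  thus ?thesis by (simp add: omega2_def omega1_def fps_inverse_mult mult_ac)
qed

lemma omega2_commute: "omega2 q t = omega2 t q"
  by (simp add: omega2_eq mult_ac)

text \<open>The source of the second triangularity of the Macdonald functions: an eigenvector found for $(q,t)$ is an
  eigenvector for $(t,q)$.\<close>

lemma D0_commute: "D0 q t = D0 t q"
  by (simp add: D0_def omega2_commute fun_eq_iff)

lemma omega2_1: "fps_nth (omega2 q t) 1 = (1 - q) * (1 - t)"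
proof -
  have "omega2 q t * fps_dil q (omega1 t) = omega1 t"
    by (simp add: omega2_def mult.assoc inverse_mult_eq_1)
  hence "fps_nth (omega2 q t * fps_dil q (omega1 t)) 1 = 1 - t" by (simp add: omega1_Suc)
  thus ?thesis by (simp add: fps_mult_nth omega1_Suc algebra_simps)
qed

text \<open>Both sides are ring homomorphisms in \<open>F\<close> with the same constants, so it suffices to compare the images
  of $H(T)$. They are $H(T)/H(qT)$ times $\omega_2(yT)$ and $\omega_1(yT)/\omega_1(qyT)$ respectively.\<close>

lemma theta_tau: "map_poly (theta q) (tau (omega2 q t) F) = tau (omega1 t) (theta q F)"
proof -
  let ?mp = "map_poly (theta q)" and ?c = "\<lambda>c :: 'a sym. [:c:]"
  let ?H = "fps_map ?c hgen" and ?I = "fps_map ?c hinv" and ?d = "fps_dil [:cst q:]"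
  interpret th: comm_ring_hom "theta q" by (rule theta_hom)
  interpret mp: map_poly_comm_ring_hom "theta q :: 'a sym \<Rightarrow> 'a sym" ..
  interpret t1: comm_ring_hom "tau (omega1 t)" by (rule tau_hom)
  interpret c: comm_ring_hom ?c by (rule const_poly_hom)
  interpret fc: comm_ring_hom "fps_map ?c" by (rule fps_map_hom[OF const_poly_hom])
  interpret f1: comm_ring_hom "fps_map (tau (omega1 t))" by (rule fps_map_hom[OF tau_hom])
  interpret fm: comm_ring_hom "fps_map ?mp" by (rule fps_map_hom) (rule mp.comm_ring_hom_axioms)
  interpret d: comm_ring_hom ?d by (rule fps_dil_hom)
  let ?W1 = "graded_gen (omega1 t)" and ?W2 = "graded_gen (omega2 q t)"
  have W: "?W2 * ?d ?W1 = ?W1"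
    by (simp add: omega2_def mult.assoc inverse_mult_eq_1 flip: graded_gen_dil graded_gen_mult)
  have HI: "?H * ?I = 1" by (simp add: hgen_hinv flip: fc.hom_mult)
  have "fps_map (tau (omega1 t)) hgen * fps_map (tau (omega1 t)) hinv = 1"
    by (simp add: hgen_hinv flip: f1.hom_mult)
  hence inv1: "?H * ?W1 * fps_map (tau (omega1 t)) hinv = 1" by (simp add: tau_hgen)
  have mc: "?mp (?c x) = ?c (theta q x)" for x by (rule poly_eqI) (simp add: coeff_pCons split: nat.split)
  have mm: "fps_map ?mp (graded_gen \<omega>) = graded_gen \<omega>" for \<omega>
    by (simp add: fps_eq_iff graded_gen_def)
  have L: "fps_map ?mp (fps_map (tau (omega2 q t)) hgen) = ?H * ?d ?I * ?W2"
  proof -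
    have "fps_map ?mp ?H = fps_map ?c (fps_map (theta q) hgen)"
      by (simp add: fps_eq_iff mc)
    also have "\<dots> = ?H * ?d ?I"
      by (simp add: theta_hgen fc.hom_mult fps_map_dil[OF const_poly_hom])
    finally show ?thesis by (simp add: tau_hgen fm.hom_mult mm)
  qed
  have R: "fps_map (tau (omega1 t)) (fps_map (theta q) hgen) =
      ?H * ?W1 * ?d (fps_map (tau (omega1 t)) hinv)"
    by (simp add: theta_hgen f1.hom_mult fps_map_dil[OF tau_hom] tau_hgen)
  have "fps_map ?mp (fps_map (tau (omega2 q t)) hgen) =
      ?H * ?d ?I * ?W2 * ?d (?H * ?W1 * fps_map (tau (omega1 t)) hinv)"
    by (simp add: L inv1)
  also have "\<dots> = ?H * ?d (?H * ?I) * (?W2 * ?d ?W1) * ?d (fps_map (tau (omega1 t)) hinv)"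
    by (simp only: d.hom_mult mult_ac)
  also have "\<dots> = fps_map (tau (omega1 t)) (fps_map (theta q) hgen)"
    by (simp add: HI W R)
  finally have gen: "?mp (tau (omega2 q t) (hvar k)) = tau (omega1 t) (theta q (hvar k))" for k
    by (simp add: fps_eq_iff)
  define f where "f = (\<lambda>k. \<Sum>j\<le>k. monom (cst (fps_nth (omega2 q t) j) * hvar (k - j)) j :: 'a sym poly)"
  define g where "g = (\<lambda>k. fps_nth (hgen * fps_dil (cst q) hinv) k :: 'a sym)"
  have f: "tau (omega2 q t) (hvar k) = f k" for k by (simp add: f_def tau_hvar)
  have g: "theta q (hvar k) = g k" for k by (simp add: g_def theta_hvar)
  have "?mp (hsubst (\<lambda>c. [:cst c:]) f F) = hsubst (\<lambda>x. ?mp [:cst x:]) (\<lambda>k. ?mp (f k)) F"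
    by (rule hom_hsubst) (rule mp.comm_ring_hom_axioms)
  moreover have "tau (omega1 t) (hsubst cst g F) =
      hsubst (\<lambda>x. tau (omega1 t) (cst x)) (\<lambda>k. tau (omega1 t) (g k)) F"
    by (rule hom_hsubst[OF tau_hom])
  moreover have "?mp (f k) = tau (omega1 t) (g k)" for k
    using gen[of k] by (simp only: f g)
  ultimately show ?thesis by (simp add: tau_def[of "omega2 q t"] theta_def[of q, abs_def, symmetric] mc flip: f_def g_def) (simp add: theta_def flip: g_def)
qed

lemma theta_D0: "theta q (D0 q t F) = Dq q t (theta q F)"
proof -
  interpret th: comm_ring_hom "theta q" by (rule theta_hom)
  show ?thesis by (simp add: D0_def Dq_def th.hom_pairing theta_tau theta_hinv gser_def)
qed

section \<open>Triangularity of the operator\<close>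

definition hprod :: "nat list \<Rightarrow> 'a::comm_ring_1 sym" where
  "hprod \<gamma> = prod_list (map hvar \<gamma>)"

definition hmon :: "nat list \<Rightarrow> nat multiset" where
  "hmon \<gamma> = image_mset (\<lambda>x. x - 1) (filter_mset (\<lambda>x. x \<noteq> 0) (mset \<gamma>))"

lemma hmon_Nil [simp]: "hmon [] = {#}" by (simp add: hmon_def)

lemma hmon_Cons: "hmon (a # \<gamma>) = hmon [a] + hmon \<gamma>" by (simp add: hmon_def)

lemma hvar_eq_single: "hvar a = Poly_Mapping.single (hmon [a]) 1"
  by (simp add: hvar_def hmon_def)

lemma hprod_eq_single: "hprod \<gamma> = Poly_Mapping.single (hmon \<gamma>) 1"
  by (induction \<gamma>) (simp_all add: hprod_def hvar_eq_single mult_single flip: hmon_Cons)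

lemma hprod_Nil [simp]: "hprod [] = 1" and hprod_Cons [simp]: "hprod (a # \<gamma>) = hvar a * hprod \<gamma>"
  by (simp_all add: hprod_def)

text \<open>The exponent sequences (not sorted, zeros allowed) that occur when the operator lowers the degree of
  $h_\beta$ by \<open>k\<close>. The bound on the partial sums is dominance up to the shift by \<open>k\<close>, and it is stable
  under prefixing a part. For $k = 0$ sorting only increases partial sums, so only partitions that
  dominate $\beta$ arise (\<open>lowered_dominates\<close>).\<close>

definition lowered :: "nat \<Rightarrow> nat list \<Rightarrow> nat list set" where
  "lowered k \<beta> = {\<gamma>. length \<gamma> = length \<beta> \<and> sum_list \<gamma> + k = sum_list \<beta> \<and>
     (\<forall>j. sum_list (take j \<beta>) \<le> sum_list (take j \<gamma>) + k)}"

lemma lowered_Cons: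
  assumes "\<gamma> \<in> lowered k' \<beta>" "b + k = a + k'"
  shows "b # \<gamma> \<in> lowered k (a # \<beta>)"
proof -
  have "sum_list (take j (a # \<beta>)) \<le> sum_list (take j (b # \<gamma>)) + k" for j
  proof (cases j)
    case (Suc i)
    have "sum_list (take i \<beta>) \<le> sum_list (take i \<gamma>) + k'" using assms(1) by (simp add: lowered_def)
    with assms(2) Suc show ?thesis by simp
  qed simp
  thus ?thesis using assms by (simp add: lowered_def)
qed

locale subring =
  fixes R :: "'a::comm_ring_1 set"
  assumes one_mem: "1 \<in> R"
    and diff_mem: "x \<in> R \<Longrightarrow> y \<in> R \<Longrightarrow> x - y \<in> R"
    and mult_mem: "x \<in> R \<Longrightarrow> y \<in> R \<Longrightarrow> x * y \<in> R"
begin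

lemma zero_mem: "0 \<in> R" using diff_mem[OF one_mem one_mem] by simp
lemma uminus_mem: "x \<in> R \<Longrightarrow> - x \<in> R" using diff_mem[OF zero_mem] by fastforce
lemma add_mem: "x \<in> R \<Longrightarrow> y \<in> R \<Longrightarrow> x + y \<in> R" using diff_mem[OF _ uminus_mem] by fastforce
lemma power_mem: "x \<in> R \<Longrightarrow> x ^ n \<in> R" by (induction n) (auto simp: one_mem mult_mem)
lemma prod_mem: "(\<And>i. i \<in> A \<Longrightarrow> f i \<in> R) \<Longrightarrow> prod f A \<in> R"
  by (induction A rule: infinite_finite_induct) (auto simp: one_mem mult_mem)

end

text \<open>The powers of the ideal generated by \<open>e\<close>. For $e = 1-t$ they measure how fast a coefficient vanishes as
  $t \to 1$.\<close>

locale filtered_ring = subring R for R :: "'a::comm_ring_1 set" +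
  fixes e :: 'a
  assumes e_mem: "e \<in> R"
begin

definition fil :: "nat \<Rightarrow> 'a set" where "fil n = (\<lambda>x. e ^ n * x) ` R"

lemma fil_add: "x \<in> fil n \<Longrightarrow> y \<in> fil n \<Longrightarrow> x + y \<in> fil n"
  by (auto simp: fil_def image_iff intro!: bexI[of _ "_ + _"] add_mem simp flip: distrib_left)

lemma fil_0 [simp]: "fil 0 = R" by (simp add: fil_def)

lemma fil_zero: "0 \<in> fil n" using zero_mem by (force simp: fil_def)

lemma fil_uminus: "x \<in> fil n \<Longrightarrow> - x \<in> fil n"
  by (auto simp: fil_def image_iff intro!: bexI[of _ "- _"] uminus_mem)

lemma fil_mult: "x \<in> fil n \<Longrightarrow> y \<in> fil m \<Longrightarrow> x * y \<in> fil (n + m)"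
proof -
  assume "x \<in> fil n" "y \<in> fil m"
  then obtain a b where "x = e ^ n * a" "y = e ^ m * b" "a \<in> R" "b \<in> R" by (auto simp: fil_def)
  hence "x * y = e ^ (n + m) * (a * b)" "a * b \<in> R" by (auto simp: power_add mult_ac mult_mem)
  thus ?thesis by (auto simp: fil_def)
qed

lemma fil_e: "e \<in> fil 1" using one_mem by (force simp: fil_def)

lemma fil_mono: assumes "n \<le> m" shows "fil m \<subseteq> fil n"
proof -
  have "e ^ m * x = e ^ n * (e ^ (m - n) * x)" for x
    using assms by (simp flip: mult.assoc power_add)
  thus ?thesis by (auto simp: fil_def intro!: mult_mem power_mem e_mem)
qed

text \<open>Combinations of the monomials in \<open>A\<close> with all coefficients in $e^n R$.\<close>

definition spn :: "nat \<Rightarrow> nat multiset set \<Rightarrow> 'a sym set" where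
  "spn n A = {F. \<forall>m. mcoeff F m \<in> fil n \<and> (mcoeff F m \<noteq> 0 \<longrightarrow> m \<in> A)}"

lemma spn_zero: "0 \<in> spn n A" by (simp add: spn_def fil_zero)

lemma spn_add: "F \<in> spn n A \<Longrightarrow> G \<in> spn n A \<Longrightarrow> F + G \<in> spn n A"
  by (auto simp: spn_def lookup_add fil_add) (metis add.right_neutral)

lemma spn_uminus: "F \<in> spn n A \<Longrightarrow> - F \<in> spn n A"
  by (auto simp: spn_def fil_uminus)

lemma spn_diff: "F \<in> spn n A \<Longrightarrow> G \<in> spn n A \<Longrightarrow> F - G \<in> spn n A"
  using spn_add[OF _ spn_uminus, of F n A G] by simp

lemma spn_sum: "(\<And>i. i \<in> I \<Longrightarrow> F i \<in> spn n A) \<Longrightarrow> sum F I \<in> spn n A"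
  by (induction I rule: infinite_finite_induct) (auto simp: spn_zero spn_add)

lemma spn_mono: "F \<in> spn m A \<Longrightarrow> n \<le> m \<Longrightarrow> A \<subseteq> B \<Longrightarrow> F \<in> spn n B"
  using fil_mono by (auto simp: spn_def) blast

lemma spn_cst: "c \<in> fil n \<Longrightarrow> F \<in> spn m A \<Longrightarrow> cst c * F \<in> spn (n + m) A"
  by (auto simp: spn_def lookup_cst_mult fil_mult) (metis mult_zero_right)

lemma spn_cst0: "c \<in> R \<Longrightarrow> F \<in> spn m A \<Longrightarrow> cst c * F \<in> spn m A"
  using spn_cst[of c 0 F m A] by simp

lemma spn_cst1: "F \<in> spn m A \<Longrightarrow> cst e * F \<in> spn (Suc m) A"
  using spn_cst[of e 1 F m A] by (simp add: fil_e[simplified])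

lemma spn_single: "c \<in> fil n \<Longrightarrow> m \<in> A \<Longrightarrow> Poly_Mapping.single m c \<in> spn n A"
  by (auto simp: spn_def lookup_single when_def fil_zero)

lemma spn_hvar:
  assumes "F \<in> spn n A" "\<And>m. m \<in> A \<Longrightarrow> hmon [a] + m \<in> B"
  shows "hvar a * F \<in> spn n B"
proof -
  have "hvar a * F = (\<Sum>m\<in>supp F. Poly_Mapping.single (hmon [a] + m) (mcoeff F m))"
    by (subst (1) sym_sum_singles[of F]) (simp add: sum_distrib_left hvar_eq_single mult_single)
  also have "\<dots> \<in> spn n B"
    using assms by (intro spn_sum spn_single) (auto simp: spn_def in_keys_iff)
  finally show ?thesis .
qed

lemma spn_hvar_lowered:
  assumes "F \<in> spn n (hmon ` lowered k' \<beta>)" "b + k = a + k'"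
  shows "hvar b * F \<in> spn n (hmon ` lowered k (a # \<beta>))"
proof (rule spn_hvar[OF assms(1)])
  fix m assume "m \<in> hmon ` lowered k' \<beta>"
  then obtain \<gamma> where "\<gamma> \<in> lowered k' \<beta>" "m = hmon \<gamma>" by auto
  thus "hmon [b] + m \<in> hmon ` lowered k (a # \<beta>)"
    using lowered_Cons[OF _ assms(2)] by (auto simp flip: hmon_Cons)
qed

end

text \<open>The induction on $\beta$ that establishes triangularity involves all coefficients of the Laurent series
  whose constant term is the conjugated operator.\<close>

definition Tq :: "'a::field \<Rightarrow> 'a \<Rightarrow> nat \<Rightarrow> nat list \<Rightarrow> 'a sym" where
  "Tq q t k \<beta> = pairing (gser q) k (tau (omega1 t) (hprod \<beta>))"

lemma hgen_gser: "hgen * gser q = fps_dil (cst q) hgen"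
proof -
  have "hgen * gser q = fps_dil (cst q) hgen * (hgen * hinv)" unfolding gser_def by (simp only: mult_ac)
  thus ?thesis by (simp add: hgen_hinv)
qed

lemma gser_0 [simp]: "fps_nth (gser q) 0 = 1"
  by (simp add: gser_def)

lemma gser_conv: "(\<Sum>b\<le>c. hvar b * fps_nth (gser q) (c - b)) = cst (q ^ c) * hvar c"
  using arg_cong[OF hgen_gser[of q], of "\<lambda>f. fps_nth f c"]
  by (simp add: fps_mult_nth atLeast0AtMost cst.hom_power)

text \<open>The convolution with the $h_b$, $b \le a$, is the beginning of the full convolution given by
  $H(v)\cdot H(qv)/H(v) = H(qv)$; the second sum is the missing end, $b > a$.\<close>

lemma shifted_gser_conv:
  fixes q :: "'a::field"
  assumes "s \<le> N"
  shows "(\<Sum>j\<le>a. hvar (a - j) * shifted (gser q) k (s + j)) + (\<Sum>r=1..N. hvar (a + r) * shifted (gser q) (k + r) s) =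
    (if k \<le> s + a then cst (q ^ (s + a - k)) * hvar (s + a - k) else 0)"
proof (cases "k \<le> s + a")
  case False
  thus ?thesis by (simp add: shifted_def)
next
  case True
  define c where "c = s + a - k"
  have *: "(\<Sum>j\<le>a. hvar (a - j) * shifted (gser q) k (s + j)) =
      (\<Sum>b | b \<le> a \<and> b \<le> c. hvar b * fps_nth (gser q) (c - b))"
  proof -
    have "(\<Sum>j\<le>a. hvar (a - j) * shifted (gser q) k (s + j)) =
        (\<Sum>b\<le>a. hvar b * shifted (gser q) k (s + (a - b)))"
      by (rule sum.reindex_bij_witness[of _ "\<lambda>i. a - i" "\<lambda>i. a - i"]) auto
    also have "\<dots> = (\<Sum>b\<le>a. if b \<le> c then hvar b * fps_nth (gser q) (c - b) else 0)"
      using True by (intro sum.cong) (auto simp: shifted_def c_def algebra_simps)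
    also have "\<dots> = (\<Sum>b\<in>{b\<in>{..a}. b \<le> c}. hvar b * fps_nth (gser q) (c - b))"
      by (rule sum.inter_filter[symmetric]) simp
    finally show ?thesis by simp
  qed
  have "(\<Sum>r=1..N. hvar (a + r) * shifted (gser q) (k + r) s) =
      (\<Sum>r\<in>{1..N}. if a + r \<le> c then hvar (a + r) * fps_nth (gser q) (c - (a + r)) else 0)"
    using True by (intro sum.cong) (auto simp: shifted_def c_def algebra_simps)
  also have "\<dots> = (\<Sum>r\<in>{r\<in>{1..N}. a + r \<le> c}. hvar (a + r) * fps_nth (gser q) (c - (a + r)))"
    by (rule sum.inter_filter[symmetric]) simp
  also have "\<dots> = (\<Sum>b | a < b \<and> b \<le> c. hvar b * fps_nth (gser q) (c - b))"
    by (rule sum.reindex_bij_witness[of _ "\<lambda>b. b - a" "\<lambda>r. a + r"])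
      (use True assms in \<open>auto simp: c_def\<close>)
  finally have "(\<Sum>j\<le>a. hvar (a - j) * shifted (gser q) k (s + j)) +
      (\<Sum>r=1..N. hvar (a + r) * shifted (gser q) (k + r) s) =
      (\<Sum>b | b \<le> a \<and> b \<le> c. hvar b * fps_nth (gser q) (c - b)) +
      (\<Sum>b | a < b \<and> b \<le> c. hvar b * fps_nth (gser q) (c - b))" by (simp add: *)
  also have "\<dots> = (\<Sum>b\<in>{b. b \<le> a \<and> b \<le> c} \<union> {b. a < b \<and> b \<le> c}. hvar b * fps_nth (gser q) (c - b))"
    by (rule sum.union_disjoint[symmetric]) auto
  also have "{b. b \<le> a \<and> b \<le> c} \<union> {b. a < b \<and> b \<le> c} = {..c}" by auto
  finally show ?thesis using True gser_conv[of q c] by (simp add: c_def)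
qed

lemma tau1_coeff:
  "coeff (tau (omega1 t) (hvar a)) j =
     (if j = 0 then hvar a else if j \<le> a then cst (1 - t) * hvar (a - j) else 0)"
  by (auto simp: tau_hvar coeff_sum omega1_Suc sum.delta if_distrib cong: if_cong)

lemma tau1_degree: "degree (tau (omega1 t) (hvar a)) \<le> a"
  by (rule degree_le) (simp add: tau1_coeff)

text \<open>The translation sends $h_a$ to $h_a + (1-t)\sum_{j\ge1} h_{a-j}y^j = t h_a + (1-t)\sum_{j\ge0} h_{a-j}y^j$,
  and the convolution formula turns the last sum into terms with first factor $h_b$, where either a power
  of \<open>q\<close> appears or $b > a$. Every term except the first carries the factor $1-t$, and in each term the
  first part $b$ and the degree lost by the other parts are balanced as \<open>lowered_Cons\<close> requires.\<close>

lemma Tq_Cons: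
  fixes q t :: "'a::field"
  assumes "degree (tau (omega1 t) (hprod \<beta>)) \<le> N"
  shows "Tq q t k (a # \<beta>) = cst t * (hvar a * Tq q t k \<beta>) +
     cst (1 - t) * (\<Sum>s | s \<le> N \<and> k \<le> s + a.
        cst (q ^ (s + a - k)) * (hvar (s + a - k) * coeff (tau (omega1 t) (hprod \<beta>)) s)) -
     cst (1 - t) * (\<Sum>r=1..N. hvar (a + r) * Tq q t (k + r) \<beta>)"
proof -
  interpret t1: comm_ring_hom "tau (omega1 t)" by (rule tau_hom)
  define P where "P = tau (omega1 t) (hprod \<beta>)"
  let ?A = "tau (omega1 t) (hvar a)" and ?g = "gser q"
  have T: "Tq q t k' \<beta> = (\<Sum>s\<le>N. shifted ?g k' s * coeff P s)" for k'
    using assms by (simp add: Tq_def P_def pairing_bound)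
  have "(\<Sum>j\<le>a. coeff ?A j * shifted ?g k (s + j)) =
      cst t * (hvar a * shifted ?g k s) +
      cst (1 - t) * (if k \<le> s + a then cst (q ^ (s + a - k)) * hvar (s + a - k) else 0) -
      cst (1 - t) * (\<Sum>r=1..N. hvar (a + r) * shifted ?g (k + r) s)" if "s \<le> N" for s
  proof -
    have "(\<Sum>j\<le>a. coeff ?A j * shifted ?g k (s + j)) =
        (\<Sum>j\<le>a. (if j = 0 then cst t * (hvar a * shifted ?g k s) else 0) +
            cst (1 - t) * (hvar (a - j) * shifted ?g k (s + j)))"
      by (intro sum.cong) (auto simp: tau1_coeff cst.hom_minus algebra_simps)
    also have "\<dots> = cst t * (hvar a * shifted ?g k s) +
        cst (1 - t) * (\<Sum>j\<le>a. hvar (a - j) * shifted ?g k (s + j))"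
      by (simp add: sum.distrib sum_distrib_left)
    also have "(\<Sum>j\<le>a. hvar (a - j) * shifted ?g k (s + j)) =
        (if k \<le> s + a then cst (q ^ (s + a - k)) * hvar (s + a - k) else 0) -
        (\<Sum>r=1..N. hvar (a + r) * shifted ?g (k + r) s)"
      using shifted_gser_conv[OF that, where a = a and k = k and q = q] by (simp add: algebra_simps)
    finally show ?thesis by (simp add: algebra_simps)
  qed
  hence *: "Tq q t k (a # \<beta>) = (\<Sum>s\<le>N. (cst t * (hvar a * shifted ?g k s) +
      cst (1 - t) * (if k \<le> s + a then cst (q ^ (s + a - k)) * hvar (s + a - k) else 0) -
      cst (1 - t) * (\<Sum>r=1..N. hvar (a + r) * shifted ?g (k + r) s)) * coeff P s)"
    using pairing_mult[OF tau1_degree assms, of ?g k]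
    by (simp add: Tq_def t1.hom_mult P_def)
  have "Tq q t k (a # \<beta>) = (\<Sum>s\<le>N. cst t * (hvar a * (shifted ?g k s * coeff P s)) +
      cst (1 - t) * (if k \<le> s + a then cst (q ^ (s + a - k)) * (hvar (s + a - k) * coeff P s) else 0) -
      cst (1 - t) * (\<Sum>r=1..N. hvar (a + r) * (shifted ?g (k + r) s * coeff P s)))"
    unfolding * by (intro sum.cong refl) (auto simp: left_diff_distrib distrib_right sum_distrib_right mult.assoc)
  also have "\<dots> = cst t * (hvar a * (\<Sum>s\<le>N. shifted ?g k s * coeff P s)) +
      cst (1 - t) * (\<Sum>s\<le>N. if k \<le> s + a then cst (q ^ (s + a - k)) * (hvar (s + a - k) * coeff P s) else 0) -
      cst (1 - t) * (\<Sum>s\<le>N. \<Sum>r=1..N. hvar (a + r) * (shifted ?g (k + r) s * coeff P s))"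
    unfolding sum.distrib sum_subtractf sum_distrib_left by (rule refl)
  also have "(\<Sum>s\<le>N. \<Sum>r=1..N. hvar (a + r) * (shifted ?g (k + r) s * coeff P s)) =
      (\<Sum>r=1..N. hvar (a + r) * Tq q t (k + r) \<beta>)"
    by (subst sum.swap) (simp add: T sum_distrib_left)
  also have "(\<Sum>s\<le>N. if k \<le> s + a then cst (q ^ (s + a - k)) * (hvar (s + a - k) * coeff P s) else 0) =
      (\<Sum>s\<in>{s\<in>{..N}. k \<le> s + a}. cst (q ^ (s + a - k)) * (hvar (s + a - k) * coeff P s))"
    by (rule sum.inter_filter[symmetric]) simp
  finally show ?thesis by (simp add: T P_def)
qed

text \<open>The eigenvalue $1 - (1-q)(1-t)B_\lambda(q,t)$ (see \<open>dval_Bsum\<close>), in the form in which the recursion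
  produces it.\<close>

fun dval :: "'a::comm_ring_1 \<Rightarrow> 'a \<Rightarrow> nat list \<Rightarrow> 'a" where
  "dval q t [] = 1"
| "dval q t (a # \<beta>) = t * dval q t \<beta> + (1 - t) * q ^ a"

locale macdonald_ring = filtered_ring R "1 - t" for R :: "'a::field set" and q t :: 'a +
  assumes q_mem: "q \<in> R"
begin

lemma t_mem: "t \<in> R" using diff_mem[OF one_mem e_mem] by simp

lemma hprod_spn: "hprod \<beta> \<in> spn 0 (hmon ` lowered 0 \<beta>)"
  unfolding hprod_eq_single by (rule spn_single) (auto simp: one_mem lowered_def)

lemma tau_spn:
  "coeff (tau (omega1 t) (hprod \<beta>)) 0 = hprod \<beta> \<and>
   (\<forall>s\<ge>1. coeff (tau (omega1 t) (hprod \<beta>)) s \<in> spn 1 (hmon ` lowered s \<beta>))"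
proof (induction \<beta>)
  case Nil
  interpret t1: comm_ring_hom "tau (omega1 t)" by (rule tau_hom)
  show ?case by (auto simp: spn_zero)
next
  case (Cons a \<beta>)
  interpret t1: comm_ring_hom "tau (omega1 t)" by (rule tau_hom)
  let ?A = "tau (omega1 t) (hvar a)" and ?P = "tau (omega1 t) (hprod \<beta>)"
  have P: "coeff ?P s \<in> spn 0 (hmon ` lowered s \<beta>)" for s
    using Cons hprod_spn spn_mono[of "coeff ?P s" 1 "hmon ` lowered s \<beta>" 0] by (cases "s = 0") auto
  have "coeff (?A * ?P) s \<in> spn 1 (hmon ` lowered s (a # \<beta>))" if "s \<ge> 1" for s
    unfolding coeff_mult
  proof (rule spn_sum)
    fix j assume j: "j \<in> {..s}"
    show "coeff ?A j * coeff ?P (s - j) \<in> spn 1 (hmon ` lowered s (a # \<beta>))"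
    proof (cases "j = 0")
      case True
      thus ?thesis using Cons that by (auto simp: tau1_coeff intro!: spn_hvar_lowered)
    next
      case False
      have "cst (1 - t) * (hvar (a - j) * coeff ?P (s - j)) \<in> spn (Suc 0) (hmon ` lowered s (a # \<beta>))" if "j \<le> a"
        using j that by (intro spn_cst1 spn_hvar_lowered[OF P]) auto
      thus ?thesis using False by (auto simp: tau1_coeff mult.assoc spn_zero)
    qed
  qed
  moreover have "coeff (?A * ?P) 0 = hvar a * hprod \<beta>" using Cons by (simp add: coeff_mult tau1_coeff)
  ultimately show ?case by (simp add: t1.hom_mult)
qed

text \<open>Triangularity. In the recursion the first term and the one with $s = 0$ contribute the diagonal entry
  $t\,d_\beta + (1-t)q^a$. The other terms have a factor $1-t$ from the recursion and another one from
  the translation or from the case $k \ge 1$ for the shorter sequence. This square is what makes the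
  eigenvectors tend to $h_\lambda$ for $t \to 1$.\<close>

lemma Tq_spn:
  "(\<forall>k\<ge>1. Tq q t k \<beta> \<in> spn 1 (hmon ` lowered k \<beta>)) \<and>
   Tq q t 0 \<beta> - cst (dval q t \<beta>) * hprod \<beta> \<in> spn 2 (hmon ` (lowered 0 \<beta> - {\<beta>}))"
proof (induction \<beta>)
  case Nil
  interpret t1: comm_ring_hom "tau (omega1 t)" by (rule tau_hom)
  show ?case by (auto simp: Tq_def pairing_def shifted_def spn_zero)
next
  case (Cons a \<beta>)
  let ?P = "tau (omega1 t) (hprod \<beta>)"
  define N where "N = degree ?P"
  have P: "coeff ?P s \<in> spn 0 (hmon ` lowered s \<beta>)" for s
    using tau_spn[of \<beta>] hprod_spn spn_mono[of "coeff ?P s" 1 "hmon ` lowered s \<beta>" 0] by (cases "s = 0") auto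
  note rec = Tq_Cons[of t \<beta> N q, folded N_def, OF order_refl]
  have "Tq q t k (a # \<beta>) \<in> spn 1 (hmon ` lowered k (a # \<beta>))" if k: "k \<ge> 1" for k
    unfolding rec
  proof (intro spn_add spn_diff)
    show "cst t * (hvar a * Tq q t k \<beta>) \<in> spn 1 (hmon ` lowered k (a # \<beta>))"
      using Cons k by (intro spn_cst0 t_mem spn_hvar_lowered[where k' = k]) auto
    have "cst (1 - t) * (\<Sum>s | s \<le> N \<and> k \<le> s + a. cst (q ^ (s + a - k)) * (hvar (s + a - k) * coeff ?P s))
        \<in> spn (Suc 0) (hmon ` lowered k (a # \<beta>))"
      by (intro spn_cst1 spn_sum spn_cst0 power_mem q_mem spn_hvar_lowered[OF P]) auto
    thus "cst (1 - t) * (\<Sum>s | s \<le> N \<and> k \<le> s + a. cst (q ^ (s + a - k)) * (hvar (s + a - k) * coeff ?P s))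
        \<in> spn 1 (hmon ` lowered k (a # \<beta>))" by simp
    have "Tq q t (k + r) \<beta> \<in> spn 0 (hmon ` lowered (k + r) \<beta>)" for r
      by (rule spn_mono[of _ 1]) (use Cons k in auto)
    hence "cst (1 - t) * (\<Sum>r=1..N. hvar (a + r) * Tq q t (k + r) \<beta>)
        \<in> spn (Suc 0) (hmon ` lowered k (a # \<beta>))"
      by (intro spn_cst1 spn_sum spn_hvar_lowered[where k' = "k + _"]) auto
    thus "cst (1 - t) * (\<Sum>r=1..N. hvar (a + r) * Tq q t (k + r) \<beta>)
        \<in> spn 1 (hmon ` lowered k (a # \<beta>))" by simp
  qed
  moreover have "Tq q t 0 (a # \<beta>) - cst (dval q t (a # \<beta>)) * hprod (a # \<beta>) \<in>
      spn 2 (hmon ` (lowered 0 (a # \<beta>) - {a # \<beta>}))"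
  proof -
    let ?B = "hmon ` (lowered 0 (a # \<beta>) - {a # \<beta>})"
    define S where "S = (\<Sum>s=1..N. cst (q ^ (s + a)) * (hvar (s + a) * coeff ?P s))"
    define U where "U = (\<Sum>r=1..N. hvar (a + r) * Tq q t r \<beta>)"
    have "{s. s \<le> N \<and> 0 \<le> s + a} = insert 0 {1..N}" by auto
    hence T0: "Tq q t 0 (a # \<beta>) = cst t * (hvar a * Tq q t 0 \<beta>) +
        cst (1 - t) * (cst (q ^ a) * (hvar a * hprod \<beta>) + S) - cst (1 - t) * (hvar a * Tq q t 0 \<beta> - hvar a * Tq q t 0 \<beta> + U)"
      using rec[of 0 a] tau_spn[of \<beta>] by (simp add: S_def U_def)
    have eq: "Tq q t 0 (a # \<beta>) - cst (dval q t (a # \<beta>)) * hprod (a # \<beta>) =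
        cst t * (hvar a * (Tq q t 0 \<beta> - cst (dval q t \<beta>) * hprod \<beta>)) + cst (1 - t) * S - cst (1 - t) * U"
      unfolding T0 by (simp add: cst.hom_add cst.hom_mult cst.hom_minus algebra_simps)
    have aux: "hvar b * F \<in> spn n ?B" if "F \<in> spn n (hmon ` lowered k \<beta>)" "b = a + k" "k \<ge> 1" for F n b k
    proof (rule spn_hvar[OF that(1)])
      fix m assume "m \<in> hmon ` lowered k \<beta>"
      then obtain \<gamma> where g: "\<gamma> \<in> lowered k \<beta>" "m = hmon \<gamma>" by auto
      hence "b # \<gamma> \<in> lowered 0 (a # \<beta>)" by (intro lowered_Cons) (use that in auto)
      thus "hmon [b] + m \<in> ?B" using g(2) that by (auto simp flip: hmon_Cons)
    qed
    show ?thesis unfolding eq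
    proof (intro spn_add spn_diff)
      show "cst t * (hvar a * (Tq q t 0 \<beta> - cst (dval q t \<beta>) * hprod \<beta>)) \<in> spn 2 ?B"
      proof (intro spn_cst0 t_mem spn_hvar)
        show "Tq q t 0 \<beta> - cst (dval q t \<beta>) * hprod \<beta> \<in> spn 2 (hmon ` (lowered 0 \<beta> - {\<beta>}))"
          using Cons by simp
        fix m assume "m \<in> hmon ` (lowered 0 \<beta> - {\<beta>})"
        then obtain \<gamma> where g: "\<gamma> \<in> lowered 0 \<beta>" "\<gamma> \<noteq> \<beta>" "m = hmon \<gamma>" by auto
        thus "hmon [a] + m \<in> ?B" using lowered_Cons[OF g(1), of a 0 a] by (auto simp flip: hmon_Cons)
      qed
      have "cst (1 - t) * S \<in> spn (Suc (Suc 0)) ?B" unfolding S_def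
        by (rule spn_cst1, rule spn_sum, rule spn_cst0, intro power_mem q_mem, rule aux)
          (use tau_spn[of \<beta>] in auto)
      thus "cst (1 - t) * S \<in> spn 2 ?B" by (simp add: numeral_2_eq_2)
      have "cst (1 - t) * U \<in> spn (Suc (Suc 0)) ?B" unfolding U_def
        by (rule spn_cst1, rule spn_sum, rule aux) (use Cons in auto)
      thus "cst (1 - t) * U \<in> spn 2 ?B" by (simp add: numeral_2_eq_2)
    qed
  qed
  ultimately show ?case by blast
qed

end

section \<open>Dominance order\<close>

text \<open>In a decreasing list the first \<open>k\<close> entries have the largest sum among all choices of at most \<open>k\<close>
  entries. Hence sorting a sequence can only raise its partial sums.\<close>

lemma sum_mset_le_take_sorted:
  assumes "sorted_wrt (\<ge>) l" "S \<subseteq># mset l" "size S \<le> k"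
  shows "sum_mset S \<le> sum_list (take k (l :: nat list))"
  using assms
proof (induction l arbitrary: S k)
  case Nil
  thus ?case by simp
next
  case (Cons a l)
  have srt: "sorted_wrt (\<ge>) l" and ge: "\<And>b. b \<in> set l \<Longrightarrow> b \<le> a" using Cons.prems(1) by auto
  show ?case
  proof (cases "S = {#}")
    case False
    define b where "b = (if a \<in># S then a else (SOME x. x \<in># S))"
    have "\<exists>x. x \<in># S" using False by auto
    hence "b \<in># S" unfolding b_def by (auto intro: someI_ex)
    then obtain S' where S: "S = add_mset b S'" by (meson multi_member_split)
    obtain k' where k': "k = Suc k'" using Cons.prems(3) S by (cases k) auto
    have sub: "S' \<subseteq># mset l"
    proof (cases "a \<in># S")
      case True
      hence "b = a" by (simp add: b_def)
      thus ?thesis using Cons.prems(2) S by simp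
    next
      case notin: False
      have "count S' x \<le> count (mset l) x" for x
      proof (cases "x = a")
        case True
        thus ?thesis using notin S by (simp add: not_in_iff)
      next
        case False
        have "count S' x \<le> count S x" using S by simp
        also have "\<dots> \<le> count (mset (a # l)) x" by (rule mset_subset_eq_count[OF Cons.prems(2)])
        finally show ?thesis using False by simp
      qed
      thus ?thesis by (rule mset_subset_eqI)
    qed
    have "b \<in># mset (a # l)" by (rule mset_subset_eqD[OF Cons.prems(2)]) (simp add: S)
    hence "b \<le> a" using ge by auto
    moreover have "sum_mset S' \<le> sum_list (take k' l)"
      using Cons.IH[OF srt sub] Cons.prems(3) S k' by simp
    ultimately show ?thesis using S k' by simp
  qed simp
qed

lemma sum_mset_nonzero: "sum_mset (filter_mset (\<lambda>x. x \<noteq> 0) (mset \<gamma>)) = sum_list (\<gamma> :: nat list)"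
  by (induction \<gamma>) auto

lemma partition_of_mset:
  assumes "0 \<notin># m"
  obtains \<nu> where "is_partition \<nu>" "mset \<nu> = m"
proof
  show "is_partition (rev (sorted_list_of_multiset m))"
    using assms by (simp add: is_partition_def sorted_wrt_rev)
qed simp

lemma mset_of_hmon: "is_partition l \<Longrightarrow> image_mset Suc (hmon l) = mset l"
  by (induction l) (auto simp: hmon_def is_partition_def)

lemma partition_eqI:
  assumes "is_partition \<nu>" "is_partition \<mu>" "hmon \<nu> = hmon \<mu>"
  shows "\<nu> = \<mu>"
proof -
  have "mset (rev \<nu>) = mset (rev \<mu>)" using assms mset_of_hmon by (metis mset_rev)
  moreover have "sorted (rev \<nu>)" "sorted (rev \<mu>)"
    using assms by (simp_all add: is_partition_def sorted_wrt_rev)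
  ultimately show ?thesis by (metis properties_for_sort rev_rev_ident)
qed

lemma inj_on_hmon: "inj_on hmon {l. is_partition l}"
  by (rule inj_onI) (auto intro: partition_eqI)

lemma hmon_surj:
  obtains \<nu> where "is_partition \<nu>" "hmon \<nu> = m"
proof -
  have "0 \<notin># image_mset Suc m" by simp
  then obtain \<nu> where nu: "is_partition \<nu>" "mset \<nu> = image_mset Suc m" by (rule partition_of_mset)
  hence "image_mset Suc (hmon \<nu>) = image_mset Suc m" by (simp add: mset_of_hmon)
  hence "image_mset (\<lambda>x. x - 1) (image_mset Suc (hmon \<nu>)) = image_mset (\<lambda>x. x - 1) (image_mset Suc m)"
    by simp
  hence "hmon \<nu> = m" by (simp add: image_mset.compositionality o_def)
  thus thesis using nu that by blast
qed

lemma dominates_refl: "is_partition l \<Longrightarrow> l \<unrhd>\<^sub>d l" by (simp add: dominates_def)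

lemma dominates_trans: "n \<unrhd>\<^sub>d m \<Longrightarrow> m \<unrhd>\<^sub>d l \<Longrightarrow> n \<unrhd>\<^sub>d l"
  unfolding dominates_def by (metis order_trans)

lemma eq_of_partial_sums:
  fixes k l :: "nat list"
  assumes "length k = length l" "\<And>j. sum_list (take j k) = sum_list (take j l)"
  shows "k = l"
proof (rule nth_equalityI)
  fix i assume i: "i < length k"
  hence "take (Suc i) k = take i k @ [k ! i]" "take (Suc i) l = take i l @ [l ! i]"
    using assms(1) by (auto simp: take_Suc_conv_app_nth)
  with assms(2)[of i] assms(2)[of "Suc i"] show "k ! i = l ! i" by simp
qed fact

lemma lowered_dominates:
  assumes "is_partition l" "\<gamma> \<in> lowered 0 l"
  obtains \<nu> where "hmon \<nu> = hmon \<gamma>" "\<nu> \<unrhd>\<^sub>d l" "\<nu> = l \<Longrightarrow> \<gamma> = l"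
proof -
  let ?nz = "\<lambda>\<gamma>. filter_mset (\<lambda>x. x \<noteq> 0) (mset \<gamma> :: nat multiset)"
  have "0 \<notin># ?nz \<gamma>" by simp
  then obtain \<nu> where nu: "is_partition \<nu>" "mset \<nu> = ?nz \<gamma>" by (rule partition_of_mset)
  have le: "sum_list (take j \<gamma>) \<le> sum_list (take j \<nu>)" for j
  proof -
    have "mset (take j \<gamma>) \<subseteq># mset \<gamma>" by (metis append_take_drop_id mset_append mset_subset_eq_add_left)
    hence "?nz (take j \<gamma>) \<subseteq># mset \<nu>" unfolding nu(2) by (rule multiset_filter_mono)
    moreover have "size (?nz (take j \<gamma>)) \<le> j"
      by (rule order_trans[OF size_filter_mset_lesseq]) simp
    ultimately have "sum_mset (?nz (take j \<gamma>)) \<le> sum_list (take j \<nu>)"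
      using nu(1) by (intro sum_mset_le_take_sorted) (auto simp: is_partition_def)
    thus ?thesis by (simp only: sum_mset_nonzero)
  qed
  have sum: "sum_list \<nu> = sum_list l"
    using assms(2) nu(2) sum_mset_nonzero[of \<gamma>] sum_mset_sum_list[of \<nu>] by (simp add: lowered_def)
  have low: "sum_list (take j l) \<le> sum_list (take j \<gamma>)" for j
    using assms(2) by (simp add: lowered_def)
  have "\<nu> \<unrhd>\<^sub>d l" unfolding dominates_def using nu assms(1) sum low le by (auto intro: order_trans)
  moreover have "\<gamma> = l" if "\<nu> = l"
    using assms(2) that low le by (intro eq_of_partial_sums antisym) (auto simp: lowered_def)
  moreover have "hmon \<nu> = hmon \<gamma>" unfolding hmon_def nu(2) by (simp add: filter_filter_mset)
  ultimately show thesis using that by blast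
qed

lemma dominates_antisym:
  assumes "n \<unrhd>\<^sub>d l" "l \<unrhd>\<^sub>d n"
  shows "n = l"
proof -
  have *: "length k \<le> length j" if "k \<unrhd>\<^sub>d j" for k j
  proof (rule ccontr)
    assume "\<not> ?thesis"
    then have "drop (length j) k \<noteq> []" "set (drop (length j) k) \<subseteq> set k" by (auto dest: in_set_dropD)
    moreover have "0 \<notin> set k" using that by (simp add: dominates_def is_partition_def)
    ultimately have "sum_list (drop (length j) k) \<noteq> 0"
      by (metis list.set_intros(1) neq_Nil_conv subsetD sum_list_eq_0_iff)
    hence "sum_list (drop (length j) k) > 0" by (simp only: neq0_conv)
    moreover have "sum_list k = sum_list (take (length j) k) + sum_list (drop (length j) k)"
      by (metis append_take_drop_id sum_list_append)
    moreover have "sum_list (take (length j) k) \<ge> sum_list j" using that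
      unfolding dominates_def by (metis order_refl take_all)
    ultimately show False using that unfolding dominates_def by linarith
  qed
  show ?thesis using assms *[OF assms(1)] *[OF assms(2)]
    by (intro eq_of_partial_sums antisym) (auto simp: dominates_def)
qed

lemma finite_partitions: "finite {l. is_partition l \<and> sum_list l = n}"
proof (rule finite_subset)
  have "length l \<le> sum_list l" if "0 \<notin> set l" for l :: "nat list"
    using that by (induction l) auto
  moreover have "x \<le> sum_list l" if "x \<in> set l" for x :: nat and l using that by (intro member_le_sum_list) auto
  ultimately show "{l. is_partition l \<and> sum_list l = n} \<subseteq> {l. set l \<subseteq> {..n} \<and> length l \<le> n}"
    by (auto simp: is_partition_def)
qed (simp add: finite_lists_length_le)

text \<open>Upper sets of the dominance order in a fixed degree. The operator preserves their $h$-spans, and removing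
  a minimal element is the induction step for all triangular systems below.\<close>

definition up_set :: "nat \<Rightarrow> nat list set \<Rightarrow> bool" where
  "up_set n S \<longleftrightarrow> S \<subseteq> {l. is_partition l \<and> sum_list l = n} \<and> (\<forall>l\<in>S. \<forall>m. m \<unrhd>\<^sub>d l \<longrightarrow> m \<in> S)"

lemma up_set_finite: "up_set n S \<Longrightarrow> finite S"
  using finite_partitions finite_subset by (auto simp: up_set_def)

lemma up_set_induct [consumes 1, case_names empty insert]:
  assumes "up_set n S" "P {}"
    "\<And>S l. up_set n (insert l S) \<Longrightarrow> up_set n S \<Longrightarrow> l \<notin> S \<Longrightarrow> {m. m \<unrhd>\<^sub>d l} - {l} \<subseteq> S \<Longrightarrow> P S \<Longrightarrow> P (insert l S)"
  shows "P S"
proof -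
  have "finite S" using assms(1) by (rule up_set_finite)
  thus ?thesis using assms(1)
  proof (induction S rule: finite_psubset_induct)
    case (psubset S)
    show ?case
    proof (cases "S = {}")
      case False
      have "\<exists>l\<in>S. \<forall>m\<in>S. l \<unrhd>\<^sub>d m \<longrightarrow> m = l"
      proof (rule ccontr)
        assume neg: "\<not> ?thesis"
        \<comment> \<open>A strict order on a finite set is well-founded, hence has a minimal element.\<close>
        define r where "r = {(m, l). m \<in> S \<and> l \<in> S \<and> l \<unrhd>\<^sub>d m \<and> m \<noteq> l}"
        have "trans r"
        proof (rule transI)
          fix x y z assume "(x, y) \<in> r" "(y, z) \<in> r"
          hence *: "x \<in> S" "z \<in> S" "y \<unrhd>\<^sub>d x" "z \<unrhd>\<^sub>d y" "y \<noteq> x" by (auto simp: r_def)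
          moreover have "x \<noteq> z" using *(3,4,5) dominates_antisym by blast
          ultimately show "(x, z) \<in> r" unfolding r_def using dominates_trans[OF *(4,3)] by simp
        qed
        hence "acyclic r" by (auto simp: acyclic_def r_def)
        moreover have "finite r" by (rule finite_subset[of _ "S \<times> S"]) (auto simp: r_def psubset.hyps)
        ultimately have "wf r" by (simp add: finite_acyclic_wf)
        then obtain z where "z \<in> S" "\<And>y. (y, z) \<in> r \<Longrightarrow> y \<notin> S" using False by (metis wfE_min ex_in_conv)
        moreover from this(1) neg obtain m where "m \<in> S" "z \<unrhd>\<^sub>d m" "m \<noteq> z" by blast
        ultimately show False unfolding r_def by blast
      qed
      then obtain l where l: "l \<in> S" "\<And>m. m \<in> S \<Longrightarrow> l \<unrhd>\<^sub>d m \<Longrightarrow> m = l" by blast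
      have up: "up_set n (S - {l})" using psubset.prems l by (auto simp: up_set_def)
      have "P (insert l (S - {l}))"
      proof (rule assms(3))
        show "P (S - {l})" using up l by (intro psubset.IH) auto
        show "{m. m \<unrhd>\<^sub>d l} - {l} \<subseteq> S - {l}" using psubset.prems l by (auto simp: up_set_def)
      qed (use up psubset.prems l in \<open>auto simp: insert_absorb\<close>)
      thus ?thesis using l by (simp add: insert_absorb)
    qed (use assms in simp)
  qed
qed

lemma up_set_all: "up_set n {l. is_partition l \<and> sum_list l = n}"
  by (auto simp: up_set_def dominates_def)

lemma up_set_dominates: "up_set (sum_list l) {m. m \<unrhd>\<^sub>d l}"
  by (auto simp: up_set_def dest: dominates_trans) (auto simp: dominates_def)

lemma up_set_strict: "up_set (sum_list l) ({m. m \<unrhd>\<^sub>d l} - {l})"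
  using up_set_dominates[of l] by (auto simp: up_set_def dest: dominates_antisym)

section \<open>Eigenvectors\<close>

definition hspan :: "nat multiset set \<Rightarrow> 'a::comm_ring_1 sym set" where
  "hspan A = {F. supp F \<subseteq> A}"

lemma hspan_iff: "F \<in> hspan A \<longleftrightarrow> (\<forall>m. mcoeff F m \<noteq> 0 \<longrightarrow> m \<in> A)"
  by (auto simp: hspan_def in_keys_iff)

lemma hspan_0: "0 \<in> hspan A"
  and hspan_add: "F \<in> hspan A \<Longrightarrow> G \<in> hspan A \<Longrightarrow> F + G \<in> hspan A"
  and hspan_diff: "F \<in> hspan A \<Longrightarrow> G \<in> hspan A \<Longrightarrow> F - G \<in> hspan A"
  and hspan_cst: "F \<in> hspan A \<Longrightarrow> cst c * F \<in> hspan A"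
  by (auto simp: hspan_iff lookup_add lookup_minus lookup_cst_mult) (metis add_0, metis diff_0_right, metis mult_zero_right)

lemma hspan_sum: "(\<And>i. i \<in> I \<Longrightarrow> F i \<in> hspan A) \<Longrightarrow> sum F I \<in> hspan A"
  by (induction I rule: infinite_finite_induct) (auto simp: hspan_0 hspan_add)

lemma hspan_mono: "F \<in> hspan A \<Longrightarrow> A \<subseteq> B \<Longrightarrow> F \<in> hspan B"
  by (auto simp: hspan_iff)

lemma hspan_hprod: "hmon l \<in> A \<Longrightarrow> hprod l \<in> hspan A"
  by (auto simp: hspan_iff hprod_eq_single lookup_single when_def)

lemma mcoeff_hprod: "mcoeff (hprod l) m = (if m = hmon l then 1 else 0)"
  by (simp add: hprod_eq_single lookup_single when_def)

lemma hspan_insert_remove: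
  assumes "F \<in> hspan (hmon ` insert l S)"
  shows "F - cst (mcoeff F (hmon l)) * hprod l \<in> hspan (hmon ` S)"
  using assms by (auto simp: hspan_iff lookup_minus lookup_cst_mult mcoeff_hprod split: if_splits)

lemma hmon_notin:
  assumes "up_set n (insert l S)" "l \<notin> S"
  shows "hmon l \<notin> hmon ` S"
  using assms inj_on_hmon by (auto simp: up_set_def inj_on_def)

text \<open>Any family unitriangular to the $h_\lambda$ has the same spans over upper sets as the $h_\lambda$. It is
  applied to the eigenvectors and, through Jacobi-Trudi, to the Schur functions.\<close>

lemma unitriangular_span:
  assumes "\<And>l. is_partition l \<Longrightarrow> u l - hprod l \<in> hspan (hmon ` ({m. m \<unrhd>\<^sub>d l} - {l}))"
    and "up_set n S" "F \<in> hspan (hmon ` S)"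
  shows "\<exists>a. F = (\<Sum>m\<in>S. cst (a m) * u m)"
  using assms(2,3)
proof (induction S arbitrary: F rule: up_set_induct)
  case empty
  hence "F = 0" by (intro poly_mapping_eqI) (auto simp: hspan_iff)
  thus ?case by simp
next
  case (insert S l)
  define c where "c = mcoeff F (hmon l)"
  have l: "is_partition l" using insert.hyps(1) by (auto simp: up_set_def)
  have "u l - hprod l \<in> hspan (hmon ` S)"
    by (rule hspan_mono[OF assms(1)[OF l]]) (use insert.hyps(4) in auto)
  hence "(F - cst c * hprod l) - cst c * (u l - hprod l) \<in> hspan (hmon ` S)"
    unfolding c_def by (rule hspan_diff[OF hspan_insert_remove[OF insert.prems] hspan_cst])
  hence "F - cst c * u l \<in> hspan (hmon ` S)" by (simp add: algebra_simps)
  then obtain a where a: "F - cst c * u l = (\<Sum>m\<in>S. cst (a m) * u m)" using insert.IH by blast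
  have "F = (\<Sum>m\<in>insert l S. cst ((a(l := c)) m) * u m)"
  proof -
    have "(\<Sum>m\<in>S. cst ((a(l := c)) m) * u m) = (\<Sum>m\<in>S. cst (a m) * u m)"
      using insert.hyps(3) by (intro sum.cong) auto
    thus ?thesis using a up_set_finite[OF insert.hyps(2)] insert.hyps(3) by (simp add: algebra_simps)
  qed
  thus ?case by blast
qed

lemma Dq_add: "Dq q t (F + G) = Dq q t F + Dq q t G"
proof -
  interpret t1: comm_ring_hom "tau (omega1 t)" by (rule tau_hom)
  show ?thesis by (simp add: Dq_def t1.hom_add pairing_add)
qed

lemma Dq_cst: "Dq q t (cst c * F) = cst c * Dq q t F"
proof -
  interpret t1: comm_ring_hom "tau (omega1 t)" by (rule tau_hom)
  show ?thesis by (simp only: Dq_def t1.hom_mult tau_cst pairing_smult)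
qed

lemma Dq_diff: "Dq q t (F - G) = Dq q t F - Dq q t G"
  using Dq_add[of q t "F - G" G] by simp

lemma Dq_0 [simp]: "Dq q t 0 = 0"
  using Dq_diff[of q t 0 0] by simp

lemma Dq_hprod: "Dq q t (hprod \<beta>) = Tq q t 0 \<beta>"
  by (simp add: Dq_def Tq_def)

context macdonald_ring
begin

lemma spn_hspan: "F \<in> spn n A \<Longrightarrow> F \<in> hspan A"
  by (auto simp: spn_def hspan_iff)

lemma Dq_partition:
  assumes "is_partition l"
  shows "Dq q t (hprod l) - cst (dval q t l) * hprod l \<in> spn 2 (hmon ` ({m. m \<unrhd>\<^sub>d l} - {l}))"
proof -
  have "hmon ` (lowered 0 l - {l}) \<subseteq> hmon ` ({m. m \<unrhd>\<^sub>d l} - {l})"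
  proof
    fix m assume "m \<in> hmon ` (lowered 0 l - {l})"
    then obtain \<gamma> where g: "\<gamma> \<in> lowered 0 l" "\<gamma> \<noteq> l" "m = hmon \<gamma>" by auto
    obtain \<nu> where "hmon \<nu> = hmon \<gamma>" "\<nu> \<unrhd>\<^sub>d l" "\<nu> = l \<Longrightarrow> \<gamma> = l"
      using lowered_dominates[OF assms g(1)] by blast
    thus "m \<in> hmon ` ({m. m \<unrhd>\<^sub>d l} - {l})" using g by (intro image_eqI[of _ _ \<nu>]) auto
  qed
  thus ?thesis using Tq_spn[of l] spn_mono[OF _ order_refl] by (auto simp: Dq_hprod)
qed

end

text \<open>The differences of the eigenvalues vanish for $t = 1$, but only to first order.\<close>

locale macdonald_field = macdonald_ring R q t for R :: "'a::field set" and q t +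
  assumes t_neq_1: "t \<noteq> 1"
    and dval_inj: "is_partition l \<Longrightarrow> is_partition m \<Longrightarrow> sum_list l = sum_list m \<Longrightarrow> l \<noteq> m \<Longrightarrow>
       dval q t l \<noteq> dval q t m \<and> (1 - t) / (dval q t l - dval q t m) \<in> R"
begin

text \<open>Back substitution from the minimal elements upward. Each step divides by a difference of eigenvalues and
  so loses exactly one of the two factors $1-t$.\<close>

lemma solve_triangular:
  assumes "up_set n S" "is_partition l" "sum_list l = n" "l \<notin> S" "g \<in> spn 2 (hmon ` S)"
  shows "\<exists>f \<in> spn 1 (hmon ` S). Dq q t f - cst (dval q t l) * f = g"
  using assms
proof (induction S arbitrary: g rule: up_set_induct)
  case empty
  hence "g = 0" by (intro poly_mapping_eqI) (auto simp: spn_def)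
  thus ?case by (intro bexI[of _ 0] spn_zero) simp
next
  case (insert S m)
  define c where "c = mcoeff g (hmon m)"
  \<comment> \<open>The minimal element m is removed by subtracting the multiple of $h_m$ that the
    diagonal entry maps to the coefficient of $h_m$ in the right hand side.\<close>
  define \<delta> where "\<delta> = dval q t m - dval q t l"
  have m: "is_partition m" "sum_list m = n" using insert.hyps(1) by (auto simp: up_set_def)
  have delta: "\<delta> \<noteq> 0" "(1 - t) / \<delta> \<in> R"
    using dval_inj[OF m(1) insert.prems(1)] insert.prems m by (auto simp: \<delta>_def)
  have "c \<in> fil 2" using insert.prems(4) by (auto simp: c_def spn_def)
  then obtain x where x: "x \<in> R" "c = (1 - t) ^ 2 * x" by (auto simp: fil_def)
  have "c / \<delta> = (1 - t) ^ 1 * (x * ((1 - t) / \<delta>))"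
    by (simp add: x power2_eq_square)
  hence cd: "c / \<delta> \<in> fil 1" unfolding fil_def using mult_mem[OF x(1) delta(2)] by blast
  define f0 where "f0 = cst (c / \<delta>) * hprod m"
  define g' where "g' = g - (Dq q t f0 - cst (dval q t l) * f0)"
  have "g' = (g - cst c * hprod m) - cst (c / \<delta>) * (Dq q t (hprod m) - cst (dval q t m) * hprod m)"
  proof -
    have "cst c * hprod m = cst (c / \<delta>) * (cst (dval q t m - dval q t l) * hprod m)"
      using delta(1) by (simp add: \<delta>_def flip: mult.assoc cst.hom_mult)
    thus ?thesis unfolding g'_def f0_def Dq_cst by (simp add: cst.hom_minus algebra_simps)
  qed
  moreover have "g - cst c * hprod m \<in> spn 2 (hmon ` S)"
    using insert.prems(4) unfolding spn_def
    by (auto simp: lookup_minus lookup_cst_mult mcoeff_hprod c_def fil_zero)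
  moreover have "cst (c / \<delta>) * (Dq q t (hprod m) - cst (dval q t m) * hprod m) \<in> spn 2 (hmon ` S)"
    by (rule spn_mono[OF spn_cst[OF cd Dq_partition[OF m(1)]]])
      (use insert.hyps(4) in auto)
  ultimately have "g' \<in> spn 2 (hmon ` S)" by (auto intro: spn_diff)
  with insert obtain f where f: "f \<in> spn 1 (hmon ` S)" "Dq q t f - cst (dval q t l) * f = g'" by auto
  have "f0 \<in> spn 1 (hmon ` insert m S)"
    unfolding f0_def hprod_eq_single single_eq_cst[symmetric] by (rule spn_single[OF cd]) simp
  moreover have "f \<in> spn 1 (hmon ` insert m S)" by (rule spn_mono[OF f(1)]) auto
  moreover have "Dq q t (f0 + f) - cst (dval q t l) * (f0 + f) = g"
    using f(2) by (simp add: g'_def Dq_add algebra_simps)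
  ultimately show ?case by (metis spn_add)
qed

lemma eigenvector_exists:
  assumes "is_partition l"
  shows "\<exists>v. v - hprod l \<in> spn 1 (hmon ` ({m. m \<unrhd>\<^sub>d l} - {l})) \<and> Dq q t v = cst (dval q t l) * v"
proof -
  obtain f where f: "f \<in> spn 1 (hmon ` ({m. m \<unrhd>\<^sub>d l} - {l}))"
      "Dq q t f - cst (dval q t l) * f = Dq q t (hprod l) - cst (dval q t l) * hprod l"
    using solve_triangular[OF up_set_strict assms refl _ Dq_partition[OF assms]] by blast
  show ?thesis
  proof (intro exI conjI)
    show "(hprod l - f) - hprod l \<in> spn 1 (hmon ` ({m. m \<unrhd>\<^sub>d l} - {l}))"
      using spn_uminus[OF f(1)] by simp
    show "Dq q t (hprod l - f) = cst (dval q t l) * (hprod l - f)"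
      using f(2) by (simp add: Dq_diff algebra_simps)
  qed
qed

definition evec :: "nat list \<Rightarrow> 'a sym" where
  "evec l = (SOME v. v - hprod l \<in> spn 1 (hmon ` ({m. m \<unrhd>\<^sub>d l} - {l})) \<and> Dq q t v = cst (dval q t l) * v)"

lemma
  assumes "is_partition l"
  shows evec_spn: "evec l - hprod l \<in> spn 1 (hmon ` ({m. m \<unrhd>\<^sub>d l} - {l}))"
    and evec_eigen: "Dq q t (evec l) = cst (dval q t l) * evec l"
  using someI_ex[OF eigenvector_exists[OF assms]] unfolding evec_def by blast+

lemma evec_hspan:
  assumes "is_partition l"
  shows "evec l \<in> hspan (hmon ` {m. m \<unrhd>\<^sub>d l})"
proof -
  have "evec l - hprod l \<in> hspan (hmon ` {m. m \<unrhd>\<^sub>d l})"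
    by (rule hspan_mono[OF spn_hspan[OF evec_spn[OF assms]]]) auto
  moreover have "hprod l \<in> hspan (hmon ` {m. m \<unrhd>\<^sub>d l})"
    using dominates_refl[OF assms] by (intro hspan_hprod) auto
  ultimately show ?thesis using hspan_add by fastforce
qed

lemma mcoeff_evec_self:
  assumes "is_partition l"
  shows "mcoeff (evec l) (hmon l) = 1"
proof -
  have "hmon l \<notin> hmon ` ({m. m \<unrhd>\<^sub>d l} - {l})"
    using assms by (auto simp: dominates_def dest: partition_eqI)
  hence "mcoeff (evec l - hprod l) (hmon l) = 0"
    using spn_hspan[OF evec_spn[OF assms]] by (auto simp: hspan_iff)
  thus ?thesis by (simp add: lookup_minus mcoeff_hprod)
qed

lemma Dq_up_set:
  assumes "up_set n S" "F \<in> hspan (hmon ` S)"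
  shows "Dq q t F \<in> hspan (hmon ` S)"
  using assms
proof (induction S arbitrary: F rule: up_set_induct)
  case empty
  hence "F = 0" by (intro poly_mapping_eqI) (auto simp: hspan_iff)
  thus ?case by (simp add: hspan_0)
next
  case (insert S l)
  define c where "c = mcoeff F (hmon l)"
  have l: "is_partition l" using insert.hyps(1) by (auto simp: up_set_def)
  have "Dq q t (F - cst c * hprod l) \<in> hspan (hmon ` S)"
    using insert.IH hspan_insert_remove[OF insert.prems] by (simp add: c_def)
  hence 1: "Dq q t (F - cst c * hprod l) \<in> hspan (hmon ` insert l S)" by (rule hspan_mono) auto
  have "Dq q t (hprod l) - cst (dval q t l) * hprod l \<in> hspan (hmon ` insert l S)"
    by (rule hspan_mono[OF spn_hspan[OF Dq_partition[OF l]]]) (use insert.hyps(4) in auto)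
  moreover have "cst (dval q t l) * hprod l \<in> hspan (hmon ` insert l S)"
    by (intro hspan_cst hspan_hprod) auto
  ultimately have "Dq q t (hprod l) \<in> hspan (hmon ` insert l S)"
    using hspan_add by fastforce
  hence "cst c * Dq q t (hprod l) \<in> hspan (hmon ` insert l S)" by (rule hspan_cst)
  from hspan_add[OF 1 this] show ?case by (simp add: Dq_diff Dq_cst)
qed

text \<open>At a minimal element \<open>m\<close> of the support the operator acts by the scalar \<open>dval q t m\<close>. For an eigenvector
  this scalar is the eigenvalue, so $m = l$; but the coefficient there vanishes.\<close>

lemma eigen_zero:
  assumes "up_set n S" "F \<in> hspan (hmon ` S)" "Dq q t F = cst (dval q t l) * F"
    and "is_partition l" "sum_list l = n" "mcoeff F (hmon l) = 0"
  shows "F = 0"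
  using assms
proof (induction S arbitrary: F rule: up_set_induct)
  case empty
  thus ?case by (intro poly_mapping_eqI) (auto simp: hspan_iff)
next
  case (insert S m)
  define c where "c = mcoeff F (hmon m)"
  have m: "is_partition m" "sum_list m = n" using insert.hyps(1) by (auto simp: up_set_def)
  have notin: "hmon m \<notin> hmon ` S" by (rule hmon_notin) fact+
  have "Dq q t (F - cst c * hprod m) \<in> hspan (hmon ` S)"
    unfolding c_def by (intro Dq_up_set[OF insert.hyps(2)] hspan_insert_remove insert.prems)
  hence 1: "mcoeff (Dq q t (F - cst c * hprod m)) (hmon m) = 0"
    using notin by (auto simp: hspan_iff)
  have "Dq q t (hprod m) - cst (dval q t m) * hprod m \<in> hspan (hmon ` S)"
    by (rule hspan_mono[OF spn_hspan[OF Dq_partition[OF m(1)]]]) (use insert.hyps(4) in auto)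
  hence 2: "mcoeff (Dq q t (hprod m)) (hmon m) = dval q t m"
    using notin by (force simp: hspan_iff lookup_minus lookup_cst_mult mcoeff_hprod)
  have "dval q t l * c = c * dval q t m"
    using 1 insert.prems(2) 2
    by (simp add: Dq_diff Dq_cst lookup_minus lookup_cst_mult c_def)
  hence "c = 0 \<or> dval q t l = dval q t m" by auto
  hence "c = 0" using dval_inj[OF insert.prems(3) m(1)] insert.prems m by (cases "l = m") (auto simp: c_def)
  hence "F \<in> hspan (hmon ` S)" using hspan_insert_remove[OF insert.prems(1)] by (simp add: c_def)
  thus ?case using insert by blast
qed

lemma eigen_unique:
  assumes "F \<in> hspan (hmon ` {l. is_partition l \<and> sum_list l = sum_list l0})"
    "Dq q t F = cst (dval q t l0) * F" "is_partition l0"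
  shows "F = cst (mcoeff F (hmon l0)) * evec l0"
proof -
  let ?S = "{l. is_partition l \<and> sum_list l = sum_list l0}"
  let ?G = "F - cst (mcoeff F (hmon l0)) * evec l0"
  have "evec l0 \<in> hspan (hmon ` ?S)"
    by (rule hspan_mono[OF evec_hspan[OF assms(3)]]) (auto simp: dominates_def)
  hence "?G \<in> hspan (hmon ` ?S)" by (intro hspan_diff assms hspan_cst)
  moreover have "Dq q t ?G = cst (dval q t l0) * ?G"
    by (simp add: Dq_diff Dq_cst assms(2) evec_eigen[OF assms(3)] algebra_simps)
  ultimately have "?G = 0"
    by (rule eigen_zero[OF up_set_all]) (simp_all add: assms lookup_minus lookup_cst_mult mcoeff_evec_self)
  thus ?thesis by simp
qed

lemma evec_span:
  assumes "up_set n S" "F \<in> hspan (hmon ` S)"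
  shows "\<exists>a. F = (\<Sum>m\<in>S. cst (a m) * evec m)"
  using unitriangular_span[OF spn_hspan[OF evec_spn] assms] .

lemma evec_independent:
  assumes "up_set n S" "(\<Sum>m\<in>S. cst (a m) * evec m) = 0" "l \<in> S"
  shows "a l = 0"
  using assms
proof (induction S arbitrary: l rule: up_set_induct)
  case (insert S m)
  have fin: "finite S" using up_set_finite[OF insert.hyps(2)] .
  have m: "is_partition m" using insert.hyps(1) by (auto simp: up_set_def)
  have "evec k \<in> hspan (hmon ` S)" if "k \<in> S" for k
    by (rule hspan_mono[OF evec_hspan]) (use that insert.hyps(2) in \<open>auto simp: up_set_def\<close>)
  hence "(\<Sum>k\<in>S. cst (a k) * evec k) \<in> hspan (hmon ` S)"
    by (intro hspan_sum hspan_cst) auto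
  hence "mcoeff (\<Sum>k\<in>S. cst (a k) * evec k) (hmon m) = 0"
    using hmon_notin[OF insert.hyps(1,3)] by (auto simp: hspan_iff)
  moreover have "mcoeff (\<Sum>k\<in>insert m S. cst (a k) * evec k) (hmon m) = 0"
    using insert.prems(1) by simp
  ultimately have am: "a m = 0"
    using fin insert.hyps(3) by (simp add: lookup_add lookup_cst_mult mcoeff_evec_self[OF m])
  hence "(\<Sum>k\<in>S. cst (a k) * evec k) = 0" using insert.prems(1) fin insert.hyps(3) by simp
  thus ?case using insert.IH insert.prems(2) am by blast
qed simp

end

section \<open>Power sums\<close>

definition xD :: "'a::comm_ring_1 fps \<Rightarrow> 'a fps" where "xD f = fps_X * fps_deriv f"

lemma xD_nth [simp]: "fps_nth (xD f) n = of_nat n * fps_nth f n"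
  by (cases n) (simp_all add: xD_def)

lemma xD_mult: "xD (f * g) = xD f * g + f * xD g"
  by (simp add: xD_def algebra_simps)

lemma xD_dil: "xD (fps_dil a f) = fps_dil a (xD f)"
  by (simp add: fps_eq_iff mult_ac)

lemma fps_map_xD: "comm_ring_hom \<psi> \<Longrightarrow> fps_map \<psi> (xD f) = xD (fps_map \<psi> f)"
proof -
  assume "comm_ring_hom \<psi>"
  then interpret comm_ring_hom \<psi> .
  show ?thesis by (simp add: fps_eq_iff hom_distribs)
qed

text \<open>$\sum_n p_n T^n = T H'(T)/H(T)$.\<close>

definition pgen :: "'a::comm_ring_1 sym fps" where "pgen = xD hgen * hinv"

definition psym :: "nat \<Rightarrow> 'a::comm_ring_1 sym" where "psym n = fps_nth pgen n"

lemma pgen_hgen: "pgen * hgen = xD hgen"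
proof -
  have "pgen * hgen = xD hgen * (hgen * hinv)" unfolding pgen_def by (simp only: mult_ac)
  thus ?thesis by (simp add: hgen_hinv)
qed

lemma psym_0 [simp]: "psym 0 = 0"
  by (simp add: psym_def pgen_def)

text \<open>Newton's identities: the coefficients of $T H' = (T H'/H)\, H$.\<close>

lemma newton: "of_nat n * (hvar n :: 'a::comm_ring_1 sym) = (\<Sum>i=1..n. psym i * hvar (n - i))"
proof -
  have "of_nat n * (hvar n :: 'a sym) = (\<Sum>i=0..n. psym i * hvar (n - i))"
    using arg_cong[OF pgen_hgen[symmetric], of "\<lambda>f. fps_nth f n"] by (simp add: fps_mult_nth psym_def)
  thus ?thesis by (simp add: sum.atLeast_Suc_atMost)
qed

lemma theta_pgen: "fps_map (theta (a :: 'a::comm_ring_1)) pgen = pgen - fps_dil (cst a) pgen"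
proof -
  interpret m: comm_ring_hom "fps_map (theta a)" by (rule fps_map_hom[OF theta_hom])
  interpret d: comm_ring_hom "fps_dil (cst a :: 'a sym)" by (rule fps_dil_hom)
  let ?d = "fps_dil (cst a)"
  have inv: "hinv * hgen = 1" using hgen_hinv by (simp add: mult.commute)
  have "xD (hgen * hinv :: 'a sym fps) = 0" by (simp add: hgen_hinv fps_eq_iff)
  hence "hgen * xD hinv = - (pgen :: 'a sym fps)" by (simp add: xD_mult pgen_def eq_neg_iff_add_eq_0 add.commute)
  hence 1: "hgen * hinv * ?d (xD hinv * hgen) = - ?d pgen"
    by (simp add: hgen_hinv mult.commute[of "xD hinv"] d.hom_uminus)
  have "fps_map (theta a) pgen = xD (hgen * ?d hinv) * (?d hgen * hinv)"
    by (simp add: pgen_def m.hom_mult theta_hinv fps_map_xD[OF theta_hom] theta_hgen)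
  also have "\<dots> = xD hgen * hinv * ?d (hinv * hgen) + hgen * hinv * ?d (xD hinv * hgen)"
    by (simp add: xD_mult xD_dil d.hom_mult algebra_simps)
  finally show ?thesis by (simp add: inv 1 pgen_def)
qed

text \<open>The logarithmic derivative of $H(T)/H(aT)$.\<close>

lemma theta_psym: "theta a (psym n) = cst (1 - a ^ n) * psym n"
  using arg_cong[OF theta_pgen[of a], of "\<lambda>f. fps_nth f n"]
  by (simp add: psym_def cst.hom_minus cst.hom_power left_diff_distrib)

definition weight :: "nat multiset \<Rightarrow> nat" where "weight m = sum_mset (image_mset Suc m)"

definition homog :: "nat \<Rightarrow> 'a::comm_ring_1 sym set" where "homog n = hspan {m. weight m = n}"

lemma weight_add [simp]: "weight (m + m') = weight m + weight m'" by (simp add: weight_def)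

lemma weight_hmon: "weight (hmon l) = sum_list l"
  by (induction l) (auto simp: weight_def hmon_def)

lemma homog_eq: "homog n = hspan (hmon ` {l. is_partition l \<and> sum_list l = n})"
proof -
  have "{m. weight m = n} = hmon ` {l. is_partition l \<and> sum_list l = n}"
  proof (intro equalityI subsetI)
    fix m assume "m \<in> {m. weight m = n}"
    moreover obtain l where "is_partition l" "hmon l = m" by (rule hmon_surj)
    ultimately show "m \<in> hmon ` {l. is_partition l \<and> sum_list l = n}" by (auto simp: weight_hmon)
  qed (auto simp: weight_hmon)
  thus ?thesis by (simp add: homog_def)
qed

lemma homog_hprod: "hprod l \<in> homog (sum_list l)"
  unfolding homog_def by (rule hspan_hprod) (simp add: weight_hmon)

lemma homog_hvar: "hvar k \<in> homog k"
  using homog_hprod[of "[k]"] by simp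

lemma homog_mult: "F \<in> homog a \<Longrightarrow> G \<in> homog b \<Longrightarrow> F * G \<in> homog (a + b)"
  using keys_mult[of F G] by (fastforce simp: homog_def hspan_def)

lemma homog_1: "1 \<in> homog 0" using homog_hprod[of "[]"] by simp

lemma homog_sum: "(\<And>i. i \<in> I \<Longrightarrow> F i \<in> homog n) \<Longrightarrow> sum F I \<in> homog n"
  unfolding homog_def by (rule hspan_sum)

lemma homog_cst: "F \<in> homog n \<Longrightarrow> cst c * F \<in> homog n"
  unfolding homog_def by (rule hspan_cst)

lemma homog_prod_mset:
  assumes "\<And>k. \<phi> (Suc k) \<in> homog (Suc k)"
  shows "(\<Prod>k\<in>#m. \<phi> (Suc k)) \<in> homog (weight m)"
proof (induction m)
  case (add k m)
  have "weight (add_mset k m) = Suc k + weight m" by (simp add: weight_def)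
  with homog_mult[OF assms[of k] add] show ?case by simp
qed (simp add: homog_1 weight_def)

lemma homog_hsubst:
  assumes "F \<in> homog n" "\<And>k. \<phi> (Suc k) \<in> homog (Suc k)"
  shows "hsubst cst \<phi> F \<in> homog n"
  unfolding hsubst_def
proof (intro homog_sum homog_cst)
  fix m assume "m \<in> supp F"
  hence "weight m = n" using assms(1) by (auto simp: homog_def hspan_def)
  thus "(\<Prod>k\<in>#m. \<phi> (Suc k)) \<in> homog n" using homog_prod_mset[OF assms(2), of m] by simp
qed

lemma homog_fps_mult:
  assumes "\<And>k. fps_nth f k \<in> homog k" "\<And>k. fps_nth g k \<in> homog k"
  shows "fps_nth (f * g) k \<in> homog k"
  unfolding fps_mult_nth
proof (rule homog_sum)
  fix i assume "i \<in> {0..k}"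
  thus "fps_nth f i * fps_nth g (k - i) \<in> homog k"
    using homog_mult[OF assms(1)[of i] assms(2)[of "k - i"]] by simp
qed

lemma homog_hinv: "fps_nth (hinv :: 'a::comm_ring_1 sym fps) k \<in> homog k"
proof (induction k rule: less_induct)
  case (less k)
  show ?case
  proof (cases "k = 0")
    case False
    have "0 = fps_nth (hgen * hinv :: 'a sym fps) k" using False by (simp add: hgen_hinv)
    also have "\<dots> = fps_nth hinv k + (\<Sum>i=1..k. hvar i * fps_nth hinv (k - i))"
      by (simp add: fps_mult_nth sum.atLeast_Suc_atMost)
    finally have "(fps_nth hinv k :: 'a sym) = (\<Sum>i=1..k. cst (-1) * (hvar i * fps_nth hinv (k - i)))"
      by (simp add: eq_neg_iff_add_eq_0 cst.hom_uminus sum_negf)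
    also have "\<dots> \<in> homog k"
    proof (intro homog_sum homog_cst)
      fix i assume "i \<in> {1..k}"
      thus "hvar i * fps_nth hinv (k - i) \<in> (homog k :: 'a sym set)"
        using homog_mult[OF homog_hvar[of i] less.IH[of "k - i"]] by simp
    qed
    finally show ?thesis .
  qed (simp add: homog_1)
qed

lemma homog_of_nat: "F \<in> homog n \<Longrightarrow> of_nat k * F \<in> homog n"
  using homog_cst[of F n "of_nat k"] by (simp add: cst.hom_of_nat)

lemma homog_psym: "psym k \<in> homog k"
  unfolding psym_def pgen_def
  by (rule homog_fps_mult) (simp_all add: homog_hinv homog_of_nat homog_hvar)

lemma homog_theta: "F \<in> homog n \<Longrightarrow> theta a F \<in> homog n"
  unfolding theta_def
proof (rule homog_hsubst)
  have "fps_nth (hgen * fps_dil (cst a) hinv) k \<in> homog k" for k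
  proof (rule homog_fps_mult)
    fix k
    show "fps_nth (fps_dil (cst a) hinv) k \<in> homog k"
      using homog_cst[OF homog_hinv, of "a ^ k" k] by (simp add: cst.hom_power)
  qed (simp add: homog_hvar)
  thus "fps_nth (hgen * fps_dil (cst a) hinv) (Suc k) \<in> homog (Suc k)" for k .
qed

lemma hsubst_psym_psym:
  assumes "k \<noteq> 0"
  shows "hsubst cst psym (Poly_Mapping.single {#k - 1#} 1) = psym k"
  using assms by (simp add: hsubst_single[OF cst_hom])

text \<open>Newton's identities express $n h_n$ through $p_n$ and products of lower degree, and \<open>n\<close> is invertible.\<close>

lemma psym_span:
  fixes F :: "'a::field_char_0 sym"
  assumes "F \<in> homog n"
  shows "\<exists>C\<in>homog n. F = hsubst cst psym C"
proof -
  interpret p: comm_ring_hom "hsubst cst psym :: 'a sym \<Rightarrow> 'a sym" by (rule hsubst_hom[OF cst_hom])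
  define PS where "PS n = hsubst cst psym ` (homog n :: 'a sym set)" for n
  have PS_sum: "sum F I \<in> PS n" if "\<And>i. i \<in> I \<Longrightarrow> F i \<in> PS n" for F :: "'i \<Rightarrow> 'a sym" and I n
  proof -
    from that have "\<forall>i\<in>I. \<exists>C. C \<in> homog n \<and> F i = hsubst cst psym C" by (auto simp: PS_def)
    then obtain C where C: "\<And>i. i \<in> I \<Longrightarrow> C i \<in> homog n \<and> F i = hsubst cst psym (C i)" by metis
    have "sum F I = hsubst cst psym (sum C I)" using C by (simp add: p.hom_sum)
    moreover have "sum C I \<in> homog n" using C by (intro homog_sum) auto
    ultimately show ?thesis by (auto simp: PS_def)
  qed
  have PS_mult: "F * G \<in> PS (n + m)" if "F \<in> PS n" "G \<in> PS m" for F G n m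
    using that homog_mult by (force simp: PS_def simp flip: p.hom_mult)
  have PS_cst: "cst c * F \<in> PS n" if "F \<in> PS n" for c F n
  proof -
    from that obtain C where "C \<in> homog n" "F = hsubst cst psym C" by (auto simp: PS_def)
    hence "cst c * F = hsubst cst psym (cst c * C)" by (simp add: p.hom_mult hsubst_cst[OF cst_hom])
    thus ?thesis using homog_cst[OF \<open>C \<in> homog n\<close>] by (auto simp: PS_def)
  qed
  have PS_1: "1 \<in> PS 0" unfolding PS_def using homog_1 p.hom_one by (metis image_eqI)
  have PS_psym: "psym k \<in> PS k" if "k \<noteq> 0" for k
    unfolding PS_def
    by (rule image_eqI[where x = "Poly_Mapping.single {#k - 1#} 1"], rule hsubst_psym_psym[OF that, symmetric])
      (use that in \<open>auto simp: homog_def hspan_iff lookup_single when_def weight_def\<close>)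
  have PS_hvar: "hvar k \<in> PS k" for k
  proof (induction k rule: less_induct)
    case (less k)
    show ?case
    proof (cases "k = 0")
      case False
      have "(hvar k :: 'a sym) = cst (1 / of_nat k * of_nat k) * hvar k" using False by simp
      also have "\<dots> = cst (1 / of_nat k) * (of_nat k * hvar k)"
        unfolding cst.hom_mult cst.hom_of_nat by (simp only: mult.assoc)
      also have "\<dots> = cst (1 / of_nat k) * (\<Sum>i=1..k. psym i * hvar (k - i))"
        by (simp only: newton)
      also have "\<dots> \<in> PS k"
      proof (intro PS_cst PS_sum)
        fix i assume "i \<in> {1..k}"
        thus "psym i * hvar (k - i) \<in> PS k"
          using PS_mult[OF PS_psym[of i] less.IH[of "k - i"]] by simp
      qed
      finally show ?thesis .
    qed (simp add: PS_1)
  qed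
  have PS_hprod: "hprod l \<in> PS (sum_list l)" for l
    by (induction l) (auto simp: PS_1 PS_mult PS_hvar)
  have "F = (\<Sum>m\<in>supp F. cst (mcoeff F m) * Poly_Mapping.single m 1)"
    by (subst sym_sum_singles) (simp add: single_eq_cst[symmetric])
  also have "\<dots> \<in> PS n"
  proof (intro PS_sum PS_cst)
    fix m assume "m \<in> supp F"
    hence "weight m = n" using assms by (auto simp: homog_def hspan_def)
    moreover obtain l where "is_partition l" "hmon l = m" by (rule hmon_surj)
    ultimately show "Poly_Mapping.single m 1 \<in> PS n"
      using PS_hprod[of l] by (auto simp: hprod_eq_single weight_hmon)
  qed
  finally show ?thesis by (auto simp: PS_def)
qed

lemma psym_span_all:
  fixes F :: "'a::field_char_0 sym"
  shows "\<exists>C. F = hsubst cst psym C"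
proof -
  interpret p: comm_ring_hom "hsubst cst psym :: 'a sym \<Rightarrow> 'a sym" by (rule hsubst_hom[OF cst_hom])
  have "\<exists>C. Poly_Mapping.single m (mcoeff F m) = hsubst cst psym C" for m
  proof -
    have "Poly_Mapping.single m (mcoeff F m) \<in> homog (weight m)"
      by (auto simp: homog_def hspan_iff lookup_single when_def)
    thus ?thesis using psym_span by blast
  qed
  then obtain C where "\<And>m. Poly_Mapping.single m (mcoeff F m) = hsubst cst psym (C m)" by metis
  hence "F = hsubst cst psym (\<Sum>m\<in>supp F. C m)"
    by (subst sym_sum_singles) (simp add: p.hom_sum)
  thus ?thesis by blast
qed

text \<open>In terms of power sums the plethysm is diagonal with the nonzero entries $1 - a^r$.\<close>

lemma theta_surj:
  fixes F :: "'a::field_char_0 sym"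
  assumes "F \<in> homog n" "\<And>k. a ^ Suc k \<noteq> 1"
  shows "\<exists>E\<in>homog n. theta a E = F"
proof -
  obtain C where C: "C \<in> homog n" "F = hsubst cst psym C" using psym_span[OF assms(1)] by blast
  \<comment> \<open>Divide each power sum by the factor it receives.\<close>
  define E where "E = hsubst cst (\<lambda>k. cst (inverse (1 - a ^ k)) * psym k) C"
  have "theta a (cst (inverse (1 - a ^ Suc k)) * psym (Suc k)) = psym (Suc k)" for k
  proof -
    interpret th: comm_ring_hom "theta a" by (rule theta_hom)
    have "inverse (1 - a ^ Suc k) * (1 - a ^ Suc k) = 1" using assms(2)[of k] by (intro left_inverse) auto
    thus ?thesis by (simp only: th.hom_mult theta_cst theta_psym mult_1_left flip: mult.assoc cst.hom_mult) simp
  qed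
  hence "theta a E = F" unfolding E_def C(2) hom_hsubst[OF theta_hom] by (simp add: hsubst_def)
  moreover have "E \<in> homog n" unfolding E_def
    by (rule homog_hsubst[OF C(1)]) (intro homog_cst homog_psym)
  ultimately show ?thesis by blast
qed

section \<open>Symmetric functions as series in the variables\<close>

lemma xcoeff_Abs [simp]: "xcoeff (Abs_xps f) m = f m"
  by (simp add: Abs_xps_inverse)

lemma xcoeff_xscale [simp]: "xcoeff (xscale c f) m = c * xcoeff f m"
  by (simp add: xscale_def)

lemma xcoeff_power_sum: "xcoeff (power_sum r) m = (if \<exists>i. m = replicate_mset r i then 1 else 0)"
  by (simp add: power_sum_def)

lemma xcoeff_complete_sym: "xcoeff (complete_sym r) m = (if size m = r then 1 else 0)"
  by (simp add: complete_sym_def)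

lemma complete_sym_0 [simp]: "complete_sym 0 = 1"
  by (rule xps_eqI) (simp add: xcoeff_complete_sym one_xps.rep_eq)

lemma xcoeff_mult: "xcoeff (f * g) m = (\<Sum>(a, b) | a + b = m. xcoeff f a * xcoeff g b)"
  by (simp add: times_xps.rep_eq)

lemma xcoeff_sum: "xcoeff (\<Sum>i\<in>I. f i) m = (\<Sum>i\<in>I. xcoeff (f i) m)"
  by (induction I rule: infinite_finite_induct) (simp_all add: zero_xps.rep_eq plus_xps.rep_eq)

definition xsc :: "'a::comm_ring_1 \<Rightarrow> 'a xps" where "xsc c = xscale c 1"

lemma xsc_mult: "xsc c * f = xscale c f"
proof (rule xps_eqI)
  fix m
  have "xcoeff (xsc c * f) m = (\<Sum>(a, b)\<in>{({#}, m)}. xcoeff (xsc c) a * xcoeff f b)"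
    unfolding xcoeff_mult
    by (rule sum.mono_neutral_right) (auto simp: finite_antidiagonal xsc_def one_xps.rep_eq split: if_splits)
  thus "xcoeff (xsc c * f) m = xcoeff (xscale c f) m" by (simp add: xsc_def one_xps.rep_eq)
qed

lemma xsc_hom: "comm_ring_hom (xsc :: 'a::comm_ring_1 \<Rightarrow> 'a xps)"
proof
  fix x y :: 'a
  show "xsc (x * y) = xsc x * xsc y" unfolding xsc_mult by (rule xps_eqI) (simp add: xsc_def)
qed (auto intro!: xps_eqI simp: xsc_def plus_xps.rep_eq zero_xps.rep_eq algebra_simps)

definition iota :: "'a::comm_ring_1 sym \<Rightarrow> 'a xps" where
  "iota = hsubst xsc complete_sym"

lemma iota_hom: "comm_ring_hom iota"
  unfolding iota_def by (rule hsubst_hom[OF xsc_hom])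

lemma iota_hvar [simp]: "iota (hvar k) = complete_sym k"
  unfolding iota_def by (rule hsubst_hvar[OF xsc_hom]) simp

lemma iota_cst [simp]: "iota (cst c) = xsc c"
  unfolding iota_def by (rule hsubst_cst[OF xsc_hom])

text \<open>Coefficientwise: a monomial \<open>m\<close> of degree \<open>n\<close> is a product $x_i^r\cdot m'$ in as many ways as there are
  pairs $(i,r)$ with $1 \le r \le$ the exponent of $x_i$, that is in \<open>n\<close> ways.\<close>

lemma xps_newton:
  "of_nat n * complete_sym n = (\<Sum>i=1..n. power_sum i * (complete_sym (n - i) :: 'a::comm_ring_1 xps))"
proof (rule xps_eqI)
  interpret xsc: comm_ring_hom "xsc :: 'a \<Rightarrow> 'a xps" by (rule xsc_hom)
  fix m
  have ofn: "xcoeff (of_nat n * f) m = of_nat n * xcoeff f m" for f :: "'a xps"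
    using arg_cong[OF xsc_mult[of "of_nat n" f], of "\<lambda>f. xcoeff f m"] by (simp add: xsc.hom_of_nat)
  have L: "xcoeff (power_sum i * (complete_sym (n - i) :: 'a xps)) m =
      (if size m = n then of_nat (card {x \<in> set_mset m. i \<le> count m x}) else 0)" if i: "i \<in> {1..n}" for i
  proof -
    let ?P = "{p. fst p + snd p = m}" and ?Q = "{p. fst p + snd p = m \<and> (\<exists>x. fst p = replicate_mset i x) \<and> size (snd p) = n - i}"
    have "xcoeff (power_sum i * (complete_sym (n - i) :: 'a xps)) m =
        (\<Sum>p\<in>?P. if (\<exists>x. fst p = replicate_mset i x) \<and> size (snd p) = n - i then 1 else 0)"
      unfolding xcoeff_mult by (intro sum.cong) (auto simp: xcoeff_power_sum xcoeff_complete_sym)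
    also have "\<dots> = (\<Sum>p\<in>?Q. 1)"
      using finite_antidiagonal'[of m]
      by (intro sum.mono_neutral_cong_right) auto
    also have "\<dots> = of_nat (card ?Q)" by simp
    also have "card ?Q = (if size m = n then card {x \<in> set_mset m. i \<le> count m x} else 0)"
    proof (cases "size m = n")
      case True
      have "bij_betw (\<lambda>x. (replicate_mset i x, m - replicate_mset i x)) {x \<in> set_mset m. i \<le> count m x} ?Q"
      proof (rule bij_betw_imageI)
        show "inj_on (\<lambda>x. (replicate_mset i x, m - replicate_mset i x)) {x \<in> set_mset m. i \<le> count m x}"
        proof (rule inj_onI)
          fix x y assume "(replicate_mset i x, m - replicate_mset i x) = (replicate_mset i y, m - replicate_mset i y)"
          moreover have "x \<in># replicate_mset i x" using i by simp
          ultimately have "x \<in># replicate_mset i y" by simp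
          thus "x = y" using i by (simp split: if_splits)
        qed
        show "(\<lambda>x. (replicate_mset i x, m - replicate_mset i x)) ` {x \<in> set_mset m. i \<le> count m x} = ?Q"
        proof (intro equalityI subsetI)
          fix p assume "p \<in> ?Q"
          then obtain x where x: "fst p = replicate_mset i x" "m = replicate_mset i x + snd p"
            by auto
          thus "p \<in> (\<lambda>x. (replicate_mset i x, m - replicate_mset i x)) ` {x \<in> set_mset m. i \<le> count m x}"
            using i by (intro image_eqI[of _ _ x]) (auto simp: prod_eq_iff)
        next
          fix p assume "p \<in> (\<lambda>x. (replicate_mset i x, m - replicate_mset i x)) ` {x \<in> set_mset m. i \<le> count m x}"
          then obtain x where x: "i \<le> count m x" "p = (replicate_mset i x, m - replicate_mset i x)" by auto
          hence "replicate_mset i x \<subseteq># m" by (simp add: count_le_replicate_mset_subset_eq)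
          thus "p \<in> ?Q" using x True by (auto simp: size_Diff_submset)
        qed
      qed
      thus ?thesis using True by (simp add: bij_betw_same_card)
    next
      case False
      have "p \<notin> ?Q" for p
      proof
        assume "p \<in> ?Q"
        then obtain x where "m = fst p + snd p" "fst p = replicate_mset i x" "size (snd p) = n - i" by auto
        hence "size m = i + (n - i)" by simp
        thus False using False i by simp
      qed
      hence "?Q = {}" by (simp only: set_eq_iff empty_iff simp_thms)
      thus ?thesis using False by (simp only: card.empty if_False)
    qed
    finally show ?thesis by simp
  qed
  have "(\<Sum>i=1..n. card {x \<in> set_mset m. i \<le> count m x}) = n" if "size m = n"
  proof -
    have "(\<Sum>i=1..n. card {x \<in> set_mset m. i \<le> count m x}) = (\<Sum>i=1..n. \<Sum>x\<in>set_mset m. if i \<le> count m x then 1 else 0)"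
      by (simp add: sum.If_cases Int_def)
    also have "\<dots> = (\<Sum>x\<in>set_mset m. \<Sum>i=1..n. if i \<le> count m x then 1 else 0)" by (rule sum.swap)
    also have "\<dots> = (\<Sum>x\<in>set_mset m. count m x)"
    proof (rule sum.cong[OF refl])
      fix x
      have "count m x \<le> n" using that count_le_size[of m x] by simp
      hence "{i \<in> {1..n}. i \<le> count m x} = {1..count m x}" by auto
      thus "(\<Sum>i=1..n. if i \<le> count m x then 1 else 0) = count m x"
        by (simp add: sum.If_cases Int_def)
    qed
    also have "\<dots> = n" using that by (simp add: size_multiset_overloaded_eq)
    finally show ?thesis .
  qed
  hence "(\<Sum>i=1..n. (of_nat (card {x \<in> set_mset m. i \<le> count m x}) :: 'a)) = of_nat n" if "size m = n"
    using that by (simp flip: of_nat_sum)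
  thus "xcoeff (of_nat n * complete_sym n) m = xcoeff (\<Sum>i=1..n. power_sum i * (complete_sym (n - i) :: 'a xps)) m"
    by (simp add: ofn xcoeff_sum L xcoeff_complete_sym)
qed

lemma iota_psym:
  assumes "n \<noteq> 0"
  shows "iota (psym n) = (power_sum n :: 'a::comm_ring_1 xps)"
  using assms
proof (induction n rule: less_induct)
  case (less n)
  interpret i: comm_ring_hom "iota :: 'a sym \<Rightarrow> 'a xps" by (rule iota_hom)
  have I: "{1..n} = insert n {1..<n}" using less.prems by auto
  have last: "(\<Sum>i=1..n. f i) = f n + (\<Sum>i\<in>{1..<n}. f i)" for f :: "nat \<Rightarrow> 'a xps"
    unfolding I by simp
  have "iota (psym n) + (\<Sum>i\<in>{1..<n}. iota (psym i) * complete_sym (n - i)) =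
      (\<Sum>i=1..n. iota (psym i) * (complete_sym (n - i) :: 'a xps))"
    by (subst last) simp
  also have "\<dots> = iota (of_nat n * hvar n)"
    unfolding newton by (simp add: i.hom_sum i.hom_mult)
  also have "\<dots> = of_nat n * complete_sym n" by (simp add: i.hom_mult i.hom_of_nat)
  also have "\<dots> = power_sum n + (\<Sum>i\<in>{1..<n}. power_sum i * complete_sym (n - i))"
    unfolding xps_newton by (subst last) simp
  also have "(\<Sum>i\<in>{1..<n}. power_sum i * complete_sym (n - i)) =
      (\<Sum>i\<in>{1..<n}. iota (psym i) * (complete_sym (n - i) :: 'a xps))"
    using less.IH by (intro sum.cong) auto
  finally show ?case by simp
qed

text \<open>The monomial $\prod_j x_{f_j}^{l_j}$. The variables $f_j$ may coincide: these are the monomials that arise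
  when the product of the power sums $p_{l_j}$ is expanded.\<close>

definition monomial_at :: "nat list \<Rightarrow> nat list \<Rightarrow> nat multiset" where
  "monomial_at l f = sum_list (map2 replicate_mset l f)"

lemma monomial_at_Nil [simp]: "monomial_at [] f = {#}" and monomial_at_Cons [simp]: "monomial_at (r # l) (i # f) = replicate_mset r i + monomial_at l f"
  by (simp_all add: monomial_at_def)

lemma count_monomial_at_notin:
  "length l = length f \<Longrightarrow> i \<notin> set f \<Longrightarrow> count (monomial_at l f) i = 0"
  by (induction l f rule: list_induct2) auto

lemma count_monomial_at_distinct:
  "length l = length f \<Longrightarrow> distinct f \<Longrightarrow> j < length f \<Longrightarrow> count (monomial_at l f) (f ! j) = l ! j"
proof (induction l f arbitrary: j rule: list_induct2)
  case (Cons r l i f)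
  thus ?case by (cases j) (auto simp: count_monomial_at_notin)
qed simp

lemma count_xmonomial: "count (xmonomial l) i = (if i < length l then l ! i else 0)"
  by (simp add: xmonomial_def count_sum sum.delta)

text \<open>For positive $l_j$ the coefficient counts the ways to write the monomial as $\prod_j x_{f_j}^{l_j}$. As a
  natural number it does not vanish in characteristic $0$ if there is one such way.\<close>

lemma psum_part_coeff:
  "\<exists>N. \<forall>x. xcoeff (psum_part l :: 'a::comm_ring_1 xps) x = of_nat (N x) \<and>
     (N x > 0 \<longleftrightarrow> (\<exists>f. length f = length l \<and> x = monomial_at l f))"
proof (induction l)
  case Nil
  show ?case
    by (intro exI[of _ "\<lambda>x. if x = {#} then 1 else 0"]) (auto simp: psum_part_def one_xps.rep_eq)
next
  case (Cons r l)
  then obtain N where N: "\<And>x. xcoeff (psum_part l :: 'a xps) x = of_nat (N x)"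
    "\<And>x. N x > 0 \<longleftrightarrow> (\<exists>f. length f = length l \<and> x = monomial_at l f)" by auto
  define N' where "N' x = (\<Sum>p | fst p + snd p = x. if \<exists>i. fst p = replicate_mset r i then N (snd p) else 0)"
    for x
  have fin: "finite {p. fst p + snd p = x}" for x :: "nat multiset" by (rule finite_antidiagonal')
  have "xcoeff (psum_part (r # l) :: 'a xps) x = of_nat (N' x)" for x
  proof -
    have "xcoeff (psum_part (r # l) :: 'a xps) x = xcoeff (power_sum r * psum_part l :: 'a xps) x"
      by (simp add: psum_part_def)
    also have "\<dots> = of_nat (N' x)"
      unfolding xcoeff_mult N'_def of_nat_sum case_prod_unfold
      by (intro sum.cong) (auto simp: xcoeff_power_sum N(1))
    finally show ?thesis .
  qed
  moreover have "N' x > 0 \<longleftrightarrow> (\<exists>f. length f = length (r # l) \<and> x = monomial_at (r # l) f)" for x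
  proof
    assume "N' x > 0"
    have "\<exists>p\<in>{p. fst p + snd p = x}. (if \<exists>i. fst p = replicate_mset r i then N (snd p) else 0) \<noteq> 0"
    proof (rule ccontr)
      assume "\<not> ?thesis"
      hence "N' x = 0" unfolding N'_def by (intro sum.neutral) blast
      thus False using \<open>N' x > 0\<close> by simp
    qed
    then obtain p i where p: "fst p + snd p = x" "fst p = replicate_mset r i" "N (snd p) > 0"
      by (auto split: if_splits)
    then obtain f where "length f = length l" "snd p = monomial_at l f" using N(2) by auto
    thus "\<exists>f. length f = length (r # l) \<and> x = monomial_at (r # l) f"
      using p by (intro exI[of _ "i # f"]) auto
  next
    assume "\<exists>f. length f = length (r # l) \<and> x = monomial_at (r # l) f"
    then obtain i f where f: "length f = length l" "x = replicate_mset r i + monomial_at l f"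
      by (auto simp: length_Suc_conv)
    hence "N (monomial_at l f) > 0" using N(2) by auto
    moreover have "N (monomial_at l f) \<le> N' x"
    proof -
      let ?g = "\<lambda>p. if \<exists>i. fst p = replicate_mset r i then N (snd p) else 0"
      have "?g (replicate_mset r i, monomial_at l f) \<le> (\<Sum>p | fst p + snd p = x. ?g p)"
        by (rule member_le_sum[OF _ _ fin[of x]]) (use f in auto)
      moreover have "?g (replicate_mset r i, monomial_at l f) = N (monomial_at l f)" by auto
      ultimately show ?thesis unfolding N'_def by simp
    qed
    ultimately show "N' x > 0" by simp
  qed
  ultimately show ?case by blast
qed

lemma prod_list_hmon:
  "is_partition l \<Longrightarrow> prod_list (map \<beta> l) = (\<Prod>k\<in>#hmon l. (\<beta> :: nat \<Rightarrow> 'b::comm_monoid_mult) (Suc k))"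
proof -
  assume "is_partition l"
  hence "prod_list (map \<beta> l) = (\<Prod>k\<in>#image_mset Suc (hmon l). \<beta> k)"
    by (simp only: mset_of_hmon prod_list_map_eq_mset)
  thus ?thesis by (simp add: image_mset.compositionality o_def)
qed

lemma length_partition: "is_partition l \<Longrightarrow> length l = size (hmon l)"
  by (metis mset_of_hmon size_image_mset size_mset)

lemma xmonomial_eq_monomial_at: "xmonomial l = monomial_at l [0..<length l]"
proof (rule multiset_eqI)
  fix i show "count (xmonomial l) i = count (monomial_at l [0..<length l]) i"
    using count_monomial_at_distinct[of l "[0..<length l]" i] count_monomial_at_notin[of l "[0..<length l]" i]
    by (cases "i < length l") (auto simp: count_xmonomial)
qed

text \<open>The monomial $x^l$ has \<open>length l\<close> distinct variables. A list $l'$ with at most as many entries produces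
  it only by placing each entry at a variable of its own, and is then a rearrangement of \<open>l\<close>.\<close>

lemma xmonomial_eq_monomial_at_imp:
  assumes "0 \<notin> set l" "length f = length l'" "xmonomial l = monomial_at l' f" "length l' \<le> length l"
  shows "mset l' = mset l"
proof -
  have sub: "{..<length l} \<subseteq> set f"
  proof
    fix i assume "i \<in> {..<length l}"
    hence i: "i < length l" by simp
    hence "l ! i \<noteq> 0" using assms(1) by (metis nth_mem)
    hence "count (monomial_at l' f) i \<noteq> 0" using i count_xmonomial[of l i] unfolding assms(3) by simp
    thus "i \<in> set f" using count_monomial_at_notin[of l' f i] assms(2) by metis
  qed
  have "length l \<le> card (set f)" using card_mono[OF _ sub] by simp
  with card_length[of f] assms have len: "length f = length l" "card (set f) = length f" by linarith+
  hence dist: "distinct f" by (simp add: card_distinct)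
  have setf: "{..<length l} = set f"
    by (rule card_subset_eq[OF _ sub]) (simp_all add: len)
  have "mset f = mset [0..<length l]"
    by (subst set_eq_iff_mset_eq_distinct[OF dist distinct_upt, symmetric]) (simp add: setf[symmetric] atLeast0LessThan)
  hence "mset (map (\<lambda>i. l ! i) f) = mset (map (\<lambda>i. l ! i) [0..<length l])"
    by (simp only: mset_map)
  moreover have "map (\<lambda>i. l ! i) f = l'"
  proof (rule nth_equalityI)
    fix j assume "j < length (map (\<lambda>i. l ! i) f)"
    hence j: "j < length f" by simp
    hence "f ! j \<in> {..<length l}" unfolding setf by (rule nth_mem)
    hence "l ! (f ! j) = count (xmonomial l) (f ! j)" by (simp add: count_xmonomial)
    also have "\<dots> = l' ! j" unfolding assms(3) by (rule count_monomial_at_distinct[OF assms(2)[symmetric] dist j])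
    finally show "map (\<lambda>i. l ! i) f ! j = l' ! j" using j by simp
  qed (simp add: assms)
  ultimately show ?thesis by (simp only: map_nth)
qed

text \<open>Choose in a relation a term $p_\lambda$ with the largest number of parts. The monomial $x^\lambda$ occurs
  in $p_\lambda$, but in no other $p_\mu$ of the relation.\<close>

lemma power_sum_independent:
  fixes C :: "'a::field_char_0 sym"
  assumes "hsubst xsc power_sum C = 0"
  shows "C = 0"
proof (rule ccontr)
  assume "C \<noteq> 0"
  hence ne: "supp C \<noteq> {}" by simp
  have "Max (size ` supp C) \<in> size ` supp C" using ne by (intro Max_in) auto
  then obtain m where m1: "m \<in> supp C" "size m = Max (size ` supp C)" by auto
  have m: "size m' \<le> size m" if "m' \<in> supp C" for m'
    unfolding m1(2) using that by (intro Max_ge) auto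
  obtain l where l: "is_partition l" "hmon l = m" by (rule hmon_surj)
  let ?x = "xmonomial l" and ?P = "\<lambda>m'. (\<Prod>k\<in>#m'. power_sum (Suc k)) :: 'a xps"
  have P: "?P (hmon l') = psum_part l'" if "is_partition l'" for l'
    unfolding psum_part_def by (rule prod_list_hmon[OF that, symmetric])
  have zero: "xcoeff (?P m') ?x = 0" if m': "m' \<in> supp C" "m' \<noteq> m" for m'
  proof -
    obtain l' where l': "is_partition l'" "hmon l' = m'" by (rule hmon_surj)
    obtain N where N: "xcoeff (psum_part l' :: 'a xps) ?x = of_nat (N ?x)"
      "N ?x > 0 \<longleftrightarrow> (\<exists>f. length f = length l' \<and> ?x = monomial_at l' f)" using psum_part_coeff[of l'] by blast
    have "\<not> N ?x > 0"
    proof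
      assume "N ?x > 0"
      then obtain f where f: "length f = length l'" "?x = monomial_at l' f" using N(2) by auto
      have le: "length l' \<le> length l" using m[OF m'(1)] l l' by (simp add: length_partition)
      have "mset l' = mset l"
        by (rule xmonomial_eq_monomial_at_imp[OF _ f le]) (use l(1) in \<open>simp add: is_partition_def\<close>)
      hence "hmon l' = hmon l" by (simp only: hmon_def)
      thus False using m'(2) l l' by simp
    qed
    thus ?thesis using N(1) P[OF l'(1)] l'(2) by simp
  qed
  have nonzero: "xcoeff (?P m) ?x \<noteq> 0"
  proof -
    obtain N where N: "xcoeff (psum_part l :: 'a xps) ?x = of_nat (N ?x)"
      "N ?x > 0 \<longleftrightarrow> (\<exists>f. length f = length l \<and> ?x = monomial_at l f)" using psum_part_coeff[of l] by blast
    have "N ?x > 0" unfolding N(2) using xmonomial_eq_monomial_at[of l] by (intro exI[of _ "[0..<length l]"]) simp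
    thus ?thesis using N(1) P[OF l(1)] l(2) by simp
  qed
  have "0 = xcoeff (hsubst xsc power_sum C) ?x" by (simp add: assms zero_xps.rep_eq)
  also have "\<dots> = (\<Sum>m'\<in>supp C. mcoeff C m' * xcoeff (?P m') ?x)"
    by (simp add: hsubst_def xcoeff_sum xsc_mult)
  also have "\<dots> = (\<Sum>m'\<in>{m}. mcoeff C m' * xcoeff (?P m') ?x)"
    by (rule sum.mono_neutral_right) (use m1 zero in auto)
  finally show False using nonzero m1(1) by (simp add: in_keys_iff)
qed

lemma iota_hsubst_psym: "iota (hsubst cst psym C) = hsubst xsc power_sum C"
  unfolding hom_hsubst[OF iota_hom] by (simp add: hsubst_def iota_psym)

lemma iota_inj:
  assumes "iota F = iota (G :: 'a::field_char_0 sym)"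
  shows "F = G"
proof -
  interpret i: comm_ring_hom "iota :: 'a sym \<Rightarrow> 'a xps" by (rule iota_hom)
  interpret p: comm_ring_hom "hsubst cst psym :: 'a sym \<Rightarrow> 'a sym" by (rule hsubst_hom[OF cst_hom])
  obtain C where C: "F - G = hsubst cst psym C" using psym_span_all by blast
  have "hsubst xsc power_sum C = 0"
    using assms by (simp add: iota_hsubst_psym[symmetric] C[symmetric] i.hom_minus)
  hence "F - G = 0" using power_sum_independent C by fastforce
  thus ?thesis by simp
qed

section \<open>Expansions in multiplicative bases\<close>

text \<open>The coefficients of a polynomial, indexed by partitions: this identifies expansions in a multiplicative
  basis $b_\lambda = \prod_i \beta(\lambda_i)$ with polynomials in the $\beta(k)$.\<close>

definition unpack :: "'a::zero sym \<Rightarrow> nat list \<Rightarrow> 'a" where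
  "unpack C l = (if is_partition l then mcoeff C (hmon l) else 0)"

lemma unpack_nonzero_iff: "unpack C l \<noteq> 0 \<longleftrightarrow> is_partition l \<and> hmon l \<in> supp C"
  by (simp add: unpack_def in_keys_iff)

lemma bij_unpack: "bij_betw hmon {l. unpack C l \<noteq> 0} (supp C)"
  unfolding unpack_nonzero_iff
proof (rule bij_betw_imageI)
  show "inj_on hmon {l. is_partition l \<and> hmon l \<in> supp C}"
    by (rule inj_on_subset[OF inj_on_hmon]) blast
  show "hmon ` {l. is_partition l \<and> hmon l \<in> supp C} = supp C"
  proof (intro equalityI subsetI)
    fix m assume m: "m \<in> supp C"
    obtain l where "is_partition l" "hmon l = m" by (rule hmon_surj)
    thus "m \<in> hmon ` {l. is_partition l \<and> hmon l \<in> supp C}" using m by blast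
  qed blast
qed

lemma finite_unpack: "finite {l. unpack C l \<noteq> 0}"
  unfolding bij_betw_finite[OF bij_unpack[of C]] by (rule finite_keys)

lemma hsubst_eq_sum_unpack:
  "hsubst xsc \<beta> C = (\<Sum>l | unpack C l \<noteq> 0. xscale (unpack C l) (prod_list (map \<beta> l)))"
proof -
  have "hsubst xsc \<beta> C = (\<Sum>l | unpack C l \<noteq> 0. xsc (mcoeff C (hmon l)) * (\<Prod>k\<in>#hmon l. \<beta> (Suc k)))"
    unfolding hsubst_def by (rule sum.reindex_bij_betw[OF bij_unpack, symmetric])
  also have "\<dots> = (\<Sum>l | unpack C l \<noteq> 0. xscale (unpack C l) (prod_list (map \<beta> l)))"
    by (intro sum.cong refl) (auto simp: unpack_def xsc_mult prod_list_hmon split: if_splits)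
  finally show ?thesis .
qed

lemma expands_multiplicative_iff:
  assumes "\<And>l. b l = prod_list (map \<beta> l)"
  shows "expands b f c \<longleftrightarrow> (\<exists>C. c = unpack C \<and> f = hsubst xsc \<beta> C)"
proof
  assume e: "expands b f c"
  define C where "C = (\<Sum>l | c l \<noteq> 0. Poly_Mapping.single (hmon l) (c l))"
  have fin: "finite {l. c l \<noteq> 0}" and part: "\<And>l. c l \<noteq> 0 \<Longrightarrow> is_partition l"
    using e by (auto simp: expands_def)
  have c: "c = unpack C"
  proof
    fix l show "c l = unpack C l"
    proof (cases "is_partition l")
      case True
      have "mcoeff C (hmon l) = (\<Sum>l' | c l' \<noteq> 0. if l' = l then c l else 0)"
        unfolding C_def lookup_sum
        using True part by (intro sum.cong refl) (auto simp: lookup_single when_def dest: partition_eqI)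
      thus ?thesis using True fin by (simp add: unpack_def sum.delta)
    next
      case False
      thus ?thesis using part by (auto simp: unpack_def)
    qed
  qed
  show "\<exists>C. c = unpack C \<and> f = hsubst xsc \<beta> C"
    using e c by (intro exI[of _ C]) (auto simp: expands_def hsubst_eq_sum_unpack assms)
next
  assume "\<exists>C. c = unpack C \<and> f = hsubst xsc \<beta> C"
  then obtain C where C: "c = unpack C" "f = hsubst xsc \<beta> C" by blast
  show "expands b f c"
    unfolding expands_def C using finite_unpack[of C]
    by (auto simp: hsubst_eq_sum_unpack assms) (auto simp: unpack_def split: if_splits)
qed

lemma coeffs_in_psum: "coeffs_in psum_part (hsubst xsc power_sum (C :: 'a::field_char_0 sym)) = unpack C"
  unfolding coeffs_in_def
proof (rule the_equality)
  interpret p: comm_ring_hom "hsubst xsc power_sum :: 'a sym \<Rightarrow> 'a xps" by (rule hsubst_hom[OF xsc_hom])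
  note iff = expands_multiplicative_iff[of psum_part power_sum, OF psum_part_def]
  show "expands psum_part (hsubst xsc power_sum C) (unpack C)" unfolding iff by blast
  fix c assume "expands psum_part (hsubst xsc power_sum C) c"
  then obtain C' where C': "c = unpack C'" "hsubst xsc power_sum C = hsubst xsc power_sum C'"
    unfolding iff by blast
  hence "hsubst xsc power_sum (C - C') = 0" by (simp add: p.hom_minus)
  hence "C - C' = 0" by (rule power_sum_independent)
  thus "c = unpack C" using C' by simp
qed

lemma coeffs_in_h_part: "coeffs_in h_part (iota (C :: 'a::field_char_0 sym)) = unpack C"
  unfolding coeffs_in_def
proof (rule the_equality)
  note iff = expands_multiplicative_iff[of h_part complete_sym, OF h_part_def, folded iota_def]
  show "expands h_part (iota C) (unpack C)" unfolding iff by blast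
  fix c assume "expands h_part (iota C) c"
  then obtain C' where "c = unpack C'" "iota C = iota C'" unfolding iff by blast
  thus "c = unpack C" by (auto dest: iota_inj)
qed

lemma pleth_iota: "pleth_one_minus a (iota F) = iota (theta a (F :: 'a::field_char_0 sym))"
proof -
  interpret i: comm_ring_hom "iota :: 'a sym \<Rightarrow> 'a xps" by (rule iota_hom)
  obtain C where C: "F = hsubst cst psym C" using psym_span_all by blast
  have F: "iota F = hsubst xsc power_sum C" by (simp add: C iota_hsubst_psym)
  have "pleth_one_minus a (iota F) = hsubst xsc (\<lambda>r. xscale (1 - a ^ r) (power_sum r)) C"
    unfolding F pleth_one_minus_def coeffs_in_psum by (simp add: Let_def hsubst_eq_sum_unpack)
  also have "\<dots> = iota (theta a F)"
    unfolding C hom_hsubst[OF theta_hom] hom_hsubst[OF iota_hom]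
    by (simp add: hsubst_def theta_psym i.hom_mult iota_psym xsc_mult del: power_Suc)
  finally show ?thesis .
qed

lemma h_part_eq_iota: "h_part l = iota (hprod l)"
proof -
  interpret i: comm_ring_hom "iota :: 'a sym \<Rightarrow> 'a xps" by (rule iota_hom)
  show ?thesis by (induction l) (simp_all add: h_part_def i.hom_mult)
qed

lemma hall_h_part:
  assumes "is_partition \<mu>"
  shows "hall f (h_part \<mu>) = xcoeff (f :: 'a::field_char_0 xps) (xmonomial \<mu>)"
proof -
  have "unpack (hprod \<mu>) l = (if l = \<mu> then 1 else (0 :: 'a))" for l
    using assms by (auto simp: unpack_def mcoeff_hprod dest: partition_eqI)
  thus ?thesis unfolding hall_def h_part_eq_iota coeffs_in_h_part by (simp add: Let_def)
qed

lemma schur_row_part: "schur (row_part n) = h_part (row_part n)"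
  by (simp add: schur_def row_part_def h_part_def det_def)

section \<open>Schur functions\<close>

text \<open>The Jacobi-Trudi determinant in the polynomial ring.\<close>

definition sdet :: "nat list \<Rightarrow> 'a::comm_ring_1 sym" where
  "sdet l = det (mat (length l) (length l)
     (\<lambda>(i, j). if i \<le> l ! i + j then hvar (l ! i + j - i) else 0))"

lemma schur_eq_iota: "schur l = iota (sdet l)"
proof -
  interpret i: comm_ring_hom "iota :: 'a sym \<Rightarrow> 'a xps" by (rule iota_hom)
  let ?M = "mat (length l) (length l) (\<lambda>(i, j). if i \<le> l ! i + j then hvar (l ! i + j - i) else 0) :: 'a sym mat"
  have "(mat (length l) (length l) (\<lambda>(i, j). if i \<le> l ! i + j then complete_sym (l ! i + j - i) else 0) :: 'a xps mat)
      = map_mat iota ?M"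
    by (rule eq_matI) auto
  thus ?thesis unfolding schur_def sdet_def by (simp only: i.hom_det)
qed

lemma sum_le_sum_inj:
  fixes p :: "nat \<Rightarrow> nat"
  assumes "inj_on p {..<k}"
  shows "(\<Sum>i<k. i) \<le> (\<Sum>i<k. p i)"
proof -
  have *: "(\<Sum>i<card A. i) \<le> \<Sum>A" if "finite A" for A :: "nat set"
    using that
  proof (induction "card A" arbitrary: A)
    case (Suc c)
    hence ne: "A \<noteq> {}" by auto
    let ?m = "Max A"
    have m: "?m \<in> A" using Suc ne by simp
    have "card A \<le> Suc ?m"
      using card_mono[of "{..?m}" A] Suc.prems Max_ge[OF Suc.prems] by (simp add: subset_iff)
    hence "c \<le> ?m" using Suc by simp
    moreover have "(\<Sum>i<card (A - {?m}). i) \<le> \<Sum>(A - {?m})"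
      using Suc m by (intro Suc.hyps) auto
    moreover have "\<Sum>A = ?m + \<Sum>(A - {?m})" using Suc m by (simp add: sum.remove)
    moreover have "card (A - {?m}) = c" using Suc m by simp
    ultimately show ?case using Suc.hyps(2) by (simp flip: Suc.hyps(2))
  qed simp
  have "(\<Sum>i<card (p ` {..<k}). i) \<le> \<Sum>(p ` {..<k})" by (rule *) simp
  thus ?thesis using assms by (simp add: card_image sum.reindex o_def)
qed

text \<open>The term of a permutation \<open>p\<close> is $\pm h_\gamma$ with $\gamma_i = l_i + p(i) - i$. The partial sums of
  $\gamma$ are at least those of \<open>l\<close> because \<open>k\<close> distinct natural numbers have a sum of at least
  $0 + 1 + \cdots + (k-1)$.\<close>

lemma sdet_hspan:
  assumes "is_partition l"
  shows "sdet l - hprod l \<in> hspan (hmon ` ({m. m \<unrhd>\<^sub>d l} - {l}))"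
proof -
  let ?n = "length l"
  let ?A = "mat ?n ?n (\<lambda>(i, j). if i \<le> l ! i + j then hvar (l ! i + j - i) else 0) :: 'a sym mat"
  let ?t = "\<lambda>p. signof p * (\<Prod>i = 0..<?n. ?A $$ (i, p i))"
  let ?S = "{p. p permutes {0..<?n}}"
  have fin: "finite ?S" by (rule finite_permutations) simp
  have "sdet l = (\<Sum>p\<in>?S. ?t p)" by (simp add: sdet_def det_def)
  also have "\<dots> = ?t id + (\<Sum>p\<in>?S - {id}. ?t p)"
    using fin permutes_id by (intro sum.remove) auto
  also have "?t id = hprod l"
  proof -
    have "?t id = (\<Prod>i = 0..<?n. hvar (l ! i))" by simp
    thus ?thesis unfolding hprod_def prod.list_conv_set_nth by simp
  qed
  finally have "sdet l - hprod l = (\<Sum>p\<in>?S - {id}. ?t p)" by (simp only: add_diff_cancel_left')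
  also have "\<dots> \<in> hspan (hmon ` ({m. m \<unrhd>\<^sub>d l} - {l}))"
  proof (rule hspan_sum)
    fix p assume p: "p \<in> ?S - {id}"
    show "?t p \<in> hspan (hmon ` ({m. m \<unrhd>\<^sub>d l} - {l}))"
    proof (cases "\<forall>i<?n. i \<le> l ! i + p i")
      case False
      then obtain i where i: "i < ?n" "\<not> i \<le> l ! i + p i" by auto
      moreover have "p i < ?n" using p i(1) permutes_in_image[of p "{0..<?n}" i] by auto
      ultimately have "(\<Prod>i = 0..<?n. ?A $$ (i, p i)) = 0"
        by (intro prod_zero) (auto intro!: bexI[of _ i])
      thus ?thesis by (simp add: hspan_0)
    next
      case True
      \<comment> \<open>No subtraction is truncated here: otherwise the term of \<open>p\<close> vanishes, by the other case.\<close>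
      define \<gamma> where "\<gamma> = map (\<lambda>i. l ! i + p i - i) [0..<?n]"
      have inj: "inj p" using p by (auto intro: permutes_inj)
      have partial: "sum_list (take k \<gamma>) + (\<Sum>i<k. i) = sum_list (take k l) + (\<Sum>i<k. p i)" if "k \<le> ?n" for k
      proof -
        have "sum_list (take k \<gamma>) = (\<Sum>i<k. l ! i + p i - i)"
          using that by (simp add: sum_list_sum_nth \<gamma>_def atLeast0LessThan)
        moreover have "sum_list (take k l) = (\<Sum>i<k. l ! i)"
          using that by (simp add: sum_list_sum_nth atLeast0LessThan)
        moreover have "(\<Sum>i<k. l ! i + p i - i) + (\<Sum>i<k. i) = (\<Sum>i<k. l ! i) + (\<Sum>i<k. p i)"
          unfolding sum.distrib[symmetric] using True that by (intro sum.cong) auto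
        ultimately show ?thesis by simp
      qed
      have len: "length \<gamma> = ?n" by (simp add: \<gamma>_def)
      have "(\<Sum>i<?n. p i) = (\<Sum>i<?n. i)"
        using sum.permute[of p "{..<?n}" id] p by (simp add: atLeast0LessThan)
      hence total: "sum_list \<gamma> = sum_list l" using partial[of ?n] len by simp
      have "sum_list (take k l) \<le> sum_list (take k \<gamma>)" for k
      proof (cases "k \<le> ?n")
        case True
        have "(\<Sum>i<k. i) \<le> (\<Sum>i<k. p i)"
          by (rule sum_le_sum_inj) (rule inj_on_subset[OF inj], simp)
        thus ?thesis using partial[OF True] by simp
      qed (use total len in simp)
      hence low: "\<gamma> \<in> lowered 0 l" using len total by (simp add: lowered_def)
      have neq: "\<gamma> \<noteq> l"
      proof
        assume "\<gamma> = l"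
        have "p i = i" for i
        proof (cases "i < ?n")
          case i: True
          have "\<gamma> ! i = l ! i + p i - i" using i by (simp add: \<gamma>_def)
          moreover have "i \<le> l ! i + p i" using True i by blast
          ultimately show ?thesis using \<open>\<gamma> = l\<close> by simp
        next
          case False
          thus ?thesis using p by (auto simp: permutes_def)
        qed
        hence "p = id" by auto
        thus False using p by simp
      qed
      obtain \<nu> where nu: "hmon \<nu> = hmon \<gamma>" "\<nu> \<unrhd>\<^sub>d l" "\<nu> = l \<Longrightarrow> \<gamma> = l"
        using lowered_dominates[OF assms low] by blast
      have "(\<Prod>i = 0..<?n. ?A $$ (i, p i)) = (\<Prod>i = 0..<?n. hvar (\<gamma> ! i))"
      proof (rule prod.cong[OF refl])
        fix i assume i: "i \<in> {0..<?n}"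
        hence "p i < ?n" using p permutes_in_image[of p "{0..<?n}" i] by auto
        thus "?A $$ (i, p i) = hvar (\<gamma> ! i)" using i True by (simp add: \<gamma>_def)
      qed
      also have "\<dots> = hprod \<gamma>" unfolding hprod_def using len
        by (simp add: prod.list_conv_set_nth)
      finally have eq: "?t p = cst (signof p) * hprod \<gamma>"
        by (simp only: cst.hom_of_int)
      have "hprod \<gamma> \<in> hspan (hmon ` ({m. m \<unrhd>\<^sub>d l} - {l}))"
        by (rule hspan_hprod) (use nu neq in \<open>auto intro!: image_eqI[of _ _ \<nu>]\<close>)
      thus ?thesis unfolding eq by (rule hspan_cst)
    qed
  qed
  finally show ?thesis .
qed

lemma iota_cst_mult: "iota (cst c * F) = xscale c (iota F)"
proof -
  interpret i: comm_ring_hom "iota :: 'a sym \<Rightarrow> 'a xps" by (rule iota_hom)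
  show ?thesis by (simp add: i.hom_mult xsc_mult)
qed

text \<open>With \<open>schur_spanD\<close> this replaces the Schur functions in the definition of the Macdonald functions by
  products of complete functions.\<close>

lemma schur_spanI:
  assumes "up_set n S" "F \<in> hspan (hmon ` S)" "S \<subseteq> A"
  shows "iota F \<in> schur_span A"
proof -
  interpret i: comm_ring_hom "iota :: 'a sym \<Rightarrow> 'a xps" by (rule iota_hom)
  obtain a where a: "F = (\<Sum>m\<in>S. cst (a m) * sdet m)"
    using unitriangular_span[of sdet, OF sdet_hspan assms(1,2)] by blast
  define c where "c l = (if l \<in> S then a l else 0)" for l
  have fin: "finite S" by (rule up_set_finite[OF assms(1)])
  have "iota F = (\<Sum>m\<in>S. xscale (c m) (schur m))"
    unfolding a i.hom_sum by (intro sum.cong refl) (simp add: iota_cst_mult schur_eq_iota c_def)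
  also have "\<dots> = (\<Sum>m | c m \<noteq> 0. xscale (c m) (schur m))"
    by (rule sum.mono_neutral_right[OF fin]) (auto simp: c_def xscale_def zero_xps_def split: if_splits)
  finally have eq: "iota F = (\<Sum>m | c m \<noteq> 0. xscale (c m) (schur m))" .
  have sub: "{l. c l \<noteq> 0} \<subseteq> S" by (auto simp: c_def)
  hence "expands schur (iota F) c"
    unfolding expands_def using eq finite_subset[OF sub fin] assms(1) by (auto simp: up_set_def c_def)
  thus ?thesis unfolding schur_span_def using sub assms(3) by blast
qed

lemma schur_spanD:
  assumes "f \<in> schur_span A"
  shows "\<exists>F \<in> hspan (hmon ` {m. \<exists>l\<in>A. m \<unrhd>\<^sub>d l}). f = iota F"
proof -
  interpret i: comm_ring_hom "iota :: 'a sym \<Rightarrow> 'a xps" by (rule iota_hom)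
  obtain c where c: "expands schur f c" "\<And>l. c l \<noteq> 0 \<Longrightarrow> l \<in> A"
    using assms by (auto simp: schur_span_def)
  define F where "F = (\<Sum>l | c l \<noteq> 0. cst (c l) * sdet l)"
  have "f = iota F"
    using c(1) by (simp add: expands_def F_def i.hom_sum iota_cst_mult schur_eq_iota)
  moreover have "F \<in> hspan (hmon ` {m. \<exists>l\<in>A. m \<unrhd>\<^sub>d l})" unfolding F_def
  proof (intro hspan_sum hspan_cst)
    fix l assume "l \<in> {l. c l \<noteq> 0}"
    hence l: "l \<in> A" "is_partition l" using c by (auto simp: expands_def)
    have "sdet l - hprod l \<in> hspan (hmon ` {m. \<exists>l\<in>A. m \<unrhd>\<^sub>d l})"
      by (rule hspan_mono[OF sdet_hspan[OF l(2)]]) (use l in blast)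
    moreover have "hprod l \<in> hspan (hmon ` {m. \<exists>l\<in>A. m \<unrhd>\<^sub>d l})"
      by (rule hspan_hprod) (use l dominates_refl in blast)
    ultimately show "sdet l \<in> hspan (hmon ` {m. \<exists>l\<in>A. m \<unrhd>\<^sub>d l})"
      using hspan_add by fastforce
  qed
  ultimately show ?thesis by blast
qed

section \<open>Conjugate partitions and eigenvalues\<close>

lemma filter_gt_sorted:
  assumes "sorted_wrt (\<ge>) (l :: nat list)"
  shows "j < length (filter (\<lambda>r. i < r) l) \<longleftrightarrow> j < length l \<and> i < l ! j"
  using assms
proof (induction l arbitrary: j)
  case (Cons a l)
  show ?case
  proof (cases "i < a")
    case True
    thus ?thesis using Cons by (cases j) auto
  next
    case False
    hence "\<forall>r\<in>set (a # l). \<not> i < r" using Cons.prems by auto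
    hence "filter (\<lambda>r. i < r) (a # l) = []" by (simp only: filter_empty_conv)
    thus ?thesis using \<open>\<forall>r\<in>set (a # l). \<not> i < r\<close> by (metis length_greater_0_conv not_less0 nth_mem list.size(3))
  qed
qed simp

lemma conj_part_nth: "j < length (conj_part l) \<Longrightarrow> conj_part l ! j = length (filter (\<lambda>r. j < r) l)"
  by (simp add: conj_part_def split: list.splits)

lemma length_conj_part: "length (conj_part l) = (case l of [] \<Rightarrow> 0 | r # _ \<Rightarrow> r)"
  by (simp add: conj_part_def)

lemma filter_gt_beyond:
  assumes "is_partition l" "j \<ge> length (conj_part l)"
  shows "filter (\<lambda>r. j < r) l = []"
  using assms by (cases l) (auto simp: length_conj_part is_partition_def filter_empty_conv)

lemma cells_conj_part:
  assumes "is_partition l"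
  shows "(i, j) \<in> cells (conj_part l) \<longleftrightarrow> (j, i) \<in> cells l"
proof -
  have "(i, j) \<in> cells (conj_part l) \<longleftrightarrow> j < length (filter (\<lambda>r. i < r) l)"
  proof (cases "i < length (conj_part l)")
    case False
    hence "filter (\<lambda>r. i < r) l = []" by (intro filter_gt_beyond[OF assms]) simp
    thus ?thesis using False by (simp add: cells_def)
  qed (simp add: cells_def conj_part_nth)
  thus ?thesis using filter_gt_sorted[of l j i] assms by (simp add: is_partition_def cells_def)
qed

lemma conj_part_partition:
  assumes "is_partition l"
  shows "is_partition (conj_part l)"
proof -
  have "length (filter (\<lambda>r. j < r) l) \<le> length (filter (\<lambda>r. i < r) l)" if "i \<le> j" for i j :: nat
    using that by (induction l) auto
  moreover have "0 < length (filter (\<lambda>r. j < r) l)" if "j < length (conj_part l)" for j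
    using that filter_gt_sorted[of l 0 j] assms by (cases l) (auto simp: length_conj_part is_partition_def)
  ultimately show ?thesis
    unfolding is_partition_def sorted_wrt_iff_nth_less
    by (auto simp: conj_part_nth in_set_conv_nth)
qed

lemma cells_Nil [simp]: "cells [] = {}" by (simp add: cells_def)

lemma cells_Cons: "cells (a # l) = Pair 0 ` {..<a} \<union> map_prod Suc id ` cells l"
proof (rule Set.set_eqI)
  fix s :: "nat \<times> nat"
  obtain i j where s: "s = (i, j)" by fastforce
  show "s \<in> cells (a # l) \<longleftrightarrow> s \<in> Pair 0 ` {..<a} \<union> map_prod Suc id ` cells l"
    unfolding s by (cases i) (auto simp: cells_def image_iff)
qed

lemma finite_cells [simp]: "finite (cells l)"
  by (induction l) (simp_all add: cells_Cons)

lemma sum_cells_Cons: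
  "(\<Sum>s\<in>cells (a # l). f s) = (\<Sum>j<a. f (0, j)) + (\<Sum>(i, j)\<in>cells l. f (Suc i, j))"
proof -
  have "(\<Sum>s\<in>cells (a # l). f s) = (\<Sum>s\<in>Pair 0 ` {..<a}. f s) + (\<Sum>s\<in>map_prod Suc id ` cells l. f s)"
    unfolding cells_Cons by (rule sum.union_disjoint) auto
  also have "(\<Sum>s\<in>map_prod Suc id ` cells l. f s) = (\<Sum>(i, j)\<in>cells l. f (Suc i, j))"
    by (subst sum.reindex) (auto intro!: inj_onI simp: case_prod_unfold map_prod_def)
  finally show ?thesis by (simp add: sum.reindex inj_on_def)
qed

lemma card_cells: "card (cells l) = sum_list l"
  using sum_cells_Cons[of "\<lambda>_. 1 :: nat"] by (induction l) auto

lemma cells_inj: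
  assumes "is_partition l" "is_partition m" "cells l = cells m"
  shows "l = m"
proof -
  have *: "{j. (i, j) \<in> cells k} = {..<(if i < length k then k ! i else 0)}" for i and k :: "nat list"
    by (auto simp: cells_def)
  have nth: "(if i < length l then l ! i else 0) = (if i < length m then m ! i else 0)" for i
    using *[of i l] *[of i m] assms(3) by simp
  have pos: "i < length k \<Longrightarrow> k ! i \<noteq> 0" if "is_partition k" for k i
    using that by (metis is_partition_def nth_mem)
  have "i < length l \<longleftrightarrow> i < length m" for i
    using nth[of i] pos[OF assms(1), of i] pos[OF assms(2), of i] by (auto split: if_splits)
  hence "length l = length m" by (metis linorder_neqE_nat less_irrefl)
  thus ?thesis
  proof (rule nth_equalityI)
    fix i assume "i < length l"
    thus "l ! i = m ! i" using nth[of i] \<open>length l = length m\<close> by simp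
  qed
qed

lemma conj_conj_part:
  assumes "is_partition l"
  shows "conj_part (conj_part l) = l"
  using assms by (intro cells_inj conj_part_partition) (auto simp: cells_conj_part conj_part_partition)

lemma bij_swap_cells: "is_partition l \<Longrightarrow> bij_betw prod.swap (cells (conj_part l)) (cells l)"
  by (rule bij_betw_byWitness[of _ prod.swap]) (auto simp: cells_conj_part)

lemma sum_list_conj_part: "is_partition l \<Longrightarrow> sum_list (conj_part l) = sum_list l"
  using bij_betw_same_card[OF bij_swap_cells, of l] by (simp add: card_cells)

lemma sum_take_conj_part:
  assumes "is_partition l"
  shows "sum_list (take m (conj_part l)) = (\<Sum>r\<leftarrow>l. min r m)"
proof -
  let ?c = "\<lambda>j. length (filter (\<lambda>r. j < r) l)"
  have "sum_list (take m (conj_part l)) = (\<Sum>j<min m (length (conj_part l)). conj_part l ! j)"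
    by (simp add: sum_list_sum_nth atLeast0LessThan min.commute)
  also have "\<dots> = (\<Sum>j<min m (length (conj_part l)). ?c j)"
    by (intro sum.cong refl) (simp add: conj_part_nth)
  also have "\<dots> = (\<Sum>j<m. ?c j)"
    using filter_gt_beyond[OF assms] by (intro sum.mono_neutral_left) (auto simp: min_def)
  also have "\<dots> = (\<Sum>r\<leftarrow>l. min r m)"
  proof (induction l)
    case (Cons r l)
    have "(\<Sum>j<m. length (filter (\<lambda>r. j < r) (r # l))) =
        (\<Sum>j<m. (if j < r then 1 else 0) + length (filter (\<lambda>r. j < r) l))"
      by (intro sum.cong) auto
    also have "\<dots> = card {j\<in>{..<m}. j < r} + (\<Sum>j<m. length (filter (\<lambda>r. j < r) l))"
      by (simp add: sum.distrib sum.If_cases Int_def)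
    also have "{j\<in>{..<m}. j < r} = {..<min r m}" by auto
    finally show ?case using Cons by simp
  qed simp
  finally show ?thesis .
qed

text \<open>For each \<open>k\<close>, the parts beyond the first \<open>k\<close> contribute at most themselves to $\sum_r \min(r,m)$ and the
  first \<open>k\<close> at most \<open>m\<close> each. Equality holds when \<open>k\<close> is the number of parts larger than \<open>m\<close>. Thus
  the partial sums of the conjugate partition are determined by those of the partition as a minimum,
  from which the reversal of dominance follows.\<close>

lemma sum_min_le: "(\<Sum>r\<leftarrow>l. min r m) + sum_list (take k l) \<le> k * m + sum_list (l :: nat list)"
proof (induction l arbitrary: k)
  case (Cons a l)
  show ?case using Cons[of "k - 1"] by (cases k) auto
qed simp

lemma sum_min_eq:
  assumes "sorted_wrt (\<ge>) (l :: nat list)" "k = length (filter (\<lambda>r. m < r) l)"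
  shows "(\<Sum>r\<leftarrow>l. min r m) + sum_list (take k l) = k * m + sum_list l"
  using assms
proof (induction l arbitrary: k)
  case (Cons a l)
  show ?case
  proof (cases "m < a")
    case True
    thus ?thesis using Cons by auto
  next
    case False
    hence "\<forall>r\<in>set (a # l). r \<le> m" using Cons.prems by auto
    hence "filter (\<lambda>r. m < r) (a # l) = []" "map (\<lambda>r. min r m) (a # l) = a # l"
      by (auto simp: filter_empty_conv not_less intro!: map_idI)
    thus ?thesis using Cons.prems(2) by simp
  qed
qed simp

lemma dominates_conj:
  assumes "n \<unrhd>\<^sub>d l"
  shows "conj_part l \<unrhd>\<^sub>d conj_part n"
proof -
  have p: "is_partition n" "is_partition l" "sum_list n = sum_list l" using assms by (auto simp: dominates_def)
  have "sum_list (take m (conj_part n)) \<le> sum_list (take m (conj_part l))" for m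
  proof -
    define k where "k = length (filter (\<lambda>r. m < r) l)"
    have "(\<Sum>r\<leftarrow>l. min r m) + sum_list (take k l) = k * m + sum_list l"
      using p by (intro sum_min_eq k_def) (simp add: is_partition_def)
    moreover have "(\<Sum>r\<leftarrow>n. min r m) + sum_list (take k n) \<le> k * m + sum_list n" by (rule sum_min_le)
    moreover have "sum_list (take k l) \<le> sum_list (take k n)" using assms by (simp add: dominates_def)
    ultimately show ?thesis unfolding sum_take_conj_part[OF p(1)] sum_take_conj_part[OF p(2)]
      using p(3) by linarith
  qed
  thus ?thesis using p by (simp add: dominates_def conj_part_partition sum_list_conj_part)
qed

lemma dominates_conj_eq:
  assumes "n \<unrhd>\<^sub>d l" "conj_part n \<unrhd>\<^sub>d conj_part l"
  shows "n = l"
proof -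
  have "conj_part n = conj_part l" by (rule dominates_antisym[OF assms(2) dominates_conj[OF assms(1)]])
  thus ?thesis using assms(1) conj_conj_part by (metis dominates_def)
qed

text \<open>$B_\lambda(q,t)$, the generating function of the cells.\<close>

definition Bsum :: "'a::comm_ring_1 \<Rightarrow> 'a \<Rightarrow> nat list \<Rightarrow> 'a" where
  "Bsum q t l = (\<Sum>(i, j)\<in>cells l. q ^ j * t ^ i)"

lemma Bsum_Cons: "Bsum q t (a # l) = (\<Sum>j<a. q ^ j) + t * Bsum q t l"
  unfolding Bsum_def sum_cells_Cons by (simp add: sum_distrib_left case_prod_unfold mult_ac)

lemma dval_Bsum: "dval q t l = 1 - (1 - q) * (1 - t) * Bsum q t l"
proof (induction l)
  case (Cons a l)
  have "(1 - q) * (\<Sum>j<a. q ^ j) = 1 - q ^ a" by (rule one_diff_power_eq[symmetric])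
  hence *: "q ^ a = 1 - (1 - q) * (\<Sum>j<a. q ^ j)" by simp
  show ?case unfolding dval.simps(2) Cons Bsum_Cons * by (simp add: algebra_simps)
qed (simp add: Bsum_def)

lemma Bsum_conj: "is_partition l \<Longrightarrow> Bsum t q (conj_part l) = Bsum q t l"
  unfolding Bsum_def
  by (subst sum.reindex_bij_betw[OF bij_swap_cells, symmetric]) (auto simp: case_prod_unfold mult.commute)

lemma dval_conj: "is_partition l \<Longrightarrow> dval t q (conj_part l) = dval q t l"
  by (simp add: dval_Bsum Bsum_conj mult_ac)

section \<open>Specialisation to one and two variables\<close>

text \<open>The value at $x_0 = 1$, $x_i = 0$ otherwise. Since $h_k$ restricts to $x_0^k + x_0^{k-1}x_1$ modulo
  $x_1^2$, the second functional \<open>ev1d\<close> gives the coefficient of $x_0^{n-1}x_1$ for degree \<open>n\<close>.\<close>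

definition ev1 :: "'a::comm_ring_1 sym \<Rightarrow> 'a" where "ev1 = hsubst (\<lambda>x. x) (\<lambda>_. 1)"

definition ev1d :: "'a::comm_ring_1 sym \<Rightarrow> 'a" where
  "ev1d F = (\<Sum>m\<in>supp F. mcoeff F m * of_nat (size m))"

lemma id_hom: "comm_ring_hom (\<lambda>x :: 'a::comm_ring_1. x)" by unfold_locales auto

lemma ev1_hom: "comm_ring_hom ev1" unfolding ev1_def by (rule hsubst_hom[OF id_hom])

lemma ev1_cst [simp]: "ev1 (cst c) = c" by (simp add: ev1_def hsubst_cst[OF id_hom])

lemma ev1_hvar [simp]: "ev1 (hvar k) = 1" by (simp add: ev1_def hsubst_hvar[OF id_hom])

lemma ev1_eq_sum: "ev1 F = (\<Sum>m\<in>supp F. mcoeff F m)"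
  by (simp add: ev1_def hsubst_def)

text \<open>Restriction to the variables $x_0, x_1$; the outer series variable is $x_1$.\<close>

definition twovar :: "'a::comm_ring_1 xps \<Rightarrow> 'a fps fps" where
  "twovar F = Abs_fps (\<lambda>b. Abs_fps (\<lambda>a. xcoeff F (replicate_mset a 0 + replicate_mset b 1)))"

lemma twovar_nth: "fps_nth (fps_nth (twovar F) b) a = xcoeff F (replicate_mset a 0 + replicate_mset b 1)"
  by (simp add: twovar_def)

lemma twovar_mult: "twovar (F * G) = twovar F * twovar G"
proof -
  have "xcoeff (F * G) (replicate_mset a 0 + replicate_mset b 1) =
      (\<Sum>(i, j)\<in>{0..b} \<times> {0..a}. xcoeff F (replicate_mset j 0 + replicate_mset i 1) *
        xcoeff G (replicate_mset (a - j) 0 + replicate_mset (b - i) 1))" for a b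
    unfolding xcoeff_mult
  proof (rule sum.reindex_bij_witness[where
        i = "\<lambda>(i, j). (replicate_mset j 0 + replicate_mset i 1, replicate_mset (a - j) 0 + replicate_mset (b - i) 1)"
        and j = "\<lambda>(u, v). (count u 1, count u 0)"])
    fix p assume "p \<in> {(u, v). u + v = replicate_mset a 0 + replicate_mset b (1::nat)}"
    then obtain u v where p: "p = (u, v)" and uv: "u + v = replicate_mset a 0 + replicate_mset b (1::nat)" by auto
    have cnt: "count u x + count v x = (if x = 0 then a else if x = 1 then b else 0)" for x
      using arg_cong[OF uv, of "\<lambda>m. count m x"] by auto
    have u: "replicate_mset (count u 0) 0 + replicate_mset (count u 1) 1 = u"
      using cnt by (intro multiset_eqI) (auto, metis add_is_0 gr0I neq0_conv One_nat_def)
    have v: "replicate_mset (a - count u 0) 0 + replicate_mset (b - count u 1) 1 = v"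
    proof (rule multiset_eqI)
      fix x show "count (replicate_mset (a - count u 0) 0 + replicate_mset (b - count u 1) 1) x = count v x"
        using cnt[of x] by (auto split: if_splits)
    qed
    show "(case case p of (u, v) \<Rightarrow> (count u 1, count u 0) of (i, j) \<Rightarrow>
        (replicate_mset j 0 + replicate_mset i 1, replicate_mset (a - j) 0 + replicate_mset (b - i) 1)) = p"
      using u v by (simp add: p)
    show "(case p of (u, v) \<Rightarrow> (count u 1, count u 0)) \<in> {0..b} \<times> {0..a}"
      using cnt[of 0] cnt[of 1] by (simp add: p)
    show "(case case p of (u, v) \<Rightarrow> (count u 1, count u 0) of (i, j) \<Rightarrow>
        xcoeff F (replicate_mset j 0 + replicate_mset i 1) *
        xcoeff G (replicate_mset (a - j) 0 + replicate_mset (b - i) 1)) = (case p of (u, v) \<Rightarrow> xcoeff F u * xcoeff G v)"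
      using u v by (simp add: p)
  next
    fix p assume "p \<in> {0..b} \<times> {0..a}"
    then obtain i j where p: "p = (i, j)" "i \<le> b" "j \<le> a" by auto
    show "(case case p of (i, j) \<Rightarrow> (replicate_mset j 0 + replicate_mset i (1::nat), replicate_mset (a - j) 0 + replicate_mset (b - i) (1::nat))
        of (u, v) \<Rightarrow> (count u 1, count u 0)) = p" by (simp add: p)
    show "(case p of (i, j) \<Rightarrow> (replicate_mset j 0 + replicate_mset i 1, replicate_mset (a - j) 0 + replicate_mset (b - i) 1))
        \<in> {(u, v). u + v = replicate_mset a 0 + replicate_mset b (1::nat)}"
      using p by (auto intro!: multiset_eqI)
  qed
  thus ?thesis
    by (simp add: fps_eq_iff twovar_nth fps_mult_nth fps_sum_nth sum.cartesian_product case_prod_unfold)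
qed

lemma twovar_hom: "comm_ring_hom twovar"
proof
  show "twovar 1 = 1"
    by (simp add: fps_eq_iff twovar_nth one_xps.rep_eq)
qed (auto simp: fps_eq_iff twovar_nth plus_xps.rep_eq zero_xps.rep_eq twovar_mult)

lemma twovar_prod:
  "fps_nth (twovar (\<Prod>k\<in>#m. complete_sym (Suc k) :: 'a::comm_ring_1 xps)) 0 = fps_X ^ weight m \<and>
   fps_nth (twovar (\<Prod>k\<in>#m. complete_sym (Suc k) :: 'a xps)) 1 = of_nat (size m) * fps_X ^ (weight m - 1)"
proof (induction m)
  interpret tv: comm_ring_hom "twovar :: 'a xps \<Rightarrow> 'a fps fps" by (rule twovar_hom)
  case empty
  show ?case by (simp add: weight_def)
next
  interpret tv: comm_ring_hom "twovar :: 'a xps \<Rightarrow> 'a fps fps" by (rule twovar_hom)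
  case (add k m)
  let ?P = "twovar (\<Prod>k\<in>#m. complete_sym (Suc k) :: 'a xps)"
  have k0: "fps_nth (twovar (complete_sym (Suc k) :: 'a xps)) 0 = fps_X ^ Suc k"
    by (rule fps_ext) (auto simp: twovar_nth xcoeff_complete_sym fps_X_power_nth simp del: power_Suc)
  have k1: "fps_nth (twovar (complete_sym (Suc k) :: 'a xps)) 1 = fps_X ^ k"
    by (rule fps_ext) (auto simp: twovar_nth xcoeff_complete_sym fps_X_power_nth)
  have w: "weight (add_mset k m) = Suc (k + weight m)" by (simp add: weight_def)
  have mw: "of_nat (size m) * fps_X ^ (weight m - 1) * fps_X ^ Suc k = (of_nat (size m) * fps_X ^ (k + weight m) :: 'a fps)"
  proof (cases "m = {#}")
    case False
    then obtain x m' where "m = add_mset x m'" by (meson multiset_cases)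
    hence "weight m > 0" by (simp add: weight_def)
    hence "weight m - 1 + Suc k = k + weight m" by simp
    thus ?thesis by (simp only: mult.assoc flip: power_add)
  qed simp
  have "twovar (\<Prod>k\<in>#add_mset k m. complete_sym (Suc k) :: 'a xps) = twovar (complete_sym (Suc k)) * ?P"
    by (simp add: tv.hom_mult)
  moreover have "fps_nth (f * g) 1 = fps_nth f 0 * fps_nth g 1 + fps_nth f 1 * fps_nth g 0" for f g :: "'a fps fps"
    by (simp add: fps_mult_nth)
  ultimately show ?case using add mw
    by (simp add: w k0 k1[simplified] power_add algebra_simps)
qed

lemma iota_coeffs:
  assumes "F \<in> homog n"
  shows "xcoeff (iota F) (replicate_mset a 0) = (if a = n then ev1 F else 0)"
    and "xcoeff (iota F) (replicate_mset a 0 + {#1#}) = (if Suc a = n then ev1d F else 0)"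
proof -
  interpret tv: comm_ring_hom "twovar :: 'a xps \<Rightarrow> 'a fps fps" by (rule twovar_hom)
  let ?P = "\<lambda>m. (\<Prod>k\<in>#m. complete_sym (Suc k)) :: 'a xps"
  have xc: "xcoeff (iota F) x = (\<Sum>m\<in>supp F. mcoeff F m * xcoeff (?P m) x)" for x
    by (simp add: iota_def hsubst_def xcoeff_sum xsc_mult)
  have w: "weight m = n" if "m \<in> supp F" for m
    using assms that by (auto simp: homog_def hspan_def)
  have P0: "xcoeff (?P m) (replicate_mset a 0) = (if a = weight m then 1 else 0)" for m
    using arg_cong[OF conjunct1[OF twovar_prod[of m, where 'a='a]], of "\<lambda>f. fps_nth f a"]
    by (simp add: twovar_nth fps_X_power_nth)
  have P1: "xcoeff (?P m) (replicate_mset a 0 + {#1#}) = (if Suc a = weight m then of_nat (size m) else 0)" for m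
  proof (cases "m = {#}")
    case True
    thus ?thesis by (simp add: weight_def one_xps.rep_eq)
  next
    case False
    then obtain x m' where "m = add_mset x m'" by (meson multiset_cases)
    hence "weight m > 0" by (simp add: weight_def)
    hence eq: "a = weight m - 1 \<longleftrightarrow> Suc a = weight m" by auto
    have "xcoeff (?P m) (replicate_mset a 0 + {#1#}) = fps_nth (of_nat (size m) * fps_X ^ (weight m - 1) :: 'a fps) a"
      using arg_cong[OF conjunct2[OF twovar_prod[of m, where 'a='a]], of "\<lambda>f. fps_nth f a"]
      by (simp add: twovar_nth)
    also have "\<dots> = of_nat (size m) * (if a = weight m - 1 then 1 else 0)"
      unfolding fps_of_nat[symmetric] by (simp add: fps_X_power_nth)
    also have "\<dots> = of_nat (size m) * (if Suc a = weight m then 1 else 0)" by (simp only: eq)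
    finally show ?thesis by simp
  qed
  show "xcoeff (iota F) (replicate_mset a 0) = (if a = n then ev1 F else 0)"
    unfolding xc ev1_eq_sum by (simp add: P0 w cong: sum.cong)
  show "xcoeff (iota F) (replicate_mset a 0 + {#1#}) = (if Suc a = n then ev1d F else 0)"
    unfolding xc ev1d_def by (simp only: P1) (simp add: w cong: sum.cong)
qed

lemma geometric_fps: "(1 - fps_X) * Abs_fps (\<lambda>_. 1 :: 'a::comm_ring_1) = 1"
  by (rule fps_ext) (simp add: left_diff_distrib)

lemma ev1_hinv: "fps_map ev1 hinv = (1 - fps_X :: 'a::comm_ring_1 fps)"
proof -
  interpret e: comm_ring_hom "fps_map ev1 :: 'a sym fps \<Rightarrow> 'a fps" by (rule fps_map_hom[OF ev1_hom])
  have "fps_map ev1 hgen = Abs_fps (\<lambda>_. 1 :: 'a)" by (simp add: fps_eq_iff)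
  from this[symmetric] have 1: "Abs_fps (\<lambda>_. 1 :: 'a) * fps_map ev1 hinv = 1"
    by (simp add: hgen_hinv flip: e.hom_mult)
  have "fps_map ev1 hinv = ((1 - fps_X) * Abs_fps (\<lambda>_. 1 :: 'a)) * fps_map ev1 hinv" by (simp add: geometric_fps)
  thus ?thesis unfolding mult.assoc 1 by simp
qed

text \<open>The functional \<open>ev1d\<close> is the derivative of \<open>ev1\<close> in the direction in which all $h_k$ move with the same
  speed.\<close>

lemma hsubst_poly_coeffs:
  assumes "\<And>k. coeff (\<phi> (Suc k)) 0 = 1" "\<And>k. coeff (\<phi> (Suc k)) 1 = c"
  shows "coeff (hsubst (\<lambda>x. [:x:]) \<phi> F) 0 = ev1 F"
    and "coeff (hsubst (\<lambda>x. [:x:]) \<phi> F) 1 = c * ev1d F"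
proof -
  have "coeff (\<Prod>k\<in>#m. \<phi> (Suc k)) 0 = 1 \<and> coeff (\<Prod>k\<in>#m. \<phi> (Suc k)) 1 = of_nat (size m) * c" for m
  proof (induction m)
    case (add k m)
    thus ?case using assms[of k] by (simp add: coeff_mult algebra_simps)
  qed simp
  thus "coeff (hsubst (\<lambda>x. [:x:]) \<phi> F) 0 = ev1 F" "coeff (hsubst (\<lambda>x. [:x:]) \<phi> F) 1 = c * ev1d F"
    by (simp_all add: hsubst_def coeff_sum ev1_eq_sum ev1d_def sum_distrib_left mult_ac)
qed

text \<open>For $X = 1$ the series $\sum_k (-v)^k e_k$ is $1 - v$. So only the coefficients of $y^0$ and $y^1$ of the
  translated function are needed, and to first order $h_k[1 + (1-q)(1-t)y] = 1 + (1-q)(1-t)y$ for all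
  $k \ge 1$.\<close>

lemma ev1_D0: "ev1 (D0 q t F) = ev1 F - (1 - q) * (1 - t) * ev1d F"
proof -
  interpret e: comm_ring_hom "ev1 :: 'a sym \<Rightarrow> 'a" by (rule ev1_hom)
  interpret mp: map_poly_comm_ring_hom "ev1 :: 'a sym \<Rightarrow> 'a" ..
  let ?\<phi> = "\<lambda>k. \<Sum>j\<le>k. monom (fps_nth (omega2 q t) j) j"
  have c: "map_poly ev1 [:cst x:] = [:x :: 'a:]" for x by (rule poly_eqI) (simp add: coeff_pCons split: nat.split)
  have "map_poly ev1 (tau (omega2 q t) F) = hsubst (\<lambda>x. [:x:]) ?\<phi> F"
    unfolding tau_def hom_hsubst[OF mp.comm_ring_hom_axioms] c
    by (simp add: mp.hom_sum e.hom_mult)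
  moreover have "coeff (?\<phi> (Suc k)) 0 = 1" for k
    by (simp add: coeff_sum sum.delta)
  moreover have "coeff (?\<phi> (Suc k)) 1 = (1 - q) * (1 - t)" for k
    using omega2_1[of q t] by (simp add: coeff_sum sum.delta)
  ultimately have co: "coeff (map_poly ev1 (tau (omega2 q t) F)) 0 = ev1 F"
    "coeff (map_poly ev1 (tau (omega2 q t) F)) 1 = (1 - q) * (1 - t) * ev1d F"
    using hsubst_poly_coeffs[of ?\<phi> "(1 - q) * (1 - t)" F] by simp_all
  let ?P = "map_poly ev1 (tau (omega2 q t) F)"
  have "ev1 (D0 q t F) = pairing (1 - fps_X) 0 ?P"
    by (simp only: D0_def e.hom_pairing ev1_hinv)
  also have "\<dots> = (\<Sum>s\<le>Suc (degree ?P). shifted (1 - fps_X) 0 s * coeff ?P s)"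
    by (rule pairing_bound) simp
  also have "\<dots> = (\<Sum>s\<in>{0, 1}. shifted (1 - fps_X) 0 s * coeff ?P s)"
    by (rule sum.mono_neutral_right) (auto simp: shifted_def fps_X_nth)
  also have "\<dots> = coeff ?P 0 - coeff ?P 1" by (simp add: shifted_def fps_X_nth)
  finally show ?thesis unfolding co .
qed

section \<open>Existence and uniqueness of the modified Macdonald functions\<close>

lemma hsubst_hvar_id: "hsubst cst hvar F = F"
  unfolding hsubst_def
proof -
  have "(\<Prod>k\<in>#m. hvar (Suc k)) = (Poly_Mapping.single m 1 :: 'a sym)" for m
    by (induction m) (simp_all add: hvar_def mult_single)
  thus "(\<Sum>m\<in>supp F. cst (mcoeff F m) * (\<Prod>k\<in>#m. hvar (Suc k))) = F"
    by (subst (3) sym_sum_singles) (simp add: single_eq_cst[symmetric])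
qed

text \<open>The plethysm rescales the variables of the polynomial that expresses a function through power sums, and
  this polynomial is unique.\<close>

lemma theta_inj:
  fixes F G :: "'a::field_char_0 sym"
  assumes "\<And>k. a ^ Suc k \<noteq> 1" "theta a F = theta a G"
  shows "F = G"
proof -
  interpret th: comm_ring_hom "theta a" by (rule theta_hom)
  interpret i: comm_ring_hom "iota :: 'a sym \<Rightarrow> 'a xps" by (rule iota_hom)
  interpret p: comm_ring_hom "hsubst cst psym :: 'a sym \<Rightarrow> 'a sym" by (rule hsubst_hom[OF cst_hom])
  obtain C where C: "F - G = hsubst cst psym C" using psym_span_all by blast
  let ?b = "\<lambda>k. cst (1 - a ^ k) * hvar k"
  define C' where "C' = hsubst cst ?b C"
  have pb: "hsubst cst psym (?b k) = theta a (psym k)" if "k \<noteq> 0" for k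
    using that by (simp add: p.hom_mult hsubst_cst[OF cst_hom] theta_psym hvar_def hsubst_single[OF cst_hom])
  have "hsubst cst psym C' = theta a (F - G)"
    unfolding C'_def C hom_hsubst[OF theta_hom] hom_hsubst[OF p.comm_ring_hom_axioms]
    by (rule hsubst_cong) (simp_all only: pb hsubst_cst[OF cst_hom] theta_cst nat.distinct simp_thms)
  also have "\<dots> = 0" using assms(2) by (simp add: th.hom_minus)
  finally have "hsubst xsc power_sum C' = 0" by (simp flip: iota_hsubst_psym)
  hence "C' = 0" by (rule power_sum_independent)
  moreover have "hsubst cst (\<lambda>k. cst (inverse (1 - a ^ k)) * hvar k) C' = C"
  proof -
    have hom: "comm_ring_hom (hsubst cst (\<lambda>k. cst (inverse (1 - a ^ k)) * hvar k) :: 'a sym \<Rightarrow> 'a sym)"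
      by (rule hsubst_hom[OF cst_hom])
    interpret h: comm_ring_hom "hsubst cst (\<lambda>k. cst (inverse (1 - a ^ k)) * hvar k) :: 'a sym \<Rightarrow> 'a sym"
      by (rule hom)
    have "hsubst cst (\<lambda>k. cst (inverse (1 - a ^ k)) * hvar k) (?b (Suc k)) = hvar (Suc k)" for k
    proof -
      have "(1 - a ^ Suc k) * inverse (1 - a ^ Suc k) = 1" using assms(1)[of k] by (intro right_inverse) auto
      moreover have "hsubst cst (\<lambda>k. cst (inverse (1 - a ^ k)) * hvar k) (hvar (Suc k)) =
          cst (inverse (1 - a ^ Suc k)) * hvar (Suc k)"
        by (simp add: hvar_def[of "Suc k"] hsubst_single[OF cst_hom] del: power_Suc)
      ultimately show ?thesis
        by (simp only: h.hom_mult hsubst_cst[OF cst_hom] flip: mult.assoc cst.hom_mult) simp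
    qed
    hence "hsubst cst (\<lambda>k. cst (inverse (1 - a ^ k)) * hvar k) C' = hsubst cst hvar C"
      unfolding C'_def hom_hsubst[OF hom] by (rule hsubst_cong) (simp only: hsubst_cst[OF cst_hom])
    thus ?thesis by (simp only: hsubst_hvar_id)
  qed
  ultimately have "C = 0" by (simp add: hsubst_def)
  thus ?thesis using C by simp
qed

lemma xmonomial_row_part: "xmonomial (row_part n) = replicate_mset n 0"
  by (simp add: xmonomial_def row_part_def)

lemma row_part_partition: "is_partition (row_part n)"
  by (simp add: is_partition_def row_part_def)

text \<open>By the last condition an element of \<open>R\<close> that is congruent to $1$ modulo $1-t$ does not vanish; this is
  how the limit $t \to 1$ is used.\<close>

locale macdonald = macdonald_field R q t for R :: "'a::field_char_0 set" and q t +
  assumes q_pow: "q ^ Suc k \<noteq> 1" and t_pow: "t ^ Suc k \<noteq> 1"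
    and inv_mem: "inverse (1 - q ^ Suc k) \<in> R"
    and unit: "x \<in> R \<Longrightarrow> 1 + (1 - t) * x \<noteq> 0"
begin

lemma q_neq_1: "q \<noteq> 1" using q_pow[of 0] by simp

text \<open>For the exchanged parameters only the eigenvectors are needed, not their limit, so the
  filtration may be the trivial one by the whole field.\<close>

sublocale conj: macdonald_field UNIV t q
proof
  fix l m :: "nat list"
  assume lm: "is_partition l" "is_partition m" "sum_list l = sum_list m" "l \<noteq> m"
  have "dval t q l = dval q t (conj_part l)" "dval t q m = dval q t (conj_part m)"
    using lm dval_conj[of "conj_part _" t q] by (metis conj_conj_part conj_part_partition)+
  moreover have "conj_part l \<noteq> conj_part m" using lm conj_conj_part by metis
  ultimately show "dval t q l \<noteq> dval t q m \<and> (1 - q) / (dval t q l - dval t q m) \<in> UNIV"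
    using dval_inj[of "conj_part l" "conj_part m"] lm by (simp add: conj_part_partition sum_list_conj_part)
qed (use q_neq_1 in auto)

text \<open>The value at $X = 1/(1-q)$, that is at the variables $1, q, q^2, \ldots$. After $f \mapsto f[X(1-q)]$ it
  becomes the value at $X = 1$.\<close>

definition evq :: "'a sym \<Rightarrow> 'a" where
  "evq = hsubst (\<lambda>x. x) (\<lambda>k. \<Prod>i=1..k. inverse (1 - q ^ i))"

lemma evq_hom: "comm_ring_hom evq" unfolding evq_def by (rule hsubst_hom[OF id_hom])

lemma evq_cst [simp]: "evq (cst x) = x" by (simp add: evq_def hsubst_cst[OF id_hom])

text \<open>$Q(T) = \sum_k h_k[1/(1-q)]T^k$ satisfies $(1-T)Q(T) = Q(qT)$, so $Q(T)/Q(qT) = 1/(1-T)$.\<close>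

lemma evq_theta: "evq (theta q F) = ev1 F"
proof -
  let ?p = "\<lambda>k. \<Prod>i=1..k. inverse (1 - q ^ i)"
  interpret e: comm_ring_hom evq by (rule evq_hom)
  interpret fe: comm_ring_hom "fps_map evq" by (rule fps_map_hom[OF evq_hom])
  interpret d: comm_ring_hom "fps_dil q" by (rule fps_dil_hom)
  define Q where "Q = Abs_fps ?p"
  have hv: "evq (hvar k) = ?p k" for k unfolding evq_def by (rule hsubst_hvar[OF id_hom]) simp
  have Q: "fps_map evq hgen = Q" by (simp add: fps_eq_iff Q_def hv)
  define I where "I = fps_map evq hinv"
  have "fps_map evq (hgen * hinv) = 1" by (simp add: hgen_hinv)
  hence QI: "Q * I = 1" by (simp add: fe.hom_mult Q I_def)
  have "(1 - fps_X) * Q = fps_dil q Q"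
  proof (rule fps_ext)
    fix n show "fps_nth ((1 - fps_X) * Q) n = fps_nth (fps_dil q Q) n"
    proof (cases n)
      case (Suc m)
      have ne: "1 - q ^ Suc m \<noteq> 0" using q_pow[of m] by auto
      have p: "?p (Suc m) = inverse (1 - q ^ Suc m) * ?p m" by simp
      have "(1 - q ^ Suc m) * ?p (Suc m) = ?p m"
        using ne unfolding p by (simp only: flip: mult.assoc) (simp del: power_Suc)
      hence "?p (Suc m) - ?p m = q ^ Suc m * ?p (Suc m)" by (simp only: left_diff_distrib mult_1_left diff_eq_eq) (simp add: algebra_simps)
      thus ?thesis by (simp add: left_diff_distrib Q_def Suc del: power_Suc prod.cl_ivl_Suc)
    qed (simp add: left_diff_distrib Q_def)
  qed
  hence "(1 - fps_X) * (Q * fps_dil q I) = fps_dil q (Q * I)" by (simp add: d.hom_mult flip: mult.assoc)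
  hence 1: "(1 - fps_X) * (Q * fps_dil q I) = 1" by (simp add: QI)
  have "Q * fps_dil q I = ((1 - fps_X) * Abs_fps (\<lambda>_. 1)) * (Q * fps_dil q I)" by (simp add: geometric_fps)
  also have "\<dots> = Abs_fps (\<lambda>_. 1)" using 1 by (simp add: mult_ac)
  finally have "Q * fps_dil q I = Abs_fps (\<lambda>_. 1)" .
  moreover have "fps_map evq (hgen * fps_dil (cst q) hinv) = Q * fps_dil q I"
    by (simp add: fe.hom_mult Q fps_map_dil[OF evq_hom] I_def)
  ultimately have "evq (fps_nth (hgen * fps_dil (cst q) hinv) k) = 1" for k
    by (metis fps_map_nth fps_nth_Abs_fps)
  moreover have "evq (cst x) = x" for x by (simp add: evq_def hsubst_cst[OF id_hom])
  ultimately show ?thesis unfolding theta_def hom_hsubst[OF evq_hom] ev1_def by simp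
qed

lemma evq_weight_mem: "(\<Prod>i=1..k. inverse (1 - q ^ i)) \<in> R"
proof (rule prod_mem)
  fix i assume "i \<in> {1..k}"
  then obtain j where "i = Suc j" by (cases i) auto
  thus "inverse (1 - q ^ i) \<in> R" using inv_mem by blast
qed

lemma fil_sum: "(\<And>i. i \<in> A \<Longrightarrow> f i \<in> fil n) \<Longrightarrow> sum f A \<in> fil n"
  by (induction A rule: infinite_finite_induct) (auto simp: fil_zero fil_add)

lemma evq_spn: "F \<in> spn n A \<Longrightarrow> evq F \<in> fil n"
proof -
  assume F: "F \<in> spn n A"
  have "(\<Prod>k\<in>#m. \<Prod>i=1..Suc k. inverse (1 - q ^ i)) \<in> R" for m
    by (induction m) (use evq_weight_mem in \<open>auto simp: one_mem intro!: mult_mem simp del: prod.cl_ivl_Suc\<close>)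
  hence "mcoeff F m * (\<Prod>k\<in>#m. \<Prod>i=1..Suc k. inverse (1 - q ^ i)) \<in> fil n" for m
    using fil_mult[of _ n _ 0] F by (simp add: spn_def)
  thus ?thesis unfolding evq_def hsubst_def by (intro fil_sum) auto
qed

text \<open>Modulo $1-t$ the eigenvector is $h_\lambda$, whose value is a product of the units $1/(1-q^i)$ of \<open>R\<close>.\<close>

lemma evq_evec_nonzero:
  assumes "is_partition l"
  shows "evq (evec l) \<noteq> 0"
proof -
  interpret e: comm_ring_hom evq by (rule evq_hom)
  have hv: "evq (hvar k) = (\<Prod>i=1..k. inverse (1 - q ^ i))" for k
    unfolding evq_def by (rule hsubst_hvar[OF id_hom]) simp
  have "1 - q ^ Suc k \<in> R \<and> 1 - q ^ Suc k \<noteq> 0" for k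
    using q_pow[of k] by (auto intro!: diff_mem one_mem power_mem q_mem simp del: power_Suc)
  hence *: "1 - q ^ i \<in> R \<and> 1 - q ^ i \<noteq> 0" if "i \<in> {1..k}" for i k
    using that by (cases i) (auto simp del: power_Suc)
  have "\<exists>u\<in>R. u * evq (hprod l) = 1"
  proof (induction l)
    case (Cons a l)
    then obtain u where u: "u \<in> R" "u * evq (hprod l) = 1" by blast
    define w where "w = (\<Prod>i=1..a. 1 - q ^ i)"
    have "w * evq (hvar a) = 1"
      unfolding w_def hv prod.distrib[symmetric]
    proof (rule prod.neutral, intro ballI)
      fix i assume "i \<in> {1..a}"
      thus "(1 - q ^ i) * inverse (1 - q ^ i) = 1" using * by (intro right_inverse) blast
    qed
    moreover have "(w * u) * evq (hprod (a # l)) = (w * evq (hvar a)) * (u * evq (hprod l))"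
      by (simp add: e.hom_mult mult_ac)
    ultimately have "(w * u) * evq (hprod (a # l)) = 1" using u(2) by simp
    moreover have "w * u \<in> R"
      unfolding w_def using * by (intro mult_mem prod_mem u(1)) blast
    ultimately show ?case by blast
  qed (use one_mem in auto)
  \<comment> \<open>Multiplying by the inverse of the leading value brings the sum into the form $1 + (1-t)x$.\<close>
  then obtain u where u: "u \<in> R" "u * evq (hprod l) = 1" by blast
  have "evq (evec l - hprod l) \<in> fil 1" by (rule evq_spn[OF evec_spn[OF assms]])
  then obtain x where x: "x \<in> R" "evq (evec l) - evq (hprod l) = (1 - t) * x"
    by (auto simp: fil_def e.hom_minus)
  have "evq (evec l) = evq (hprod l) + (1 - t) * x" using x(2) by (simp add: algebra_simps)
  hence "u * evq (evec l) = u * evq (hprod l) + (1 - t) * (u * x)"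
    by (simp only: distrib_left mult.left_commute)
  hence "u * evq (evec l) = 1 + (1 - t) * (u * x)" using u(2) by simp
  thus ?thesis using unit[OF mult_mem[OF u(1) x(1)]] by auto
qed

lemma theta_scaled: "theta a (cst c * F) = cst c * theta a F"
proof -
  interpret th: comm_ring_hom "theta a" by (rule theta_hom)
  show ?thesis by (simp add: th.hom_mult)
qed

text \<open>Start from the eigenvector for $(t,q)$ and the conjugate partition, which has the same eigenvalue. By the
  symmetry of the operator it yields an eigenvector for $(q,t)$, where the eigenspace is one-dimensional.
  The normalisation is possible by the nonvanishing above, and the eigenvalue equation in one variable
  gives the second coefficient.\<close>

lemma joint_eigenvector:
  assumes "is_partition l"
  shows "\<exists>H\<in>homog (sum_list l). ev1 H = 1 \<and> ev1d H = Bsum q t l \<and>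
     theta q H \<in> hspan (hmon ` {m. m \<unrhd>\<^sub>d l}) \<and> theta t H \<in> hspan (hmon ` {m. m \<unrhd>\<^sub>d conj_part l}) \<and>
     (\<exists>c. theta q H = cst c * evec l) \<and> (\<exists>c. c \<noteq> 0 \<and> theta t H = cst c * conj.evec (conj_part l))"
proof -
  let ?n = "sum_list l" and ?l' = "conj_part l" and ?d = "dval q t l"
  have l': "is_partition ?l'" "sum_list ?l' = ?n"
    using assms by (simp_all add: conj_part_partition sum_list_conj_part)
  have ev': "conj.evec ?l' \<in> homog ?n" unfolding homog_eq
    by (rule hspan_mono[OF conj.evec_hspan[OF l'(1)]]) (use l' in \<open>auto simp: dominates_def\<close>)
  obtain E where E: "E \<in> homog ?n" "theta t E = conj.evec ?l'" using theta_surj[OF ev' t_pow] by blast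
  have "theta t (D0 q t E) = Dq t q (theta t E)" using theta_D0[of t q E] by (simp add: D0_commute)
  also have "\<dots> = theta t (cst ?d * E)"
    using conj.evec_eigen[OF l'(1)] by (simp add: E(2) theta_scaled dval_conj[OF assms])
  finally have DE: "D0 q t E = cst ?d * E" by (rule theta_inj[OF t_pow])
  have "Dq q t (theta q E) = cst ?d * theta q E"
    using theta_D0[of q t E] by (simp add: DE theta_scaled)
  moreover have "theta q E \<in> hspan (hmon ` {m. is_partition m \<and> sum_list m = ?n})"
    using homog_theta[OF E(1), of q] by (simp add: homog_eq)
  ultimately have "theta q E = cst (mcoeff (theta q E) (hmon l)) * evec l" using eigen_unique assms by blast
  then obtain c where c: "theta q E = cst c * evec l" by blast
  interpret e: comm_ring_hom "ev1 :: 'a sym \<Rightarrow> 'a" by (rule ev1_hom)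
  interpret eq: comm_ring_hom evq by (rule evq_hom)
  have "c \<noteq> 0"
  proof
    assume "c = 0"
    hence "theta q E = theta q 0" using c theta_scaled[of q 0 E] by simp
    hence "E = 0" by (rule theta_inj[OF q_pow])
    hence "conj.evec ?l' = 0" using E(2) theta_scaled[of t 0 E] by simp
    thus False using conj.mcoeff_evec_self[OF l'(1)] by simp
  qed
  hence "ev1 E \<noteq> 0"
    using evq_theta[of E] evq_evec_nonzero[OF assms] by (auto simp: c eq.hom_mult)
  define x where "x = inverse (ev1 E)"
  define H where "H = cst x * E"
  have x: "x \<noteq> 0" "x * ev1 E = 1" using \<open>ev1 E \<noteq> 0\<close> by (auto simp: x_def)
  have H: "H \<in> homog ?n" unfolding H_def by (rule homog_cst[OF E(1)])
  have evH: "ev1 H = 1" using x by (simp add: H_def e.hom_mult)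
  have tq: "theta q H = cst (x * c) * evec l"
    by (simp add: H_def theta_scaled c cst.hom_mult mult.assoc)
  have tt: "theta t H = cst x * conj.evec ?l'" by (simp add: H_def theta_scaled E(2))
  have "theta q (D0 q t H) = theta q (cst ?d * H)"
    unfolding theta_D0 by (simp only: theta_scaled tq Dq_cst evec_eigen[OF assms]) (simp add: mult_ac)
  hence "D0 q t H = cst ?d * H" by (rule theta_inj[OF q_pow])
  hence "?d = 1 - (1 - q) * (1 - t) * ev1d H"
    using ev1_D0[of q t H] evH by (simp add: e.hom_mult)
  hence "(1 - q) * (1 - t) * ev1d H = (1 - q) * (1 - t) * Bsum q t l" by (auto simp: dval_Bsum)
  moreover have "(1 - q) * (1 - t) \<noteq> 0" using q_neq_1 t_neq_1 by simp
  ultimately have "ev1d H = Bsum q t l" by (metis mult_left_cancel)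
  moreover have "theta q H \<in> hspan (hmon ` {m. m \<unrhd>\<^sub>d l})"
    unfolding tq by (rule hspan_cst[OF evec_hspan[OF assms]])
  moreover have "theta t H \<in> hspan (hmon ` {m. m \<unrhd>\<^sub>d ?l'})"
    unfolding tt by (rule hspan_cst[OF conj.evec_hspan[OF l'(1)]])
  ultimately show ?thesis using H evH tq tt x(1) by blast
qed

text \<open>The modified Macdonald function, with the properties of the joint eigenvector that are used.\<close>

definition mac :: "nat list \<Rightarrow> 'a sym" where
  "mac l = (SOME H. H \<in> homog (sum_list l) \<and> ev1 H = 1 \<and> ev1d H = Bsum q t l \<and>
     theta q H \<in> hspan (hmon ` {m. m \<unrhd>\<^sub>d l}) \<and> theta t H \<in> hspan (hmon ` {m. m \<unrhd>\<^sub>d conj_part l}) \<and>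
     (\<exists>c. theta q H = cst c * evec l) \<and> (\<exists>c. c \<noteq> 0 \<and> theta t H = cst c * conj.evec (conj_part l)))"

lemma mac:
  assumes "is_partition l"
  shows "mac l \<in> homog (sum_list l)" "ev1 (mac l) = 1" "ev1d (mac l) = Bsum q t l"
    "theta q (mac l) \<in> hspan (hmon ` {m. m \<unrhd>\<^sub>d l})" "theta t (mac l) \<in> hspan (hmon ` {m. m \<unrhd>\<^sub>d conj_part l})"
    "\<exists>c. theta q (mac l) = cst c * evec l" "\<exists>c. c \<noteq> 0 \<and> theta t (mac l) = cst c * conj.evec (conj_part l)"
  using someI_ex[OF joint_eigenvector[OF assms, unfolded Bex_def]] unfolding mac_def by blast+

lemma mac_evec:
  assumes "is_partition l"
  shows "\<exists>c. c \<noteq> 0 \<and> evec l = cst c * theta q (mac l)"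
proof -
  interpret eq: comm_ring_hom evq by (rule evq_hom)
  obtain c where c: "theta q (mac l) = cst c * evec l" using mac(6)[OF assms] by blast
  have "c \<noteq> 0" using evq_theta[of "mac l"] mac(2)[OF assms] c by auto
  hence "evec l = cst (inverse c) * theta q (mac l)" by (simp add: c flip: mult.assoc cst.hom_mult)
  thus ?thesis using \<open>c \<noteq> 0\<close> by (intro exI[of _ "inverse c"]) simp
qed

lemma conj_mac_evec:
  assumes "is_partition l"
  shows "\<exists>c. conj.evec (conj_part l) = cst c * theta t (mac l)"
proof -
  obtain c where c: "c \<noteq> 0" "theta t (mac l) = cst c * conj.evec (conj_part l)" using mac(7)[OF assms] by blast
  hence "conj.evec (conj_part l) = cst (inverse c) * theta t (mac l)" by (simp flip: mult.assoc cst.hom_mult)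
  thus ?thesis by blast
qed

lemma mac_independent:
  assumes "(\<Sum>m | is_partition m \<and> sum_list m = n. cst (a m) * mac m) = 0" "is_partition l" "sum_list l = n"
  shows "a l = 0"
proof -
  let ?S = "{m. is_partition m \<and> sum_list m = n}"
  interpret th: comm_ring_hom "theta q" by (rule theta_hom)
  obtain c where c: "\<And>m. is_partition m \<Longrightarrow> theta q (mac m) = cst (c m) * evec m" using mac(6) by metis
  have "c m \<noteq> 0" if "is_partition m" for m
  proof
    interpret eq: comm_ring_hom evq by (rule evq_hom)
    assume "c m = 0"
    thus False using evq_theta[of "mac m"] mac(2)[OF that] c[OF that] by simp
  qed
  have "(\<Sum>m\<in>?S. cst (a m * c m) * evec m) = theta q (\<Sum>m\<in>?S. cst (a m) * mac m)"
    unfolding th.hom_sum by (intro sum.cong refl) (auto simp: theta_scaled c cst.hom_mult mult.assoc)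
  also have "\<dots> = 0" by (simp only: assms(1) th.hom_zero)
  finally have "a l * c l = 0" by (rule evec_independent[OF up_set_all]) (use assms in simp)
  thus ?thesis using \<open>\<And>m. is_partition m \<Longrightarrow> c m \<noteq> 0\<close>[OF assms(2)] by simp
qed

text \<open>By the first condition \<open>F\<close> is a combination of the functions of the partitions $m \unrhd l$, by the second
  one of those with $m' \unrhd l'$. As these functions are independent and conjugation reverses dominance,
  only $m = l$ remains.\<close>

lemma mac_unique:
  assumes "is_partition l" "theta q F \<in> hspan (hmon ` {m. m \<unrhd>\<^sub>d l})"
    "theta t F \<in> hspan (hmon ` {m. m \<unrhd>\<^sub>d conj_part l})"
  shows "\<exists>c. F = cst c * mac l"
proof -
  let ?n = "sum_list l"
  let ?S = "{m. is_partition m \<and> sum_list m = ?n}"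
  let ?A = "{m. m \<unrhd>\<^sub>d l}" and ?B = "{m. m \<unrhd>\<^sub>d conj_part l}"
  interpret tq: comm_ring_hom "theta q" by (rule theta_hom)
  interpret tt: comm_ring_hom "theta t" by (rule theta_hom)
  have fin: "finite ?S" by (rule finite_partitions)
  have A: "?A \<subseteq> ?S" by (auto simp: dominates_def)
  have B: "up_set ?n ?B" using up_set_dominates[of "conj_part l"] assms(1) by (simp add: sum_list_conj_part)
  obtain a where a: "theta q F = (\<Sum>m\<in>?A. cst (a m) * evec m)"
    using evec_span[OF up_set_dominates assms(2)] by blast
  obtain c where c: "\<And>m. is_partition m \<Longrightarrow> evec m = cst (c m) * theta q (mac m)" using mac_evec by metis
  have "theta q F = theta q (\<Sum>m\<in>?A. cst (a m * c m) * mac m)"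
    unfolding a tq.hom_sum
    by (intro sum.cong refl) (auto simp: theta_scaled c cst.hom_mult mult.assoc dominates_def)
  hence F1: "F = (\<Sum>m\<in>?A. cst (a m * c m) * mac m)" by (rule theta_inj[OF q_pow])
  obtain b where b: "theta t F = (\<Sum>m\<in>?B. cst (b m) * conj.evec m)"
    using conj.evec_span[OF B assms(3)] by blast
  obtain e where e: "\<And>m. is_partition m \<Longrightarrow> conj.evec (conj_part m) = cst (e m) * theta t (mac m)"
    using conj_mac_evec by metis
  let ?B' = "{m. is_partition m \<and> conj_part m \<unrhd>\<^sub>d conj_part l}"
  have bij: "bij_betw conj_part ?B' ?B"
    by (rule bij_betw_byWitness[of _ conj_part]) (auto simp: conj_conj_part conj_part_partition dominates_def)
  have "theta t F = (\<Sum>m\<in>?B'. cst (b (conj_part m)) * conj.evec (conj_part m))"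
    unfolding b by (rule sum.reindex_bij_betw[OF bij, symmetric])
  also have "\<dots> = theta t (\<Sum>m\<in>?B'. cst (b (conj_part m) * e m) * mac m)"
    unfolding tt.hom_sum
    by (intro sum.cong refl) (auto simp: theta_scaled e cst.hom_mult mult.assoc)
  finally have F2: "F = (\<Sum>m\<in>?B'. cst (b (conj_part m) * e m) * mac m)" by (rule theta_inj[OF t_pow])
  have B': "?B' \<subseteq> ?S" using assms(1) by (auto simp: dominates_def sum_list_conj_part)
  \<comment> \<open>The coefficients of the two expansions, extended by $0$ to all partitions of this size.\<close>
  define u where "u m = (if m \<in> ?A then a m * c m else 0)" for m
  define v where "v m = (if m \<in> ?B' then b (conj_part m) * e m else 0)" for m
  have Fu: "F = (\<Sum>m\<in>?S. cst (u m) * mac m)"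
    unfolding F1 by (rule sum.mono_neutral_cong_left[OF fin A]) (auto simp: u_def)
  have Fv: "F = (\<Sum>m\<in>?S. cst (v m) * mac m)"
    unfolding F2 by (rule sum.mono_neutral_cong_left[OF fin B']) (auto simp: v_def)
  have "(\<Sum>m\<in>?S. cst (u m - v m) * mac m) = 0"
    using Fu Fv by (simp add: cst.hom_minus left_diff_distrib sum_subtractf)
  hence uv: "u m = v m" if "m \<in> ?S" for m using mac_independent[of "\<lambda>m. u m - v m"] that by fastforce
  have "u m = 0" if "m \<in> ?S" "m \<noteq> l" for m
  proof (cases "m \<in> ?A \<and> m \<in> ?B'")
    case True
    hence "m = l" by (auto intro: dominates_conj_eq)
    thus ?thesis using that by simp
  next
    case False
    thus ?thesis using uv[OF that(1)] by (auto simp: u_def v_def)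
  qed
  hence "F = (\<Sum>m\<in>{l}. cst (u m) * mac m)"
    unfolding Fu by (intro sum.mono_neutral_right fin) (use assms(1) in auto)
  thus ?thesis by auto
qed

theorem modified_macdonald_unique:
  assumes "is_partition l"
  shows "is_modified_macdonald q t l G \<longleftrightarrow> G = iota (mac l)"
proof
  let ?n = "sum_list l"
  have hall: "hall f (schur (row_part ?n)) = xcoeff f (replicate_mset ?n 0)" for f :: "'a xps"
    by (simp add: schur_row_part hall_h_part row_part_partition xmonomial_row_part)
  {
    assume "G = iota (mac l)"
    have all: "iota (mac l) \<in> schur_span {n. is_partition n}"
      by (rule schur_spanI[OF up_set_all]) (use mac(1)[OF assms] in \<open>auto simp: homog_eq\<close>)
    have 1: "iota (theta q (mac l)) \<in> schur_span {n. n \<unrhd>\<^sub>d l}"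
      by (rule schur_spanI[OF up_set_dominates mac(4)[OF assms] order_refl])
    have 2: "iota (theta t (mac l)) \<in> schur_span {n. n \<unrhd>\<^sub>d conj_part l}"
      by (rule schur_spanI[OF up_set_dominates mac(5)[OF assms] order_refl])
    have 3: "hall (iota (mac l)) (schur (row_part ?n)) = 1"
      unfolding hall iota_coeffs(1)[OF mac(1)[OF assms]] by (simp add: mac(2)[OF assms])
    show "is_modified_macdonald q t l G"
      unfolding \<open>G = _\<close> is_modified_macdonald_def pleth_iota using all 1 2 3 by blast
  next
    assume mm: "is_modified_macdonald q t l G"
    then obtain F where F: "G = iota F" using schur_spanD unfolding is_modified_macdonald_def by blast
    have theta: "theta a F \<in> hspan (hmon ` {m. m \<unrhd>\<^sub>d k})" if "pleth_one_minus a G \<in> schur_span {n. n \<unrhd>\<^sub>d k}" for a k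
    proof -
      have *: "iota (theta a F) \<in> schur_span {n. n \<unrhd>\<^sub>d k}" using that unfolding F pleth_iota .
      obtain F' where "F' \<in> hspan (hmon ` {m. \<exists>j\<in>{n. n \<unrhd>\<^sub>d k}. m \<unrhd>\<^sub>d j})" "iota (theta a F) = iota F'"
        using schur_spanD[OF *] by blast
      moreover from this(2) have "theta a F = F'" by (rule iota_inj)
      moreover have "{m. \<exists>j\<in>{n. n \<unrhd>\<^sub>d k}. m \<unrhd>\<^sub>d j} \<subseteq> {m. m \<unrhd>\<^sub>d k}" by (auto dest: dominates_trans)
      ultimately show ?thesis by (blast intro: hspan_mono)
    qed
    obtain c where c: "F = cst c * mac l"
      using mac_unique[OF assms theta theta] mm unfolding is_modified_macdonald_def by blast
    have "F \<in> homog ?n" unfolding c by (rule homog_cst[OF mac(1)[OF assms]])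
    moreover have "hall G (schur (row_part ?n)) = 1" using mm by (simp add: is_modified_macdonald_def)
    ultimately have "ev1 F = 1" unfolding hall F by (simp add: iota_coeffs)
    moreover have "ev1 F = c"
    proof -
      interpret e: comm_ring_hom "ev1 :: 'a sym \<Rightarrow> 'a" by (rule ev1_hom)
      show ?thesis by (simp add: c e.hom_mult mac(2)[OF assms])
    qed
    ultimately show "G = iota (mac l)" using F c by simp
  }
qed

end

section \<open>Values of rational functions\<close>

lemma const_eval_hom: "comm_ring_hom (\<lambda>c :: rat poly. poly (map_poly of_rat c) (b :: 'a::field_char_0))"
proof -
  interpret mp: map_poly_comm_ring_hom "of_rat :: rat \<Rightarrow> 'a" ..
  show ?thesis by (rule hom_comp[OF mp.comm_ring_hom_axioms poly_hom.comm_ring_hom_axioms])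
qed

lemma poly2_hom: "comm_ring_hom (\<lambda>P. poly2 P a (b :: 'a::field_char_0))"
proof -
  interpret c: comm_ring_hom "\<lambda>c :: rat poly. poly (map_poly of_rat c) b" by (rule const_eval_hom)
  interpret mp: map_poly_comm_ring_hom "\<lambda>c :: rat poly. poly (map_poly of_rat c) b" ..
  show ?thesis unfolding poly2_def
    by (rule hom_comp[OF mp.comm_ring_hom_axioms poly_hom.comm_ring_hom_axioms])
qed

lemma poly2_pCons: "poly2 (pCons c P) a b = poly (map_poly of_rat c) b + a * poly2 P a (b :: 'a::field_char_0)"
proof -
  interpret c: comm_ring_hom "\<lambda>c :: rat poly. poly (map_poly of_rat c) b" by (rule const_eval_hom)
  interpret mp: map_poly_comm_ring_hom "\<lambda>c :: rat poly. poly (map_poly of_rat c) b" ..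
  have "map_poly (\<lambda>c :: rat poly. poly (map_poly of_rat c) b) (pCons c P) =
      pCons (poly (map_poly of_rat c) b) (map_poly (\<lambda>c. poly (map_poly of_rat c) b) P)"
    by (rule Polynomial.map_poly_pCons) simp
  thus ?thesis unfolding poly2_def by simp
qed

lemma poly2_0 [simp]: "poly2 0 a (b :: 'a::field_char_0) = 0"
  by (simp add: poly2_def)

context
  fixes a b :: "'a::field_char_0"
begin

interpretation p2: comm_ring_hom "\<lambda>P. poly2 P a b" by (rule poly2_hom)

text \<open>Evaluation is a ring homomorphism on numerators and denominators, so it respects the equality of
  fractions.\<close>

lemma has_value_unique:
  assumes "has_value F a b v" "has_value F a b v'"
  shows "v = v'"
proof -
  obtain P Q where 1: "F = Fract P Q" "poly2 Q a b \<noteq> 0" "v = poly2 P a b / poly2 Q a b"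
    using assms(1) unfolding has_value_def by blast
  obtain P' Q' where 2: "F = Fract P' Q'" "poly2 Q' a b \<noteq> 0" "v' = poly2 P' a b / poly2 Q' a b"
    using assms(2) unfolding has_value_def by blast
  note * = 1 2
  have "Q \<noteq> 0" "Q' \<noteq> 0" using * by auto
  hence "P * Q' = P' * Q" using * by (simp add: eq_fract)
  hence "poly2 P a b * poly2 Q' a b = poly2 P' a b * poly2 Q a b" by (simp flip: p2.hom_mult)
  thus ?thesis using * by (simp add: frac_eq_eq)
qed

lemma rat_at_eq: "has_value F a b v \<Longrightarrow> rat_at F a b = v"
  unfolding rat_at_def by (blast intro: has_value_unique)

lemma has_value_poly: "has_value (Fract P 1) a b (poly2 P a b)"
  unfolding has_value_def by (intro exI[of _ P] exI[of _ 1]) simp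

lemma has_value_0: "has_value 0 a b 0" using has_value_poly[of 0] by (simp add: Zero_fract_def)
lemma has_value_1: "has_value 1 a b 1" using has_value_poly[of 1] by (simp add: One_fract_def)

lemma has_value_var_z: "has_value var_z a b a"
  using has_value_poly[of "[:0, 1:]"] by (simp add: var_z_def poly2_pCons)

lemma has_value_var_w: "has_value var_w a b b"
  using has_value_poly[of "[:[:0, 1:]:]"] by (simp add: var_w_def poly2_pCons map_poly_pCons)

lemma has_value_add:
  assumes "has_value F a b u" "has_value G a b v"
  shows "has_value (F + G) a b (u + v)"
proof -
  obtain P Q P' Q' where *: "F = Fract P Q" "poly2 Q a b \<noteq> 0" "u = poly2 P a b / poly2 Q a b"
    "G = Fract P' Q'" "poly2 Q' a b \<noteq> 0" "v = poly2 P' a b / poly2 Q' a b"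
    using assms by (auto simp: has_value_def)
  have "Q \<noteq> 0" "Q' \<noteq> 0" using * by auto
  hence "F + G = Fract (P * Q' + P' * Q) (Q * Q')" by (simp add: * add_fract)
  thus ?thesis unfolding has_value_def
    by (rule exI[of _ "P * Q' + P' * Q", OF exI[of _ "Q * Q'", OF conjI]])
      (use * in \<open>simp add: p2.hom_mult p2.hom_add add_frac_eq\<close>)
qed

lemma has_value_mult:
  assumes "has_value F a b u" "has_value G a b v"
  shows "has_value (F * G) a b (u * v)"
proof -
  obtain P Q P' Q' where *: "F = Fract P Q" "poly2 Q a b \<noteq> 0" "u = poly2 P a b / poly2 Q a b"
    "G = Fract P' Q'" "poly2 Q' a b \<noteq> 0" "v = poly2 P' a b / poly2 Q' a b"
    using assms by (auto simp: has_value_def)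
  have "F * G = Fract (P * P') (Q * Q')" by (simp add: * mult_fract)
  thus ?thesis unfolding has_value_def
    by (rule exI[of _ "P * P'", OF exI[of _ "Q * Q'", OF conjI]])
      (use * in \<open>simp add: p2.hom_mult\<close>)
qed

lemma has_value_uminus:
  assumes "has_value F a b u"
  shows "has_value (- F) a b (- u)"
proof -
  have "has_value (-1) a b (-1)" using has_value_poly[of "-1"]
    by (simp add: p2.hom_uminus One_fract_def minus_fract)
  from has_value_mult[OF this assms] show ?thesis by simp
qed

lemma has_value_diff:
  assumes "has_value F a b u" "has_value G a b v"
  shows "has_value (F - G) a b (u - v)"
  using has_value_add[OF assms(1) has_value_uminus[OF assms(2)]] by simp

lemma has_value_inverse:
  assumes "has_value F a b u" "u \<noteq> 0"
  shows "has_value (inverse F) a b (inverse u)"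
proof -
  obtain P Q where *: "F = Fract P Q" "poly2 Q a b \<noteq> 0" "u = poly2 P a b / poly2 Q a b"
    using assms by (auto simp: has_value_def)
  show ?thesis unfolding has_value_def
    by (rule exI[of _ Q, OF exI[of _ P, OF conjI]]) (use * assms(2) in \<open>simp_all add: inverse_fract\<close>)
qed

lemma has_value_divide:
  assumes "has_value F a b u" "has_value G a b v" "v \<noteq> 0"
  shows "has_value (F / G) a b (u / v)"
  using has_value_mult[OF assms(1) has_value_inverse[OF assms(2,3)]] by (simp add: divide_inverse)

lemma has_value_power: "has_value F a b u \<Longrightarrow> has_value (F ^ n) a b (u ^ n)"
  by (induction n) (auto intro: has_value_1 has_value_mult)

lemma has_value_sum: "(\<And>i. i \<in> A \<Longrightarrow> has_value (F i) a b (f i)) \<Longrightarrow> has_value (sum F A) a b (sum f A)"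
  by (induction A rule: infinite_finite_induct) (auto intro: has_value_0 has_value_add)

lemma has_value_prod: "(\<And>i. i \<in> A \<Longrightarrow> has_value (F i) a b (f i)) \<Longrightarrow> has_value (prod F A) a b (prod f A)"
  by (induction A rule: infinite_finite_induct) (auto intro: has_value_1 has_value_mult)

lemma has_value_nonzero: "has_value F a b u \<Longrightarrow> u \<noteq> 0 \<Longrightarrow> F \<noteq> 0"
  using has_value_unique has_value_0 by blast

lemma has_value_Bsum:
  "has_value Q a b u \<Longrightarrow> has_value T a b v \<Longrightarrow> has_value (Bsum Q T l) a b (Bsum u v l)"
  unfolding Bsum_def case_prod_unfold by (intro has_value_sum has_value_mult has_value_power)

end

lemmas has_value_intros = has_value_0 has_value_1 has_value_var_z has_value_var_w has_value_add
  has_value_mult has_value_diff has_value_power has_value_sum has_value_prod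

lemma of_rat_ratfun: "(of_rat r :: ratfun) = Fract [:[:r:]:] 1"
proof -
  let ?e = "\<lambda>r :: rat. Fract [:[:r:]:] 1 :: ratfun"
  have "comm_ring_hom ?e"
    by unfold_locales (simp_all add: add_fract mult_fract Zero_fract_def One_fract_def one_pCons)
  then interpret e: comm_ring_hom ?e .
  obtain n d where nd: "quotient_of r = (n, d)" by fastforce
  hence d: "d \<noteq> 0" and r: "r = of_int n / of_int d" using quotient_of_denom_pos quotient_of_div by force+
  have "?e r * of_int d = ?e (r * of_int d)" by (simp only: e.hom_mult e.hom_of_int)
  also have "r * of_int d = of_int n" using d by (simp add: r)
  also have "?e (of_int n) = of_int n" by (rule e.hom_of_int)
  finally have "?e r = of_int n / of_int d" using d by (simp add: field_simps)
  thus ?thesis by (simp add: r of_rat_divide)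
qed

lemma poly2_self: "poly2 P var_z var_w = Fract P 1"
proof -
  have c: "poly (map_poly of_rat c) var_w = Fract [:c:] 1" for c :: "rat poly"
  proof (induction c)
    case 0
    show ?case by (simp add: Zero_fract_def)
  next
    case (pCons r c)
    have "poly (map_poly of_rat (pCons r c)) var_w = of_rat r + var_w * Fract [:c:] 1"
      by (simp add: Polynomial.map_poly_pCons pCons.IH)
    also have "\<dots> = Fract [:pCons r c:] 1" by (simp add: of_rat_ratfun var_w_def)
    finally show ?case .
  qed
  show ?thesis
  proof (induction P)
    case 0
    show ?case by (simp add: Zero_fract_def)
  next
    case (pCons d P)
    have "poly2 (pCons d P) var_z var_w = Fract [:d:] 1 + var_z * Fract P 1"
      by (simp only: poly2_pCons c pCons)
    thus ?case by (simp add: var_z_def mult_fract add_fract)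
  qed
qed

text \<open>Evaluating at the generic point is the identity. It is needed for the Adams operation $\psi_1$.\<close>

lemma has_value_self: "has_value F var_z var_w F"
proof -
  obtain P Q where F: "F = Fract P Q" "Q \<noteq> 0" by (cases F)
  have ne: "Fract Q 1 \<noteq> 0" using F by (simp add: Zero_fract_def eq_fract)
  have "Fract P Q = Fract P 1 / Fract Q 1" by simp
  thus ?thesis unfolding has_value_def using F ne by (auto simp: poly2_self)
qed

lemma rat_at_self: "rat_at F var_z var_w = F"
  by (rule rat_at_eq[OF has_value_self])

section \<open>The Macdonald functions over $\mathbb{Q}(q,t)$\<close>

lemma var_w1_power: "var_w1 ^ n = Fract (monom 1 n) 1"
  by (induction n) (simp_all add: var_w1_def One_fract_def mult_fract monom_Suc)

lemma var_w1_power_neq_1: "var_w1 ^ Suc n \<noteq> 1"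
proof
  assume "var_w1 ^ Suc n = 1"
  hence "monom (1 :: rat) (Suc n) = 1"
    unfolding var_w1_power One_fract_def by (simp add: eq_fract)
  hence "degree (monom (1 :: rat) (Suc n)) = degree (1 :: rat poly)" by (simp only:)
  thus False by (simp add: degree_monom_eq)
qed

text \<open>$(1-q)B_\lambda(q,1) = \sum_r (1 - q^r)$, the sum over the parts, determines the multiplicities of the
  parts. So the eigenvalues are distinct already to first order at $t = 1$.\<close>

lemma Bsum_var_w1_inj:
  assumes "is_partition l" "is_partition m" "(1 - var_w1) * Bsum var_w1 1 l = (1 - var_w1) * Bsum var_w1 1 m"
  shows "l = m"
proof -
  \<comment> \<open>The polynomial $\sum_r (1 - q^r)$, whose coefficients are the multiplicities.\<close>
  define f :: "nat list \<Rightarrow> rat poly" where "f l = (\<Sum>r\<leftarrow>l. 1 - monom 1 r)" for l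
  have "(1 - var_w1) * Bsum var_w1 1 l = Fract (f l) 1" for l
  proof (induction l)
    case (Cons a l)
    have "(1 - var_w1) * Bsum var_w1 1 (a # l) = (1 - var_w1) * (\<Sum>j<a. var_w1 ^ j) + (1 - var_w1) * Bsum var_w1 1 l"
      by (simp add: Bsum_Cons distrib_left)
    also have "(1 - var_w1) * (\<Sum>j<a. var_w1 ^ j) = 1 - var_w1 ^ a" by (rule one_diff_power_eq[symmetric])
    also have "1 - var_w1 ^ a = Fract (1 - monom 1 a) 1"
      by (simp add: var_w1_power One_fract_def)
    finally show ?case by (simp add: Cons f_def)
  qed (simp add: Bsum_def f_def Zero_fract_def)
  hence "f l = f m" using assms(3) by (simp add: eq_fract)
  moreover have "coeff (f l) (Suc k) = - of_nat (count (mset l) (Suc k))" for l k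
    by (induction l) (auto simp: f_def)
  ultimately have "count (mset l) (Suc k) = count (mset m) (Suc k)" for k by (metis neg_equal_iff_equal of_nat_eq_iff)
  moreover have "count (mset l) 0 = 0" "count (mset m) 0 = 0"
    using assms by (simp_all add: is_partition_def count_eq_zero_iff)
  ultimately have "mset l = mset m" by (intro multiset_eqI) (metis not0_implies_Suc)
  thus ?thesis using assms by (intro partition_eqI) (auto simp: hmon_def)
qed

text \<open>The functions of $(q,t)$ that are regular along $t = 1$: there \<open>q\<close> stays transcendental, which is why the
  value is taken at the variable of $\mathbb{Q}(w)$.\<close>

definition regular_ring :: "ratfun set" where
  "regular_ring = {F. regular_at F var_w1 1}"

lemma regular_ringI: "has_value F var_w1 1 v \<Longrightarrow> F \<in> regular_ring"
  by (auto simp: regular_ring_def regular_at_def)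

interpretation mac: macdonald regular_ring var_z var_w
proof
  show "1 \<in> regular_ring" by (rule regular_ringI[OF has_value_1])
  show "x - y \<in> regular_ring" "x * y \<in> regular_ring" if "x \<in> regular_ring" "y \<in> regular_ring" for x y
    using that by (auto simp: regular_ring_def regular_at_def intro: has_value_diff has_value_mult)
  show "1 - var_w \<in> regular_ring" by (rule regular_ringI[OF has_value_diff[OF has_value_1 has_value_var_w]])
  show "var_z \<in> regular_ring" by (rule regular_ringI[OF has_value_var_z])
  \<comment> \<open>The value at $(1,w)$ shows that \<open>t\<close> is not a root of unity.\<close>
  have w_pow: "var_w ^ Suc k \<noteq> 1" for k
  proof -
    have "has_value (var_w ^ Suc k - 1) 1 var_w1 (var_w1 ^ Suc k - 1)" by (intro has_value_intros)
    from has_value_nonzero[OF this] show ?thesis using var_w1_power_neq_1 by force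
  qed
  show "var_w ^ Suc k \<noteq> 1" for k by (rule w_pow)
  show w1: "var_w \<noteq> 1" using w_pow[of 0] by simp
  show "var_z ^ Suc k \<noteq> 1" and "inverse (1 - var_z ^ Suc k) \<in> regular_ring" for k
  proof -
    have v: "has_value (1 - var_z ^ Suc k) var_w1 1 (1 - var_w1 ^ Suc k)" by (intro has_value_intros)
    have ne: "1 - var_w1 ^ Suc k \<noteq> 0" using var_w1_power_neq_1[of k] by simp
    from has_value_nonzero[OF v ne] show "var_z ^ Suc k \<noteq> 1" by force
    show "inverse (1 - var_z ^ Suc k) \<in> regular_ring" by (rule regular_ringI[OF has_value_inverse[OF v ne]])
  qed
  show "1 + (1 - var_w) * x \<noteq> 0" if x: "x \<in> regular_ring" for x
  proof -
    obtain v where "has_value x var_w1 1 v" using x unfolding regular_ring_def regular_at_def by blast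
    hence "has_value (1 + (1 - var_w) * x) var_w1 1 (1 + (1 - 1) * v)" by (intro has_value_intros)
    from has_value_nonzero[OF this] show ?thesis by simp
  qed
  fix l m assume lm: "is_partition l" "is_partition m" "sum_list l = sum_list m" "l \<noteq> m"
  \<comment> \<open>The difference of the eigenvalues is $(1-t)U$ with \<open>U\<close> nonzero at $t = 1$.\<close>
  define U where "U = (1 - var_z) * Bsum var_z var_w m - (1 - var_z) * Bsum var_z var_w l"
  let ?u = "(1 - var_w1) * Bsum var_w1 1 m - (1 - var_w1) * Bsum var_w1 1 l"
  have U: "has_value U var_w1 1 ?u" unfolding U_def by (intro has_value_intros has_value_Bsum)
  have u: "?u \<noteq> 0" using Bsum_var_w1_inj lm by force
  have U0: "U \<noteq> 0" by (rule has_value_nonzero[OF U u])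
  have eq: "dval var_z var_w l - dval var_z var_w m = (1 - var_w) * U"
    by (simp add: dval_Bsum U_def algebra_simps)
  have "(1 - var_w) * U \<noteq> 0" using U0 w1 by simp
  hence "dval var_z var_w l \<noteq> dval var_z var_w m" using eq by force
  moreover have "(1 - var_w) / (dval var_z var_w l - dval var_z var_w m) = inverse U"
    unfolding eq using w1 U0 by (simp add: field_simps)
  moreover have "inverse U \<in> regular_ring" by (rule regular_ringI[OF has_value_inverse[OF U u]])
  ultimately show "dval var_z var_w l \<noteq> dval var_z var_w m \<and>
      (1 - var_w) / (dval var_z var_w l - dval var_z var_w m) \<in> regular_ring" by simp
qed

lemma macdonald_H_eq:
  assumes "is_partition l"
  shows "macdonald_H l = iota (mac.mac l)"
  unfolding macdonald_H_def mac.modified_macdonald_unique[OF assms] by simp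

lemma macdonald_H_sq_coeffs:
  assumes "is_partition l"
  shows "xcoeff (macdonald_H_sq l) (replicate_mset a 0) = (if a = sum_list l then 1 else 0)"
    and "xcoeff (macdonald_H_sq l) (replicate_mset a 0 + {#1#}) =
      (if Suc a = sum_list l then Bsum (var_z ^ 2) (var_w ^ 2) l else 0)"
proof -
  have z: "has_value var_z (var_z\<^sup>2) (var_w\<^sup>2 :: ratfun) (var_z\<^sup>2)" by (rule has_value_var_z)
  have w: "has_value var_w (var_z\<^sup>2) (var_w\<^sup>2 :: ratfun) (var_w\<^sup>2)" by (rule has_value_var_w)
  have sq: "xcoeff (macdonald_H_sq l) m = rat_at (xcoeff (iota (mac.mac l)) m) (var_z ^ 2) (var_w ^ 2)" for m
    by (simp add: macdonald_H_sq_def macdonald_H_eq[OF assms] xmap_def)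
  note co = iota_coeffs[OF mac.mac(1)[OF assms]] mac.mac(2,3)[OF assms]
  show "xcoeff (macdonald_H_sq l) (replicate_mset a 0) = (if a = sum_list l then 1 else 0)"
    unfolding sq co by (simp add: rat_at_eq[OF has_value_0] rat_at_eq[OF has_value_1])
  show "xcoeff (macdonald_H_sq l) (replicate_mset a 0 + {#1#}) =
      (if Suc a = sum_list l then Bsum (var_z ^ 2) (var_w ^ 2) l else 0)"
    unfolding sq co by (simp add: rat_at_eq[OF has_value_0] rat_at_eq[OF has_value_Bsum[OF z w]])
qed

section \<open>The plethystic logarithm\<close>

definition hook_sum :: "ratfun fps" where
  "hook_sum = Abs_fps (\<lambda>n. \<Sum>l | is_partition l \<and> sum_list l = n. hook_fun l)"

definition hook_B_sum :: "ratfun fps" where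
  "hook_B_sum = Abs_fps (\<lambda>n. \<Sum>l | is_partition l \<and> sum_list l = n.
     hook_fun l * Bsum (var_z ^ 2) (var_w ^ 2) l)"

lemma Omega_coeff:
  assumes "\<And>l. is_partition l \<Longrightarrow> xcoeff (macdonald_H_sq l) m = (if sum_list l = n then f l else 0)"
  shows "xcoeff Omega m = (\<Sum>l | is_partition l \<and> sum_list l = n. hook_fun l * f l)"
proof -
  have "xcoeff Omega m = (\<Sum>l | is_partition l \<and> xcoeff (macdonald_H_sq l) m \<noteq> 0.
      hook_fun l * xcoeff (macdonald_H_sq l) m)" by (simp add: Omega_def)
  also have "\<dots> = (\<Sum>l | is_partition l \<and> sum_list l = n. hook_fun l * f l)"
    by (rule sum.mono_neutral_cong_left[OF finite_partitions]) (auto simp: assms split: if_splits)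
  finally show ?thesis .
qed

lemma Omega_coeff_0: "xcoeff Omega (replicate_mset a 0) = fps_nth hook_sum a"
  using Omega_coeff[of "replicate_mset a 0" a "\<lambda>_. 1"] macdonald_H_sq_coeffs(1)[of _ a]
  by (auto simp: hook_sum_def eq_commute)

lemma Omega_coeff_1:
  "xcoeff Omega (replicate_mset a 0 + {#1#}) = fps_nth hook_B_sum (Suc a)"
  using Omega_coeff[of "replicate_mset a 0 + {#1#}" "Suc a" "\<lambda>l. Bsum (var_z ^ 2) (var_w ^ 2) l"]
    macdonald_H_sq_coeffs(2)[of _ a]
  by (auto simp: hook_B_sum_def eq_commute)

lemma hook_sum_0: "fps_nth hook_sum 0 = 1"
proof -
  have "{l. is_partition l \<and> sum_list l = 0} = {[]}"
    by (auto simp: is_partition_def) (metis list.set_intros(1) neq_Nil_conv)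
  thus ?thesis by (simp add: hook_sum_def hook_fun_def)
qed

text \<open>In a monomial of the form $d m'$ all exponents are divisible by \<open>d\<close>.\<close>

lemma adams_coeff_1:
  assumes "count m (i :: nat) = 1" "d \<ge> 1"
  shows "xcoeff (adams d F) m = (if d = 1 then xcoeff F m else 0)"
proof (cases "d = 1")
  case True
  have "{m'. repeat_mset 1 m' = m} = {m}" by auto
  thus ?thesis using True by (simp add: adams_def rat_at_self)
next
  case False
  have "repeat_mset d m' \<noteq> m" for m'
  proof
    assume "repeat_mset d m' = m"
    hence "d * count m' i = 1" using assms(1) by (metis count_repeat_mset)
    thus False using False by simp
  qed
  thus ?thesis using False by (simp add: adams_def)
qed

lemma fps_power_nth_1:
  fixes f :: "'a::comm_ring_1 fps"
  assumes "k \<ge> 1"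
  shows "fps_nth (f ^ k) 1 = of_nat k * fps_nth f 0 ^ (k - 1) * fps_nth f 1"
  using assms
proof (induction k rule: nat_induct_at_least)
  case (Suc k)
  have k: "k = Suc (k - 1)" using Suc.hyps by simp
  have "fps_nth (f ^ Suc k) 1 = fps_nth f 0 * fps_nth (f ^ k) 1 + fps_nth f 1 * fps_nth f 0 ^ k"
    by (simp add: fps_mult_nth fps_nth_power_0)
  also have "\<dots> = of_nat k * (fps_nth f 0 * fps_nth f 0 ^ (k - 1)) * fps_nth f 1 + fps_nth f 1 * fps_nth f 0 ^ k"
    by (simp only: Suc.IH mult_ac)
  also have "fps_nth f 0 * fps_nth f 0 ^ (k - 1) = fps_nth f 0 ^ k"
    by (subst (2) k) (simp only: power_Suc)
  finally show ?case by (simp add: algebra_simps)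
qed simp

text \<open>The logarithm is defined by sums that end at the degree of the monomial, and $1 - u$ has no constant term.\<close>

lemma truncated_geometric:
  fixes u v :: "'a::field fps"
  assumes "fps_nth u 0 = 1"
  shows "fps_nth ((\<Sum>j\<le>a. (1 - u) ^ j) * v) a = fps_nth (v * inverse u) a"
proof -
  have ne: "fps_nth u 0 \<noteq> 0" using assms by simp
  have "u * (\<Sum>j<Suc a. (1 - u) ^ j) = 1 - (1 - u) ^ Suc a"
    using one_diff_power_eq[of "1 - u" "Suc a"] by simp
  hence "inverse u * (u * (\<Sum>j\<le>a. (1 - u) ^ j)) = inverse u * (1 - (1 - u) ^ Suc a)"
    by (simp only: lessThan_Suc_atMost)
  hence "(\<Sum>j\<le>a. (1 - u) ^ j) = inverse u * (1 - (1 - u) ^ Suc a)"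
    by (simp only: inverse_mult_eq_1[OF ne] mult_1_left flip: mult.assoc)
  hence "(\<Sum>j\<le>a. (1 - u) ^ j) * v = inverse u * (1 - (1 - u) ^ Suc a) * v" by (simp only:)
  also have "\<dots> = v * inverse u - (1 - u) ^ Suc a * (v * inverse u)"
    by (simp only: right_diff_distrib left_diff_distrib mult_1_right mult_1_left mult_ac)
  finally have "(\<Sum>j\<le>a. (1 - u) ^ j) * v = v * inverse u - (1 - u) ^ Suc a * (v * inverse u)" .
  moreover have "fps_nth ((1 - u) ^ Suc a * (v * inverse u)) a = 0"
  proof -
    have "fps_nth ((1 - u) ^ Suc a) i = 0" if "i \<le> a" for i
      using startsby_zero_power_prefix[of "1 - u" "Suc a"] assms that by simp
    thus ?thesis by (simp add: fps_mult_nth del: power_Suc)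
  qed
  ultimately show ?thesis by simp
qed

text \<open>$\log(u + v x_1) = \log u + (v/u)x_1$ modulo $x_1^2$.\<close>

lemma xlog_coeff:
  assumes "xcoeff F {#} = (1 :: ratfun)"
  shows "xcoeff (xlog F) (replicate_mset a 0 + {#1#}) =
    fps_nth (fps_nth (twovar F) 1 * inverse (fps_nth (twovar F) 0)) a"
proof -
  interpret tv: comm_ring_hom "twovar :: ratfun xps \<Rightarrow> ratfun fps fps" by (rule twovar_hom)
  let ?u = "fps_nth (twovar F) 0" and ?v = "fps_nth (twovar F) 1"
  have summand: "(- 1) ^ (k - 1) / of_nat k * xcoeff ((F - 1) ^ k) (replicate_mset a 0 + {#1#}) =
      fps_nth ((1 - ?u) ^ (k - 1) * ?v) a" if "k \<ge> 1" for k
  proof -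
    have m: "replicate_mset a 0 + {#1#} = replicate_mset a 0 + replicate_mset 1 (1::nat)" by simp
    have "xcoeff ((F - 1) ^ k) (replicate_mset a 0 + {#1#}) = fps_nth (fps_nth ((twovar F - 1) ^ k) 1) a"
      unfolding m twovar_nth[symmetric] by (simp add: tv.hom_power tv.hom_minus)
    also have "fps_nth ((twovar F - 1) ^ k) 1 = of_nat k * ((?u - 1) ^ (k - 1) * ?v)"
      by (subst fps_power_nth_1[OF that]) (simp add: mult.assoc)
    also have "(?u - 1) ^ (k - 1) = (- 1) ^ (k - 1) * (1 - ?u) ^ (k - 1)"
      by (simp flip: power_mult_distrib)
    also have "(of_nat k * ((- 1) ^ (k - 1) * (1 - ?u) ^ (k - 1) * ?v) :: ratfun fps) =
        fps_const (of_nat k * (- 1) ^ (k - 1)) * ((1 - ?u) ^ (k - 1) * ?v)"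
      by (simp add: fps_of_nat[symmetric] mult_ac flip: fps_const_mult fps_const_power fps_const_neg)
    finally have "xcoeff ((F - 1) ^ k) (replicate_mset a 0 + {#1#}) =
        of_nat k * (- 1) ^ (k - 1) * fps_nth ((1 - ?u) ^ (k - 1) * ?v) a"
      by (simp only: fps_mult_left_const_nth)
    moreover have "(- 1) ^ (k - 1) * (- 1) ^ (k - 1) = (1 :: ratfun)" by (simp flip: power_mult_distrib)
    ultimately show ?thesis using that by (simp add: field_simps)
  qed
  have u: "fps_nth ?u 0 = 1" using assms by (simp add: twovar_nth)
  have "xcoeff (xlog F) (replicate_mset a 0 + {#1#}) = (\<Sum>k=1..Suc a. fps_nth ((1 - ?u) ^ (k - 1) * ?v) a)"
    using summand by (simp add: xlog_def)
  also have "\<dots> = (\<Sum>j\<le>a. fps_nth ((1 - ?u) ^ j * ?v) a)"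
    by (rule sum.reindex_bij_witness[of _ Suc "\<lambda>k. k - 1"]) auto
  also have "\<dots> = fps_nth ((\<Sum>j\<le>a. (1 - ?u) ^ j) * ?v) a"
    by (simp add: sum_distrib_right fps_sum_nth)
  finally show ?thesis by (simp only: truncated_geometric[OF u])
qed

lemma xLog_coeff_1:
  assumes "count m (i :: nat) = 1"
  shows "xcoeff (xLog F) m = xcoeff (xlog F) m"
proof -
  have "size m \<ge> 1" using assms count_le_size[of m i] by simp
  hence "(\<Sum>d = 1..size m. of_int (moebius d) / of_nat d * xcoeff (adams d (xlog F)) m) =
      (\<Sum>d\<in>{1}. of_int (moebius d) / of_nat d * xcoeff (adams d (xlog F)) m)"
    by (intro sum.mono_neutral_right) (auto simp: adams_coeff_1[OF assms])
  thus ?thesis by (simp add: xLog_def moebius_def adams_coeff_1[OF assms])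
qed

lemma xmonomial_near_row: "n \<ge> 2 \<Longrightarrow> xmonomial (near_row n) = replicate_mset (n - 1) 0 + {#1#}"
proof -
  assume "n \<ge> 2"
  moreover have "{..<length [n - 1, 1]} = {0, 1}" by auto
  ultimately show ?thesis by (simp add: xmonomial_def near_row_def)
qed

lemma near_row_partition: "n \<ge> 1 \<Longrightarrow> is_partition (near_row n)"
  by (auto simp: is_partition_def near_row_def)

text \<open>For $n = 1$ the partition is $(1)$ and the coefficient is the one at $x_0$; the formula still holds
  because $B_{(1)} = 1$.\<close>

theorem HH_part_near_row:
  assumes "n \<ge> 1"
  shows "HH_part (near_row n) = (var_z ^ 2 - 1) * (1 - var_w ^ 2) *
     fps_nth (hook_B_sum * inverse hook_sum) n"
proof -
  have const: "xcoeff Omega {#} = 1" using Omega_coeff_0[of 0] by (simp add: hook_sum_0)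
  have u: "fps_nth (twovar Omega) 0 = hook_sum"
    by (rule fps_ext) (simp add: twovar_nth Omega_coeff_0)
  have B0: "fps_nth hook_B_sum 0 = 0"
  proof -
    have "{l. is_partition l \<and> sum_list l = 0} = {[]}"
      by (auto simp: is_partition_def) (metis list.set_intros(1) neq_Nil_conv)
    thus ?thesis by (simp add: hook_B_sum_def Bsum_def)
  qed
  have v: "fps_X * fps_nth (twovar Omega) 1 = hook_B_sum"
  proof (rule fps_ext)
    fix n show "fps_nth (fps_X * fps_nth (twovar Omega) 1) n = fps_nth hook_B_sum n"
      using Omega_coeff_1[of "n - 1"] B0 by (cases n) (simp_all add: twovar_nth)
  qed
  have nth: "fps_nth (fps_nth (twovar Omega) 1 * inverse hook_sum) a = fps_nth (hook_B_sum * inverse hook_sum) (Suc a)" for a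
    unfolding v[symmetric] by (simp only: mult.assoc) simp
  have "xcoeff (xLog Omega) (xmonomial (near_row n)) = fps_nth (hook_B_sum * inverse hook_sum) n"
  proof (cases "n = 1")
    case False
    hence n2: "n \<ge> 2" using assms by simp
    have "count (replicate_mset (n - 1) 0 + {#1#}) (1::nat) = 1" by simp
    hence "xcoeff (xLog Omega) (xmonomial (near_row n)) = xcoeff (xlog Omega) (replicate_mset (n - 1) 0 + {#1#})"
      unfolding xmonomial_near_row[OF n2] by (rule xLog_coeff_1)
    also have "\<dots> = fps_nth (hook_B_sum * inverse hook_sum) (Suc (n - 1))"
      by (simp only: xlog_coeff[OF const] u nth)
    finally show ?thesis using assms by simp
  next
    case True
    have m: "xmonomial (near_row 1) = {#0#}" by (simp add: xmonomial_def near_row_def lessThan_Suc)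
    have "count {#0#} (0::nat) = 1" by simp
    hence "xcoeff (xLog Omega) {#0#} = xcoeff (xlog Omega) {#0#}" by (rule xLog_coeff_1)
    also have "\<dots> = xcoeff Omega {#0#}"
      by (simp add: xlog_def minus_xps.rep_eq one_xps.rep_eq)
    also have "\<dots> = fps_nth hook_sum 1" using Omega_coeff_0[of 1] by simp
    also have "\<dots> = fps_nth hook_B_sum 1"
    proof -
      have "Bsum q t l = 1" if "is_partition l" "sum_list l = 1" for l and q t :: ratfun
      proof -
        have "l = [1]" using that card_cells[of l]
          by (cases l rule: list.exhaust; cases "tl l") (auto simp: is_partition_def add_is_1)
        thus ?thesis using Bsum_Cons[of q t 1 "[]"] by (simp add: Bsum_def[of _ _ "[]"])
      qed
      thus ?thesis by (simp add: hook_sum_def hook_B_sum_def)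
    qed
    also have "\<dots> = fps_nth (hook_B_sum * inverse hook_sum) 1"
      by (simp add: fps_mult_nth B0 hook_sum_0)
    finally show ?thesis using True m by simp
  qed
  thus ?thesis using hall_h_part[OF near_row_partition[OF assms], of "xLog Omega"]
    by (simp add: HH_part_def)
qed

section \<open>Values of power series and infinite products\<close>

definition fps_has_value :: "ratfun fps \<Rightarrow> 'a::field_char_0 \<Rightarrow> 'a \<Rightarrow> 'a fps \<Rightarrow> bool" where
  "fps_has_value F a b G \<longleftrightarrow> (\<forall>n. has_value (fps_nth F n) a b (fps_nth G n))"

lemma fps_has_valueD: "fps_has_value F a b G \<Longrightarrow> has_value (fps_nth F n) a b (fps_nth G n)"
  by (simp add: fps_has_value_def)

lemma fps_has_value_mult:
  "fps_has_value F a b G \<Longrightarrow> fps_has_value F' a b G' \<Longrightarrow> fps_has_value (F * F') a b (G * G')"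
  unfolding fps_has_value_def fps_mult_nth by (auto intro!: has_value_sum has_value_mult)

lemma fps_has_value_diff:
  "fps_has_value F a b G \<Longrightarrow> fps_has_value F' a b G' \<Longrightarrow> fps_has_value (F - F') a b (G - G')"
  unfolding fps_has_value_def by (auto intro!: has_value_diff)

lemma fps_has_value_const: "has_value c a b v \<Longrightarrow> fps_has_value (fps_const c) a b (fps_const v)"
  unfolding fps_has_value_def by (auto intro: has_value_0)

lemma fps_has_value_1: "fps_has_value 1 a b 1"
  using fps_has_value_const[OF has_value_1] by simp

lemma fps_has_value_X_power: "fps_has_value (fps_X ^ k) a b (fps_X ^ k)"
  unfolding fps_has_value_def by (auto simp: fps_X_power_nth intro: has_value_0 has_value_1)

lemma fps_has_value_power: "fps_has_value F a b G \<Longrightarrow> fps_has_value (F ^ n) a b (G ^ n)"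
  by (induction n) (auto intro: fps_has_value_1 fps_has_value_mult)

lemma fps_has_value_prod:
  "(\<And>i. i \<in> A \<Longrightarrow> fps_has_value (F i) a b (G i)) \<Longrightarrow> fps_has_value (\<Prod>i\<in>A. F i) a b (\<Prod>i\<in>A. G i)"
  by (induction A rule: infinite_finite_induct) (auto intro: fps_has_value_1 fps_has_value_mult)

lemma fps_inverse_rec:
  fixes f :: "'a::field fps"
  assumes "fps_nth f 0 \<noteq> 0" "n > 0"
  shows "fps_nth (inverse f) n = - inverse (fps_nth f 0) * (\<Sum>i=1..n. fps_nth f i * fps_nth (inverse f) (n - i))"
proof -
  have "0 = fps_nth (f * inverse f) n"
    using inverse_mult_eq_1'[OF assms(1)] assms(2) by simp
  also have "\<dots> = fps_nth f 0 * fps_nth (inverse f) n + (\<Sum>i=1..n. fps_nth f i * fps_nth (inverse f) (n - i))"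
    by (simp add: fps_mult_nth sum.atLeast_Suc_atMost)
  finally have "fps_nth f 0 * fps_nth (inverse f) n = - (\<Sum>i=1..n. fps_nth f i * fps_nth (inverse f) (n - i))"
    by (simp add: eq_neg_iff_add_eq_0)
  hence "inverse (fps_nth f 0) * (fps_nth f 0 * fps_nth (inverse f) n) =
      inverse (fps_nth f 0) * - (\<Sum>i=1..n. fps_nth f i * fps_nth (inverse f) (n - i))" by (simp only:)
  thus ?thesis using assms(1) by (simp flip: mult.assoc)
qed

lemma fps_has_value_inverse:
  assumes "fps_has_value F a b G" "fps_nth G 0 \<noteq> 0"
  shows "fps_has_value (inverse F) a b (inverse G)"
  unfolding fps_has_value_def
proof
  have F0: "fps_nth F 0 \<noteq> 0" by (rule has_value_nonzero[OF fps_has_valueD[OF assms(1)] assms(2)])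
  have inv: "has_value (inverse (fps_nth F 0)) a b (inverse (fps_nth G 0))"
    by (rule has_value_inverse[OF fps_has_valueD[OF assms(1)] assms(2)])
  fix n show "has_value (fps_nth (inverse F) n) a b (fps_nth (inverse G) n)"
  proof (induction n rule: less_induct)
    case (less n)
    show ?case
    proof (cases "n = 0")
      case True
      thus ?thesis using inv by simp
    next
      case False
      hence n: "n > 0" by simp
      show ?thesis unfolding fps_inverse_rec[OF F0 n] fps_inverse_rec[OF assms(2) n]
        using less.IH fps_has_valueD[OF assms(1)]
        by (intro has_value_mult has_value_uminus has_value_sum inv) auto
    qed
  qed
qed

text \<open>Congruence modulo $T^{n+1}$. It replaces infinite products and sums over all partitions by finite ones.\<close>

definition eq_upto :: "nat \<Rightarrow> 'a fps \<Rightarrow> 'a::zero fps \<Rightarrow> bool" where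
  "eq_upto n f g \<longleftrightarrow> (\<forall>i\<le>n. fps_nth f i = fps_nth g i)"

lemma eq_upto_refl [simp]: "eq_upto n f f" by (simp add: eq_upto_def)

lemma eq_upto_sym: "eq_upto n f g \<Longrightarrow> eq_upto n g f" by (simp add: eq_upto_def)

lemma eq_upto_trans [trans]: "eq_upto n f g \<Longrightarrow> eq_upto n g h \<Longrightarrow> eq_upto n f h" by (simp add: eq_upto_def)

lemma eq_upto_mult:
  "eq_upto n f f' \<Longrightarrow> eq_upto n g g' \<Longrightarrow> eq_upto n (f * g) (f' * g' :: 'a::comm_ring_1 fps)"
  unfolding eq_upto_def fps_mult_nth by (auto intro!: sum.cong)

lemma eq_upto_cancel:
  fixes f g h :: "'a::field fps"
  assumes "eq_upto n (f * h) (g * h)" "fps_nth h 0 \<noteq> 0"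
  shows "eq_upto n f g"
proof -
  have "eq_upto n (f * h * inverse h) (g * h * inverse h)" by (rule eq_upto_mult[OF assms(1) eq_upto_refl])
  thus ?thesis by (simp add: mult.assoc inverse_mult_eq_1'[OF assms(2)])
qed

text \<open>The later factors are $1$ modulo $T^{n+1}$, so the partial products are eventually constant in each
  coefficient.\<close>

lemma fps_prodinf_nth:
  fixes f :: "nat \<Rightarrow> 'a::field fps"
  assumes "\<And>i. eq_upto i (f i) 1" "n \<le> N"
  shows "fps_nth (prodinf f) n = fps_nth (\<Prod>i<N. f i) n"
proof -
  define p where "p = Abs_fps (\<lambda>n. fps_nth (\<Prod>i<n. f i) n)"
  have stable: "fps_nth (\<Prod>i<N. f i) n = fps_nth p n" if "n \<le> N" for n N
    using that
  proof (induction N rule: dec_induct)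
    case (step m)
    have "eq_upto n (f m) 1" using assms(1)[of m] step.hyps by (auto simp: eq_upto_def)
    hence "eq_upto n ((\<Prod>i<m. f i) * f m) ((\<Prod>i<m. f i) * 1)" by (rule eq_upto_mult[OF eq_upto_refl])
    hence "fps_nth (\<Prod>i<Suc m. f i) n = fps_nth (\<Prod>i<m. f i) n" by (auto simp: eq_upto_def)
    thus ?case using step.IH by simp
  qed (simp add: p_def)
  have "(\<lambda>n. \<Prod>i\<le>n. f i) \<longlonglongrightarrow> p"
  proof (rule tendsto_fpsI)
    fix n
    have "fps_nth (\<Prod>i\<le>m. f i) n = fps_nth p n" if "m \<ge> n" for m
      using stable[of n "Suc m"] that by (simp only: lessThan_Suc_atMost)
    thus "\<forall>\<^sub>F m in sequentially. fps_nth (\<Prod>i\<le>m. f i) n = fps_nth p n"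
      by (auto simp: eventually_sequentially)
  qed
  moreover have "p \<noteq> 0"
  proof
    assume "p = 0"
    moreover have "fps_nth p 0 = 1" by (simp add: p_def)
    ultimately show False by simp
  qed
  ultimately have "f has_prod p" by (simp add: has_prod_def raw_has_prod_def)
  hence "(prodinf f) = p" using has_prod_unique by metis
  thus ?thesis using stable[OF assms(2)] by simp
qed

lemma eq_upto_one_minus: "eq_upto k (1 - fps_const c * fps_X ^ Suc k) (1 :: 'a::comm_ring_1 fps)"
  by (auto simp: eq_upto_def fps_X_power_nth simp del: power_Suc)

lemma eq_upto_inverse_1:
  fixes f :: "'a::field fps"
  assumes "eq_upto n f 1"
  shows "eq_upto n (inverse f) 1"
proof -
  have "fps_nth f 0 = 1" using assms by (simp add: eq_upto_def)
  hence ne: "fps_nth f 0 \<noteq> 0" by simp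
  have "eq_upto n (inverse f * f) (inverse f * 1)" by (rule eq_upto_mult[OF eq_upto_refl assms])
  thus ?thesis by (auto simp: inverse_mult_eq_1[OF ne] intro: eq_upto_sym)
qed

definition hilb_factor :: "'a::field \<Rightarrow> 'a \<Rightarrow> nat \<Rightarrow> 'a fps" where
  "hilb_factor z w i = (1 - fps_const (z * w) * fps_X ^ Suc i) ^ 2 *
     inverse ((1 - fps_const (z ^ 2) * fps_X ^ Suc i) * (1 - fps_const (w ^ 2) * fps_X ^ Suc i))"

lemma HH_hilb_eq:
  assumes "n \<le> N"
  shows "HH_hilb n = fps_nth (\<Prod>i<N. hilb_factor var_z var_w i) n"
proof -
  have "(1 - fps_const (var_z * var_w) * fps_X ^ Suc i) ^ 2 /
     ((1 - fps_const (var_z ^ 2) * fps_X ^ Suc i) * (1 - fps_const (var_w ^ 2) * fps_X ^ Suc i)) =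
     hilb_factor var_z var_w i" for i
    unfolding hilb_factor_def by (rule fps_divide_unit) simp
  hence "HH_hilb n = fps_nth (prodinf (hilb_factor var_z var_w)) n"
    by (simp only: HH_hilb_def HH_genfun_def)
  also have "\<dots> = fps_nth (\<Prod>i<N. hilb_factor var_z var_w i) n"
  proof (rule fps_prodinf_nth[OF _ assms])
    fix i
    have "eq_upto i ((1 - fps_const (var_z * var_w) * fps_X ^ Suc i) * (1 - fps_const (var_z * var_w) * fps_X ^ Suc i) *
        inverse ((1 - fps_const (var_z ^ 2) * fps_X ^ Suc i) * (1 - fps_const (var_w ^ 2) * fps_X ^ Suc i)))
        (1 * 1 * 1)"
      by (intro eq_upto_mult eq_upto_one_minus eq_upto_inverse_1)
        (use eq_upto_mult[OF eq_upto_one_minus eq_upto_one_minus] in \<open>simp del: power_Suc\<close>)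
    thus "eq_upto i (hilb_factor var_z var_w i) 1"
      unfolding hilb_factor_def power2_eq_square[of "1 - fps_const (var_z * var_w) * fps_X ^ Suc i"]
      by (simp only: mult_1_left)
  qed
  finally show ?thesis .
qed

lemma hilb_factor_value:
  fixes a b :: "'a::field_char_0"
  shows "fps_has_value (hilb_factor var_z var_w i) a b (hilb_factor a b i)"
proof -
  have fac: "fps_has_value (1 - fps_const c * fps_X ^ Suc i) a b (1 - fps_const v * fps_X ^ Suc i)"
    if "has_value c a b v" for c v
    by (intro fps_has_value_diff fps_has_value_1 fps_has_value_mult fps_has_value_const fps_has_value_X_power that)
  show ?thesis unfolding hilb_factor_def
    by (intro fps_has_value_mult[OF fps_has_value_power fps_has_value_inverse] fps_has_value_mult fac
        has_value_mult has_value_power has_value_var_z has_value_var_w) simp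
qed

lemma HH_hilb_value:
  assumes "n \<le> N"
  shows "has_value (HH_hilb n) a b (fps_nth (\<Prod>i<N. hilb_factor a (b :: 'a::field_char_0) i) n)"
  unfolding HH_hilb_eq[OF assms]
  by (rule fps_has_valueD) (intro fps_has_value_prod hilb_factor_value)

section \<open>Generating functions of partitions\<close>

definition parts_le :: "nat \<Rightarrow> nat \<Rightarrow> nat list set" where
  "parts_le N n = {l. is_partition l \<and> sum_list l = n \<and> (\<forall>r\<in>set l. r \<le> N)}"

lemma finite_parts_le: "finite (parts_le N n)"
  by (rule finite_subset[OF _ finite_partitions[of n]]) (auto simp: parts_le_def)

lemma parts_le_all: "n \<le> N \<Longrightarrow> parts_le N n = {l. is_partition l \<and> sum_list l = n}"
proof -
  assume "n \<le> N"
  moreover have "r \<le> sum_list l" if "r \<in> set l" for r and l :: "nat list"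
    using that by (intro member_le_sum_list) auto
  ultimately show ?thesis by (fastforce simp: parts_le_def)
qed

text \<open>A weight that depends on the multiplicities of the parts $1, \ldots, N$ through a product makes the sum
  over partitions a product of the series \<open>mult_gf\<close>, one for each size of the parts.\<close>

definition pgf :: "nat \<Rightarrow> (nat \<Rightarrow> nat \<Rightarrow> 'a::comm_ring_1) \<Rightarrow> 'a fps" where
  "pgf N \<phi> = Abs_fps (\<lambda>n. \<Sum>l\<in>parts_le N n. \<Prod>k=1..N. \<phi> k (count_list l k))"

definition mult_gf :: "nat \<Rightarrow> (nat \<Rightarrow> 'a::comm_ring_1) \<Rightarrow> 'a fps" where
  "mult_gf k f = Abs_fps (\<lambda>n. if k dvd n then f (n div k) else 0)"

lemma parts_le_0: "parts_le 0 n = (if n = 0 then {[]} else {})"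
proof -
  have "l = []" if "is_partition l" "\<forall>r\<in>set l. r \<le> 0" for l
    using that by (cases l) (auto simp: is_partition_def)
  hence "parts_le 0 n = {l. l = [] \<and> n = 0}" by (auto simp: parts_le_def is_partition_def[of "[]"])
  thus ?thesis by auto
qed

lemma pgf_0: "pgf 0 \<phi> = 1"
  by (rule fps_ext) (simp add: pgf_def parts_le_0)

lemma count_list_eq_0_above: "\<forall>r\<in>set l. r \<le> N \<Longrightarrow> count_list l (Suc N) = 0"
  by (induction l) auto

lemma partition_split_largest:
  assumes "is_partition l" "\<forall>r\<in>set l. r \<le> Suc N"
  shows "replicate (count_list l (Suc N)) (Suc N) @ filter (\<lambda>r. r \<le> N) l = l"
  using assms
proof (induction l)
  case (Cons a l)
  show ?case
  proof (cases "a = Suc N")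
    case True
    thus ?thesis using Cons by (simp add: is_partition_def)
  next
    case False
    hence "\<forall>r\<in>set (a # l). r \<le> N" using Cons.prems by (auto simp: is_partition_def)
    hence "filter (\<lambda>r. r \<le> N) (a # l) = a # l" "count_list (a # l) (Suc N) = 0"
      by (simp_all only: filter_id_conv count_list_eq_0_above)
    thus ?thesis by simp
  qed
qed simp

lemma pgf_Suc: "pgf (Suc N) \<phi> = pgf N \<phi> * mult_gf (Suc N) (\<phi> (Suc N))"
proof (rule fps_ext)
  fix n
  let ?I = "{m. m * Suc N \<le> n}"
  let ?w = "\<lambda>N l. \<Prod>k=1..N. \<phi> k (count_list l k)"
  have finI: "finite ?I" by (rule finite_subset[of _ "{..n}"]) auto
  have "fps_nth (pgf (Suc N) \<phi>) n = (\<Sum>l\<in>parts_le (Suc N) n. ?w (Suc N) l)" by (simp add: pgf_def)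
  also have "\<dots> = (\<Sum>(m, l)\<in>Sigma ?I (\<lambda>m. parts_le N (n - m * Suc N)). ?w N l * \<phi> (Suc N) m)"
  proof (rule sum.reindex_bij_witness[where
        i = "\<lambda>(m, l). replicate m (Suc N) @ l" and j = "\<lambda>l. (count_list l (Suc N), filter (\<lambda>r. r \<le> N) l)"])
    fix l assume "l \<in> parts_le (Suc N) n"
    hence l: "is_partition l" "sum_list l = n" "\<forall>r\<in>set l. r \<le> Suc N" by (auto simp: parts_le_def)
    let ?c = "count_list l (Suc N)" and ?f = "filter (\<lambda>r. r \<le> N) l"
    have split: "replicate ?c (Suc N) @ ?f = l" by (rule partition_split_largest[OF l(1,3)])
    show "(case (?c, ?f) of (m, l) \<Rightarrow> replicate m (Suc N) @ l) = l" using split by simp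
    have "sum_list l = ?c * Suc N + sum_list ?f"
      using arg_cong[OF split, of sum_list] by (simp add: sum_list_replicate)
    moreover have "is_partition ?f" using l(1) by (auto simp: is_partition_def sorted_wrt_filter)
    ultimately show "(?c, ?f) \<in> Sigma ?I (\<lambda>m. parts_le N (n - m * Suc N))"
      using l(2) by (auto simp: parts_le_def)
    have "count_list ?f k = count_list l k" if "k \<le> N" for k
      using that by (induction l) auto
    hence "?w N ?f = ?w N l" by (intro prod.cong) auto
    thus "(case (?c, ?f) of (m, l) \<Rightarrow> ?w N l * \<phi> (Suc N) m) = ?w (Suc N) l"
      by (simp add: mult.commute)
  next
    fix p assume "p \<in> Sigma ?I (\<lambda>m. parts_le N (n - m * Suc N))"
    then obtain m l where p: "p = (m, l)" "m * Suc N \<le> n" "is_partition l" "sum_list l = n - m * Suc N"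
      "\<forall>r\<in>set l. r \<le> N" by (auto simp: parts_le_def)
    have "count_list (replicate m (Suc N)) (Suc N) = m" by (induction m) auto
    moreover have "filter (\<lambda>r. r \<le> N) l = l" using p(5) by (simp add: filter_id_conv)
    ultimately show "(\<lambda>l. (count_list l (Suc N), filter (\<lambda>r. r \<le> N) l)) (case p of (m, l) \<Rightarrow> replicate m (Suc N) @ l) = p"
      using count_list_eq_0_above[OF p(5)] by (simp add: p(1))
    have "is_partition (replicate m (Suc N) @ l)"
    proof -
      have "sorted_wrt (\<ge>) (replicate m (Suc N))" by (induction m) auto
      thus ?thesis using p(3,5) by (auto simp: is_partition_def sorted_wrt_append)
    qed
    thus "(case p of (m, l) \<Rightarrow> replicate m (Suc N) @ l) \<in> parts_le (Suc N) n"
      using p by (auto simp: parts_le_def sum_list_replicate)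
  qed
  also have "\<dots> = (\<Sum>m\<in>?I. fps_nth (pgf N \<phi>) (n - m * Suc N) * \<phi> (Suc N) m)"
    by (subst sum.Sigma[symmetric]) (auto simp: finI finite_parts_le pgf_def sum_distrib_right simp del: mult_Suc_right)
  also have "\<dots> = (\<Sum>i | i \<le> n \<and> Suc N dvd i. fps_nth (pgf N \<phi>) (n - i) * \<phi> (Suc N) (i div Suc N))"
    by (rule sum.reindex_bij_witness[where i = "\<lambda>i. i div Suc N" and j = "\<lambda>m. m * Suc N"])
      (auto simp del: mult_Suc_right)
  also have "\<dots> = (\<Sum>i\<in>{0..n}. fps_nth (pgf N \<phi>) (n - i) * fps_nth (mult_gf (Suc N) (\<phi> (Suc N))) i)"
    by (rule sum.mono_neutral_cong_left) (auto simp: mult_gf_def)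
  also have "\<dots> = (\<Sum>i=0..n. fps_nth (pgf N \<phi>) i * fps_nth (mult_gf (Suc N) (\<phi> (Suc N))) (n - i))"
    by (rule sum.reindex_bij_witness[where i = "\<lambda>i. n - i" and j = "\<lambda>i. n - i"]) auto
  finally show "fps_nth (pgf (Suc N) \<phi>) n = fps_nth (pgf N \<phi> * mult_gf (Suc N) (\<phi> (Suc N))) n"
    by (simp add: fps_mult_nth)
qed

lemma pgf_eq_prod: "pgf N \<phi> = (\<Prod>i<N. mult_gf (Suc i) (\<phi> (Suc i)))"
  by (induction N) (simp_all add: pgf_0 pgf_Suc)

text \<open>Linear recurrences for the weight \<open>f\<close> become multiplication by $1 - cT^k$.\<close>

lemma mult_gf_mult:
  fixes f :: "nat \<Rightarrow> 'a::comm_ring_1"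
  assumes "k > 0"
  shows "mult_gf k f * (1 - fps_const c * fps_X ^ k) =
    mult_gf k (\<lambda>m. case m of 0 \<Rightarrow> f 0 | Suc m' \<Rightarrow> f (Suc m') - c * f m')"
proof (rule fps_ext)
  fix n
  let ?g = "\<lambda>m. case m of 0 \<Rightarrow> f 0 | Suc m' \<Rightarrow> f (Suc m') - c * f m'"
  have "fps_nth (mult_gf k f * (1 - fps_const c * fps_X ^ k)) n =
      fps_nth (mult_gf k f) n - c * (if n < k then 0 else fps_nth (mult_gf k f) (n - k))"
    by (simp add: right_diff_distrib mult.left_commute fps_X_power_mult_right_nth)
  also have "\<dots> = fps_nth (mult_gf k ?g) n"
  proof (cases "k dvd n")
    case True
    then obtain j where n: "n = k * j" by (auto elim: dvdE)
    show ?thesis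
    proof (cases j)
      case (Suc i)
      hence "n - k = k * i" "\<not> n < k" using n by simp_all
      thus ?thesis using assms n Suc by (simp add: mult_gf_def)
    qed (use n assms in \<open>simp add: mult_gf_def\<close>)
  next
    case False
    hence "\<not> k dvd n - k" if "\<not> n < k" using that by (metis dvd_add_triv_right_iff le_add_diff_inverse2 not_less)
    thus ?thesis using False by (simp add: mult_gf_def)
  qed
  finally show "fps_nth (mult_gf k f * (1 - fps_const c * fps_X ^ k)) n = fps_nth (mult_gf k ?g) n" .
qed

lemma mult_gf_geometric:
  assumes "k > 0"
  shows "mult_gf k (\<lambda>m. c ^ m) * (1 - fps_const c * fps_X ^ k) = (1 :: 'a::comm_ring_1 fps)"
  unfolding mult_gf_mult[OF assms] using assms
  by (intro fps_ext) (auto simp: mult_gf_def split: nat.split elim!: dvdE)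

section \<open>Hook functions at the two points\<close>

definition cell_weight :: "'a::field \<Rightarrow> 'a \<Rightarrow> nat \<Rightarrow> nat \<Rightarrow> 'a" where
  "cell_weight z w a l = (z ^ (2 * a + 1) - w ^ (2 * l + 1)) ^ 2 /
     ((z ^ (2 * a + 2) - w ^ (2 * l)) * (z ^ (2 * a) - w ^ (2 * l + 2)))"

lemma hook_fun_eq: "hook_fun l = (\<Prod>s\<in>cells l. cell_weight var_z var_w (arm l s) (leg l s))"
  by (simp add: hook_fun_def cell_weight_def)

lemma cell_weight_value:
  fixes x y :: "'b::field_char_0"
  assumes "x ^ (2 * a + 2) \<noteq> y ^ (2 * l)" "x ^ (2 * a) \<noteq> y ^ (2 * l + 2)"
  shows "has_value (cell_weight var_z var_w a l) x y (cell_weight x y a l)"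
  unfolding cell_weight_def
  by (intro has_value_divide has_value_power has_value_diff has_value_mult has_value_var_z has_value_var_w)
    (use assms in auto)

lemma hook_fun_value:
  fixes x y :: "'b::field_char_0"
  assumes "\<And>a l. x ^ (2 * a + 2) \<noteq> y ^ (2 * l)" "\<And>a l. x ^ (2 * a) \<noteq> y ^ (2 * l + 2)"
  shows "has_value (hook_fun l) x y (\<Prod>s\<in>cells l. cell_weight x y (arm l s) (leg l s))"
  unfolding hook_fun_eq by (intro has_value_prod cell_weight_value assms)

lemma var_w1_neq_0: "var_w1 \<noteq> 0"
  by (simp add: var_w1_def Zero_fract_def eq_fract)

text \<open>For a positive arm the numerator $w^{4l+2}$ and the denominator $w^{2l}w^{2l+2}$ cancel; for arm $0$ the
  factor $z^{2a} = 1$ survives in the denominator.\<close>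

lemma cell_weight_0:
  fixes w :: "'a::field"
  assumes "w \<noteq> 0"
  shows "cell_weight 0 w a l = (if a = 0 then inverse (1 - inverse (w ^ 2) ^ Suc l) else 1)"
proof -
  have w: "w ^ (2 * l) * w ^ (2 * l + 2) = (w ^ (2 * l + 1)) ^ 2"
    by (simp add: power2_eq_square flip: power_add)
  have wl: "w ^ (2 * l) \<noteq> 0" using assms by simp
  have u: "inverse (w ^ 2) ^ Suc l = inverse (w ^ (2 * l + 2))"
    by (simp add: power_inverse power_mult[symmetric] flip: power_Suc power_add)
  show ?thesis
  proof (cases "a = 0")
    case True
    have "cell_weight 0 w 0 l = (w ^ (2 * l) * w ^ (2 * l + 2)) / ((- (w ^ (2 * l))) * (1 - w ^ (2 * l + 2)))"
      unfolding cell_weight_def w by simp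
    also have "\<dots> = - (w ^ (2 * l + 2) / (1 - w ^ (2 * l + 2)))"
      using wl by simp
    also have "\<dots> = inverse (1 - inverse (w ^ (2 * l + 2)))"
    proof -
      define v where "v = w ^ (2 * l + 2)"
      have "v \<noteq> 0" using assms by (simp add: v_def)
      hence "1 - inverse v = (v - 1) / v" by (simp add: field_simps)
      hence "inverse (1 - inverse v) = v / (v - 1)" by simp
      also have "\<dots> = - (v / (1 - v))" by (metis minus_diff_eq minus_divide_right)
      finally show ?thesis by (simp add: v_def)
    qed
    finally show ?thesis using True u by simp
  next
    case False
    have "cell_weight 0 w a l = (w ^ (2 * l) * w ^ (2 * l + 2)) / ((- (w ^ (2 * l))) * (- (w ^ (2 * l + 2))))"
    proof -
      have "(0 :: 'a) ^ (2 * a) = 0" "(0 :: 'a) ^ (2 * a + 1) = 0" "(0 :: 'a) ^ (2 * a + 2) = 0"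
        using False by simp_all
      thus ?thesis unfolding cell_weight_def w by (simp only: diff_0 power2_minus)
    qed
    also have "\<dots> = 1" using assms by simp
    finally show ?thesis using False by simp
  qed
qed

lemma conj_part_nth': "is_partition l \<Longrightarrow> (i, j) \<in> cells l \<Longrightarrow> conj_part l ! j = length (filter (\<lambda>r. j < r) l)"
  using cells_conj_part[of l j i] by (intro conj_part_nth) (auto simp: cells_def)

text \<open>A new largest part \<open>r\<close> adds one cell of arm $0$, the last one of the new first row. Below it, in the same
  column, lie exactly the last cells of the other rows of length \<open>r\<close>.\<close>

lemma hook_0_rec:
  assumes "is_partition (r # l)"
  shows "(\<Prod>s\<in>cells (r # l). if arm (r # l) s = 0 then f (leg (r # l) s) else 1) =
    f (count_list l r) * (\<Prod>s\<in>cells l. if arm l s = 0 then f (leg l s) else (1 :: 'b::comm_monoid_mult))"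
proof -
  let ?g = "\<lambda>s. if arm (r # l) s = 0 then f (leg (r # l) s) else 1"
  have l: "is_partition l" and r: "r > 0" and le: "\<And>x. x \<in> set l \<Longrightarrow> x \<le> r"
    using assms by (auto simp: is_partition_def)
  have "prod ?g (cells (r # l)) = prod ?g (Pair 0 ` {..<r}) * prod ?g (map_prod Suc id ` cells l)"
    unfolding cells_Cons by (rule prod.union_disjoint) auto
  also have "prod ?g (map_prod Suc id ` cells l) = (\<Prod>s\<in>cells l. ?g (map_prod Suc id s))"
    by (subst prod.reindex) (auto intro!: inj_onI)
  also have "\<dots> = (\<Prod>s\<in>cells l. if arm l s = 0 then f (leg l s) else 1)"
  proof (rule prod.cong[OF refl])
    fix s assume s: "s \<in> cells l"
    obtain i j where ij: "s = (i, j)" by fastforce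
    have cell: "(Suc i, j) \<in> cells (r # l)" using s ij by (simp add: cells_def)
    have "j < r" using s le[of "l ! i"] by (fastforce simp: ij cells_def)
    have "leg (r # l) (Suc i, j) = leg l (i, j)"
      unfolding leg_def using conj_part_nth'[OF assms cell] conj_part_nth'[OF l s[unfolded ij]] \<open>j < r\<close> by simp
    thus "?g (map_prod Suc id s) = (if arm l s = 0 then f (leg l s) else 1)"
      by (simp add: ij arm_def)
  qed
  also have "prod ?g (Pair 0 ` {..<r}) = (\<Prod>j<r. ?g (0, j))"
    by (subst prod.reindex) (auto intro!: inj_onI)
  also have "\<dots> = (\<Prod>j\<in>{r - 1}. ?g (0, j))"
    by (rule prod.mono_neutral_right) (use r in \<open>auto simp: arm_def\<close>)
  also have "\<dots> = f (leg (r # l) (0, r - 1))" by (simp add: arm_def)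
  also have "leg (r # l) (0, r - 1) = count_list l r"
  proof -
    have "(0, r - 1) \<in> cells (r # l)" using r by (simp add: cells_def)
    hence "leg (r # l) (0, r - 1) = length (filter (\<lambda>x. r - 1 < x) l)"
      unfolding leg_def using conj_part_nth'[OF assms, of 0 "r - 1"] r by simp
    also have "filter (\<lambda>x. r - 1 < x) l = filter (\<lambda>x. r = x) l"
      using le r by (intro filter_cong refl) force
    also have "length \<dots> = count_list l r" by (induction l) auto
    finally show ?thesis .
  qed
  finally show ?thesis .
qed

lemma hook_0_eq:
  assumes "is_partition l" "\<forall>r\<in>set l. r \<le> N"
  shows "(\<Prod>s\<in>cells l. if arm l s = 0 then f (leg l s) else 1) =
    (\<Prod>k=1..N. \<Prod>j<count_list l k. f j :: 'b::comm_monoid_mult)"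
  using assms
proof (induction l)
  case (Cons r l)
  have l: "is_partition l" and r: "r \<in> {1..N}" using Cons.prems by (auto simp: is_partition_def)
  let ?p = "\<lambda>l k. \<Prod>j<count_list l k. f j"
  have "(\<Prod>k=1..N. ?p (r # l) k) = ?p (r # l) r * (\<Prod>k\<in>{1..N} - {r}. ?p (r # l) k)"
    by (rule prod.remove) (use r in auto)
  also have "?p (r # l) r = f (count_list l r) * ?p l r" by (simp add: mult.commute)
  also have "(\<Prod>k\<in>{1..N} - {r}. ?p (r # l) k) = (\<Prod>k\<in>{1..N} - {r}. ?p l k)"
    by (intro prod.cong refl) auto
  also have "f (count_list l r) * ?p l r * (\<Prod>k\<in>{1..N} - {r}. ?p l k) = f (count_list l r) * (\<Prod>k=1..N. ?p l k)"
    using prod.remove[of "{1..N}" r "?p l"] r by (simp add: mult.assoc)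
  finally show ?case unfolding hook_0_rec[OF Cons.prems(1)] using Cons.IH[OF l] Cons.prems(2) by simp
qed simp

text \<open>All differences equal $1 - w^{2a+2l+2}$ up to powers of \<open>w\<close>, which cancel.\<close>

lemma cell_weight_inverse:
  fixes w :: "'a::field"
  assumes "w \<noteq> 0" "\<And>n. w ^ Suc n \<noteq> 1"
  shows "cell_weight (inverse w) w a l = 1"
proof -
  define W where "W = w ^ (2 * a + 2 * l + 2)"
  have W: "W \<noteq> 1" using assms(2)[of "2 * a + 2 * l + 1"] by (simp add: W_def)
  have pa: "inverse w ^ k = 1 / w ^ k" for k by (simp add: power_one_over inverse_eq_divide)
  have 1: "inverse w ^ (2 * a + 1) - w ^ (2 * l + 1) = (1 - W) / w ^ (2 * a + 1)"
    using assms(1) by (simp only: pa W_def) (simp add: field_simps flip: power_add power_Suc)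
  have 2: "inverse w ^ (2 * a + 2) - w ^ (2 * l) = (1 - W) / w ^ (2 * a + 2)"
    using assms(1) by (simp only: pa W_def) (simp add: field_simps flip: power_add power_Suc)
  have 3: "inverse w ^ (2 * a) - w ^ (2 * l + 2) = (1 - W) / w ^ (2 * a)"
    using assms(1) by (simp only: pa W_def) (simp add: field_simps flip: power_add power_Suc)
  have 4: "w ^ (2 * a + 2) * w ^ (2 * a) = (w ^ (2 * a + 1)) ^ 2"
    by (simp add: power2_eq_square flip: power_add)
  have "(1 - W) ^ 2 \<noteq> 0" "(w ^ (2 * a + 1)) ^ 2 \<noteq> 0" using W assms(1) by simp_all
  thus ?thesis unfolding cell_weight_def 1 2 3
    by (simp only: power_divide times_divide_times_eq 4 power2_eq_square[of "1 - W", symmetric]) simp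
qed

section \<open>Values of the ratio of partition sums\<close>

definition part_sum :: "(nat list \<Rightarrow> 'a::comm_monoid_add) \<Rightarrow> 'a fps" where
  "part_sum f = Abs_fps (\<lambda>n. \<Sum>l | is_partition l \<and> sum_list l = n. f l)"

lemma part_sum_0: "fps_nth (part_sum f) 0 = f []"
proof -
  have "{l. is_partition l \<and> sum_list l = 0} = {[]}"
    by (auto simp: is_partition_def) (metis list.set_intros(1) neq_Nil_conv)
  thus ?thesis by (simp add: part_sum_def)
qed

lemma part_sum_cong: "(\<And>l. is_partition l \<Longrightarrow> f l = g l) \<Longrightarrow> part_sum f = part_sum g"
  by (rule fps_ext) (auto simp: part_sum_def intro!: sum.cong)

lemma part_sum_diff: "part_sum (\<lambda>l. f l - g l) = part_sum f - part_sum (g :: _ \<Rightarrow> 'a::comm_ring_1)"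
  by (rule fps_ext) (simp add: part_sum_def sum_subtractf)

lemma part_sum_const: "part_sum (\<lambda>l. c * f l) = fps_const c * part_sum (f :: _ \<Rightarrow> 'a::comm_ring_1)"
  by (rule fps_ext) (simp add: part_sum_def sum_distrib_left)

lemma eq_upto_part_sum:
  assumes "\<And>l. is_partition l \<Longrightarrow> \<forall>r\<in>set l. r \<le> N \<Longrightarrow> f l = (\<Prod>k=1..N. \<phi> k (count_list l k))"
  shows "eq_upto N (part_sum f) (pgf N \<phi>)"
  unfolding eq_upto_def
proof (intro allI impI)
  fix i assume "i \<le> N"
  hence "fps_nth (part_sum f) i = (\<Sum>l\<in>parts_le N i. f l)" by (simp add: part_sum_def parts_le_all)
  also have "\<dots> = fps_nth (pgf N \<phi>) i"
    unfolding pgf_def fps_nth_Abs_fps by (intro sum.cong refl assms) (auto simp: parts_le_def)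
  finally show "fps_nth (part_sum f) i = fps_nth (pgf N \<phi>) i" .
qed

lemma HH_part_value:
  fixes a b :: "'b::field_char_0"
  assumes "\<And>l. has_value (hook_fun l) a b (h l)" "h [] = 1" "n \<ge> 1"
  shows "has_value (HH_part (near_row n)) a b
    (fps_nth (part_sum (\<lambda>l. (a\<^sup>2 - 1) * (1 - b\<^sup>2) * (h l * Bsum (a\<^sup>2) (b\<^sup>2) l)) * inverse (part_sum h)) n)"
proof -
  have 0: "fps_has_value hook_sum a b (part_sum h)"
    unfolding fps_has_value_def hook_sum_def part_sum_def by (auto intro!: has_value_sum assms)
  have 1: "fps_has_value hook_B_sum a b (part_sum (\<lambda>l. h l * Bsum (a\<^sup>2) (b\<^sup>2) l))"
    unfolding fps_has_value_def hook_B_sum_def part_sum_def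
    by (auto intro!: has_value_sum has_value_mult assms has_value_Bsum has_value_power has_value_var_z has_value_var_w)
  have ne: "fps_nth (part_sum h) 0 \<noteq> 0" by (simp add: part_sum_0 assms(2))
  have "has_value (HH_part (near_row n)) a b ((a\<^sup>2 - 1) * (1 - b\<^sup>2) *
      fps_nth (part_sum (\<lambda>l. h l * Bsum (a\<^sup>2) (b\<^sup>2) l) * inverse (part_sum h)) n)"
    unfolding HH_part_near_row[OF assms(3)]
    by (intro has_value_mult has_value_diff has_value_power has_value_var_z has_value_var_w has_value_1
        fps_has_valueD fps_has_value_mult 1 fps_has_value_inverse[OF 0 ne])
  thus ?thesis by (simp add: part_sum_const mult.assoc)
qed

text \<open>The prefactors turn the numerator into $G - K$, so the quotient is $G/K - 1$. The subtracted $1$ only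
  changes the constant term; \<open>H\<close> is a common denominator.\<close>

lemma near_row_ratio:
  fixes F K P H :: "'a::field fps"
  assumes "F = G - K" "fps_nth K 0 = 1" "eq_upto n (G * H) (P * K * H)" "fps_nth H 0 \<noteq> 0" "n \<ge> 1"
  shows "fps_nth (F * inverse K) n = fps_nth P n"
proof -
  have K: "fps_nth K 0 \<noteq> 0" using assms by simp
  have "eq_upto n (G * inverse K) P"
  proof (rule eq_upto_cancel)
    have "G * inverse K * (K * H) = (inverse K * K) * (G * H)" by (simp only: mult_ac)
    also have "\<dots> = G * H" by (simp only: inverse_mult_eq_1[OF K] mult_1_left)
    finally show "eq_upto n (G * inverse K * (K * H)) (P * (K * H))"
      using assms(3) by (simp only: mult.assoc)
    show "fps_nth (K * H) 0 \<noteq> 0" using assms by simp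
  qed
  moreover have "F * inverse K = G * inverse K - 1"
    by (simp add: assms(1) left_diff_distrib inverse_mult_eq_1'[OF K])
  ultimately show ?thesis using assms(5) by (auto simp: eq_upto_def)
qed

text \<open>The factor $1 - cT^{i+1}$ of the infinite products.\<close>

abbreviation efac :: "'a::comm_ring_1 \<Rightarrow> nat \<Rightarrow> 'a fps" where
  "efac c i \<equiv> 1 - fps_const c * fps_X ^ Suc i"

definition eprod :: "nat \<Rightarrow> 'a::comm_ring_1 \<Rightarrow> 'a fps" where
  "eprod n c = (\<Prod>i<n. efac c i)"

lemma eprod_0: "fps_nth (eprod n c) 0 = 1"
  by (induction n) (simp_all add: eprod_def)

lemma hilb_prod:
  fixes z w :: "'a::field"
  shows "(\<Prod>i<n. hilb_factor z w i) * (eprod n (z\<^sup>2) * eprod n (w\<^sup>2)) = eprod n (z * w) ^ 2"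
proof -
  have *: "hilb_factor z w i * (efac (z\<^sup>2) i * efac (w\<^sup>2) i) = efac (z * w) i ^ 2" for i
  proof -
    have "inverse (efac (z\<^sup>2) i * efac (w\<^sup>2) i) * (efac (z\<^sup>2) i * efac (w\<^sup>2) i) = 1"
      by (rule inverse_mult_eq_1) simp
    thus ?thesis unfolding hilb_factor_def mult.assoc[of "efac (z * w) i ^ 2"] by (simp only: mult_1_right)
  qed
  have "(\<Prod>i<n. hilb_factor z w i) * (eprod n (z\<^sup>2) * eprod n (w\<^sup>2)) =
      (\<Prod>i<n. hilb_factor z w i * (efac (z\<^sup>2) i * efac (w\<^sup>2) i))"
    by (simp only: eprod_def prod.distrib)
  thus ?thesis by (simp only: * eprod_def prod_power_distrib)
qed

section \<open>The partition sums at $z = 0$\<close>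

lemma sum_count_list:
  "\<forall>r\<in>set l. 1 \<le> r \<and> r \<le> N \<Longrightarrow> (\<Sum>k=1..N. count_list l k) = length (l :: nat list)"
proof (induction l)
  case (Cons a l)
  have "(\<Sum>k=1..N. count_list (a # l) k) = (\<Sum>k=1..N. count_list l k + (if k = a then 1 else 0))"
    by (intro sum.cong) auto
  also have "\<dots> = (\<Sum>k=1..N. count_list l k) + 1"
    using Cons.prems by (simp add: sum.distrib sum.delta)
  finally show ?case using Cons by simp
qed simp

text \<open>For $q = 0$ only the cells of the first column count.\<close>

lemma Bsum_0: "is_partition l \<Longrightarrow> (1 - t) * Bsum 0 t l = 1 - t ^ length l"
proof (induction l)
  case (Cons a l)
  have a: "a > 0" and l: "is_partition l" using Cons.prems by (auto simp: is_partition_def)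
  then obtain b where "a = Suc b" by (cases a) auto
  hence "(\<Sum>j<a. (0 :: 'a) ^ j) = 1" by (simp only: sum.lessThan_Suc_shift) simp
  hence "Bsum 0 t (a # l) = 1 + t * Bsum 0 t l" by (simp add: Bsum_Cons)
  hence "(1 - t) * Bsum 0 t (a # l) = (1 - t) + t * ((1 - t) * Bsum 0 t l)"
    by (simp add: algebra_simps)
  thus ?case by (simp only: Cons.IH[OF l]) (simp add: algebra_simps)
qed (simp add: Bsum_def)

text \<open>With $p_m = 1/(u;u)_m$ and $x = w^2 = 1/u$ the relation $x^m p_m - x\cdot x^{m-1}p_{m-1} = p_m$ holds,
  because $x^m u^m = 1$. This is $F(xy)(1 - xy) = F(y)$ for $F(y) = \sum_m p_m y^m$, and taking the product
  over $y = T^k$ compares the two partition sums.\<close>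

lemma zero_identity:
  fixes w :: "'a::field"
  assumes w: "w \<noteq> 0" "\<And>n. w ^ Suc n \<noteq> 1" and n: "n \<ge> 1"
  defines "h \<equiv> \<lambda>l. \<Prod>s\<in>cells l. if arm l s = 0 then inverse (1 - inverse (w\<^sup>2) ^ Suc (leg l s)) else 1"
  shows "fps_nth (part_sum (\<lambda>l. (0\<^sup>2 - 1) * (1 - w\<^sup>2) * (h l * Bsum (0\<^sup>2) (w\<^sup>2) l)) * inverse (part_sum h)) n =
    fps_nth (\<Prod>i<n. hilb_factor 0 w i) n"
proof -
  define u where "u = inverse (w\<^sup>2)"
  define p where "p m = (\<Prod>j<m. inverse (1 - u ^ Suc j))" for m
  let ?x = "w\<^sup>2"
  have xu: "?x ^ m * u ^ m = 1" for m
    using w(1) by (simp add: u_def flip: power_mult_distrib)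
  have une: "1 - u ^ Suc j \<noteq> 0" for j
  proof
    assume "1 - u ^ Suc j = 0"
    hence "?x ^ Suc j = 1" using xu[of "Suc j"] by simp
    hence "w ^ (2 * Suc j) = 1" by (simp only: power_mult)
    moreover have "2 * Suc j = Suc (2 * j + 1)" by simp
    ultimately show False using w(2) by metis
  qed
  have h_eq: "h l = (\<Prod>k=1..n. p (count_list l k))" if "is_partition l" "\<forall>r\<in>set l. r \<le> n" for l
    unfolding h_def p_def u_def[symmetric] by (rule hook_0_eq[OF that])
  define Kx where "Kx = part_sum (\<lambda>l. ?x ^ length l * h l)"
  have K: "eq_upto n (part_sum h) (pgf n (\<lambda>k m. p m))" by (rule eq_upto_part_sum) (rule h_eq)
  have Kx: "eq_upto n Kx (pgf n (\<lambda>k m. ?x ^ m * p m))" unfolding Kx_def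
  proof (rule eq_upto_part_sum)
    fix l assume l: "is_partition l" "\<forall>r\<in>set l. r \<le> n"
    have "r \<noteq> 0" if "r \<in> set l" for r using that l(1) by (metis is_partition_def)
    hence "\<forall>r\<in>set l. 1 \<le> r \<and> r \<le> n" using l(2) by (auto simp: Suc_le_eq)
    hence "?x ^ length l = (\<Prod>k=1..n. ?x ^ count_list l k)"
      by (simp only: power_sum sum_count_list[symmetric])
    thus "?x ^ length l * h l = (\<Prod>k=1..n. ?x ^ count_list l k * p (count_list l k))"
      by (simp only: h_eq[OF l] prod.distrib)
  qed
  have step: "mult_gf (Suc i) (\<lambda>m. ?x ^ m * p m) * efac ?x i = mult_gf (Suc i) p" for i
  proof -
    have "?x ^ Suc m * p (Suc m) - ?x * (?x ^ m * p m) = p (Suc m)" for m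
    proof -
      have "p m = (1 - u ^ Suc m) * p (Suc m)" using une[of m] by (simp add: p_def)
      hence "?x * (?x ^ m * p m) = ?x ^ Suc m * (1 - u ^ Suc m) * p (Suc m)" by simp
      also have "\<dots> = ?x ^ Suc m * p (Suc m) - (?x ^ Suc m * u ^ Suc m) * p (Suc m)"
        by (simp only: right_diff_distrib left_diff_distrib mult_1_right mult.assoc)
      finally show ?thesis by (simp only: xu) simp
    qed
    hence "(case m of 0 \<Rightarrow> ?x ^ 0 * p 0 | Suc m' \<Rightarrow> ?x ^ Suc m' * p (Suc m') - ?x * (?x ^ m' * p m')) = p m" for m
      by (cases m) simp_all
    thus ?thesis by (simp only: mult_gf_mult[OF zero_less_Suc])
  qed
  have pgf: "pgf n (\<lambda>k m. ?x ^ m * p m) * eprod n ?x = pgf n (\<lambda>k m. p m)"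
    unfolding pgf_eq_prod eprod_def prod.distrib[symmetric] step by (rule refl)
  have "eq_upto n (Kx * eprod n ?x) (pgf n (\<lambda>k m. ?x ^ m * p m) * eprod n ?x)"
    by (rule eq_upto_mult[OF Kx eq_upto_refl])
  hence KxK: "eq_upto n (Kx * eprod n ?x) (part_sum h)"
    unfolding pgf by (rule eq_upto_trans[OF _ eq_upto_sym[OF K]])
  have P: "(\<Prod>i<n. hilb_factor 0 w i) * eprod n ?x = 1"
    using hilb_prod[of 0 w n] by (simp add: eprod_def)
  show ?thesis
  proof (rule near_row_ratio[OF _ _ _ _ n])
    have "(0\<^sup>2 - 1) * (1 - ?x) * (h l * Bsum (0\<^sup>2) ?x l) = ?x ^ length l * h l - h l" if "is_partition l" for l
    proof -
      have "(0\<^sup>2 - 1) * (1 - ?x) * (h l * Bsum (0\<^sup>2) ?x l) = - (((1 - ?x) * Bsum 0 ?x l) * h l)"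
        by (simp add: algebra_simps)
      also have "\<dots> = ?x ^ length l * h l - h l" by (simp only: Bsum_0[OF that]) (simp add: algebra_simps)
      finally show ?thesis .
    qed
    thus "part_sum (\<lambda>l. (0\<^sup>2 - 1) * (1 - ?x) * (h l * Bsum (0\<^sup>2) ?x l)) = Kx - part_sum h"
      unfolding Kx_def part_sum_diff[symmetric] by (rule part_sum_cong)
    show "fps_nth (part_sum h) 0 = 1" by (simp add: part_sum_0 h_def)
    show "fps_nth (eprod n ?x) 0 \<noteq> 0" by (simp add: eprod_0)
    have "(\<Prod>i<n. hilb_factor 0 w i) * part_sum h * eprod n ?x = part_sum h * ((\<Prod>i<n. hilb_factor 0 w i) * eprod n ?x)"
      by (simp only: mult_ac)
    thus "eq_upto n (Kx * eprod n ?x) ((\<Prod>i<n. hilb_factor 0 w i) * part_sum h * eprod n ?x)"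
      using KxK by (simp only: P mult_1_right)
  qed
qed

section \<open>The partition sums at $zw = 1$\<close>

text \<open>$t$ to the power of the length of column \<open>j\<close> (counted from $0$), written through the multiplicities of
  the parts so that its partition sum factorises.\<close>

definition col_prod :: "nat \<Rightarrow> 'a::comm_ring_1 \<Rightarrow> nat \<Rightarrow> nat list \<Rightarrow> 'a" where
  "col_prod N t j l = (\<Prod>k=1..N. if j < k then t ^ count_list l k else 1)"

lemma col_prod_Cons:
  assumes "a \<in> {1..N}"
  shows "col_prod N t j (a # l) = (if j < a then t else 1) * col_prod N t j l"
proof -
  let ?f = "\<lambda>l k. if j < k then t ^ count_list l k else 1"
  have "col_prod N t j (a # l) = ?f (a # l) a * (\<Prod>k\<in>{1..N} - {a}. ?f (a # l) k)"
    unfolding col_prod_def by (rule prod.remove) (use assms in auto)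
  also have "(\<Prod>k\<in>{1..N} - {a}. ?f (a # l) k) = (\<Prod>k\<in>{1..N} - {a}. ?f l k)"
    by (intro prod.cong) auto
  also have "?f (a # l) a = (if j < a then t else 1) * ?f l a" by simp
  also have "(if j < a then t else 1) * ?f l a * (\<Prod>k\<in>{1..N} - {a}. ?f l k) =
      (if j < a then t else 1) * col_prod N t j l"
    unfolding col_prod_def mult.assoc using prod.remove[of "{1..N}" a "?f l"] assms by simp
  finally show ?thesis .
qed

lemma col_prod_eq_1: "\<forall>r\<in>set l. r \<le> j \<Longrightarrow> col_prod N t j l = 1"
  unfolding col_prod_def
proof (rule prod.neutral, intro ballI)
  fix k assume l: "\<forall>r\<in>set l. r \<le> j"
  have "count_list l k = 0" if "j < k" using l that by (induction l) auto
  thus "(if j < k then t ^ count_list l k else 1) = 1" by simp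
qed

text \<open>Column \<open>j\<close> of length \<open>c\<close> contributes $q^j(1-t^c)/(1-t)$ to $B_\lambda$, and
  $1 - (1-q)\sum_{j<N} q^j = q^N$.\<close>

lemma dval_columns:
  assumes "is_partition l" "\<forall>r\<in>set l. r \<le> N"
  shows "dval q t l = q ^ N + (1 - q) * (\<Sum>j<N. q ^ j * col_prod N t j l)"
  using assms
proof (induction l)
  case Nil
  have "(1 - q) * (\<Sum>j<N. q ^ j) = 1 - q ^ N" by (rule one_diff_power_eq[symmetric])
  thus ?case by (simp add: col_prod_eq_1)
next
  case (Cons a l)
  have l: "is_partition l" and a: "a \<in> {1..N}" and le: "\<forall>r\<in>set l. r \<le> a"
    using Cons.prems by (auto simp: is_partition_def)
  define X where "X = (1 - q) * (\<Sum>j<a. q ^ j * col_prod N t j l)"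
  have tail: "(1 - q) * (\<Sum>j\<in>{a..<N}. q ^ j) = q ^ a - q ^ N"
  proof -
    have "(\<Sum>j<N. q ^ j) = (\<Sum>j<a. q ^ j) + (\<Sum>j\<in>{a..<N}. q ^ j)"
      using a by (subst sum.union_disjoint[symmetric]) (auto simp: ivl_disj_un_one)
    hence "(1 - q) * (\<Sum>j\<in>{a..<N}. q ^ j) = (1 - q) * (\<Sum>j<N. q ^ j) - (1 - q) * (\<Sum>j<a. q ^ j)"
      by (simp add: algebra_simps)
    thus ?thesis by (simp only: one_diff_power_eq[symmetric]) simp
  qed
  have split: "(1 - q) * (\<Sum>j<N. q ^ j * f j) = (1 - q) * (\<Sum>j<a. q ^ j * f j) + (q ^ a - q ^ N)"
    if "\<And>j. a \<le> j \<Longrightarrow> f j = 1" for f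
  proof -
    have "(\<Sum>j<N. q ^ j * f j) = (\<Sum>j<a. q ^ j * f j) + (\<Sum>j\<in>{a..<N}. q ^ j * f j)"
      using a by (subst sum.union_disjoint[symmetric]) (auto simp: ivl_disj_un_one)
    also have "(\<Sum>j\<in>{a..<N}. q ^ j * f j) = (\<Sum>j\<in>{a..<N}. q ^ j)" using that by (intro sum.cong) auto
    finally show ?thesis by (simp only: distrib_left tail)
  qed
  have 1: "(1 - q) * (\<Sum>j<N. q ^ j * col_prod N t j l) = X + (q ^ a - q ^ N)"
    unfolding X_def by (rule split) (intro col_prod_eq_1 ballI, use le in fastforce)
  have "(1 - q) * (\<Sum>j<N. q ^ j * col_prod N t j (a # l)) =
      (1 - q) * (\<Sum>j<a. q ^ j * col_prod N t j (a # l)) + (q ^ a - q ^ N)"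
    by (rule split) (intro col_prod_eq_1 ballI, use le in fastforce)
  also have "(\<Sum>j<a. q ^ j * col_prod N t j (a # l)) = t * (\<Sum>j<a. q ^ j * col_prod N t j l)"
    unfolding sum_distrib_left by (intro sum.cong) (auto simp: col_prod_Cons[OF a])
  finally have 2: "(1 - q) * (\<Sum>j<N. q ^ j * col_prod N t j (a # l)) = t * X + (q ^ a - q ^ N)"
    by (simp add: X_def mult.left_commute)
  have IH: "dval q t l = q ^ N + (X + (q ^ a - q ^ N))"
    using Cons.IH[OF l] Cons.prems(2) 1 by simp
  show ?case unfolding 2 dval.simps(2) IH by (simp add: algebra_simps)
qed

context
  fixes q t :: "'a::field"
  assumes qt: "q * t = 1"
begin

text \<open>$\prod_{i=1}^{j} (1-tT^i)/(1-T^i)$: the partition sum of $t^c$, \<open>c\<close> the length of column \<open>j\<close>, after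
  multiplication by $\prod_i (1-tT^i)$.\<close>

definition iprod :: "nat \<Rightarrow> 'a fps" where
  "iprod j = (\<Prod>i<j. efac t i * inverse (efac 1 i))"

definition colgf :: "nat \<Rightarrow> nat \<Rightarrow> 'a fps" where
  "colgf N j = pgf N (\<lambda>k m. if j < k then t ^ m else 1)"

lemma efac_inverse: "inverse (efac c i) * efac c i = (1 :: 'a fps)"
  by (rule inverse_mult_eq_1) simp

lemma geo: "mult_gf (Suc i) (\<lambda>m. c ^ m) = inverse (efac c i :: 'a fps)"
  using mult_gf_geometric[of "Suc i" c]
  by (intro fps_inverse_unique[symmetric]) (simp add: mult.commute del: power_Suc)

lemma colgf_mult:
  assumes "j \<le> N"
  shows "colgf N j * eprod N t = iprod j"
proof -
  have fac: "mult_gf (Suc i) (\<lambda>m. if j < Suc i then t ^ m else 1) * efac t i =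
      (if j \<le> i then 1 else efac t i * inverse (efac 1 i))" for i
  proof (cases "j \<le> i")
    case True
    thus ?thesis using geo[of i t] efac_inverse[of t i] by (simp add: less_Suc_eq_le)
  next
    case False
    thus ?thesis using geo[of i 1] by (simp add: less_Suc_eq_le mult.commute)
  qed
  have "colgf N j * eprod N t = (\<Prod>i<N. if j \<le> i then 1 else efac t i * inverse (efac 1 i))"
    unfolding colgf_def pgf_eq_prod eprod_def prod.distrib[symmetric] fac ..
  also have "\<dots> = (\<Prod>i<j. if j \<le> i then 1 else efac t i * inverse (efac 1 i))"
    using assms by (intro prod.mono_neutral_right) auto
  also have "\<dots> = iprod j" unfolding iprod_def by (intro prod.cong) auto
  finally show ?thesis .
qed

text \<open>$(t;T)_k/(T;T)_k$, the coefficients of the $q$-binomial series with base \<open>T\<close>.\<close>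

definition qbin :: "nat \<Rightarrow> 'a fps" where
  "qbin k = (\<Prod>i<k. (1 - fps_const t * fps_X ^ i) * inverse (efac 1 i))"

lemma qbin_Suc: "qbin (Suc k) = fps_const (1 - t) * iprod k * inverse (efac 1 k)"
proof (induction k)
  case 0
  show ?case by (simp add: qbin_def iprod_def)
next
  case (Suc k)
  have "qbin (Suc (Suc k)) = qbin (Suc k) * (efac t k * inverse (efac 1 (Suc k)))"
    by (simp add: qbin_def)
  thus ?case unfolding Suc by (simp add: iprod_def mult_ac del: power_Suc)
qed

text \<open>Abel summation: the difference of two consecutive products is \<open>qbin (Suc N) * fps_X ^ Suc N\<close>.\<close>

lemma iprod_telescope:
  "fps_const (q ^ N) * iprod N + fps_const (1 - q) * (\<Sum>j<N. fps_const (q ^ j) * iprod j) =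
   (\<Sum>k\<le>N. qbin k * (fps_const (q ^ k) * fps_X ^ k))"
proof (induction N)
  case 0
  show ?case by (simp add: qbin_def iprod_def)
next
  case (Suc N)
  have "iprod (Suc N) = iprod N * (efac t N * inverse (efac 1 N))" by (simp add: iprod_def)
  moreover have "efac t N = efac 1 N + fps_const (1 - t) * fps_X ^ Suc N"
    by (simp add: algebra_simps flip: fps_const_sub)
  ultimately have "iprod (Suc N) = iprod N * (inverse (efac 1 N) * efac 1 N) +
      fps_const (1 - t) * iprod N * inverse (efac 1 N) * fps_X ^ Suc N"
    by (simp only: distrib_right distrib_left mult_ac)
  hence A: "iprod (Suc N) = iprod N + qbin (Suc N) * fps_X ^ Suc N"
    by (simp only: efac_inverse mult_1_right qbin_Suc)
  have c: "fps_const (1 - q) * fps_const (q ^ N) = fps_const (q ^ N) - fps_const (q ^ Suc N)"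
    by (simp add: left_diff_distrib)
  have "fps_const (q ^ Suc N) * iprod (Suc N) + fps_const (1 - q) * (\<Sum>j<Suc N. fps_const (q ^ j) * iprod j) =
      fps_const (q ^ Suc N) * iprod (Suc N) + (fps_const (1 - q) * fps_const (q ^ N)) * iprod N +
      fps_const (1 - q) * (\<Sum>j<N. fps_const (q ^ j) * iprod j)"
    by (simp add: algebra_simps del: power_Suc fps_const_mult)
  also have "\<dots> = fps_const (q ^ N) * iprod N + fps_const (1 - q) * (\<Sum>j<N. fps_const (q ^ j) * iprod j) +
      qbin (Suc N) * (fps_const (q ^ Suc N) * fps_X ^ Suc N)"
    unfolding A c by (simp add: algebra_simps del: power_Suc fps_const_mult fps_const_sub)
  finally show ?case using Suc by (simp del: power_Suc)
qed

text \<open>The $q$-binomial series $\sum_k \frac{(t;T)_k}{(T;T)_k}x^k$ at $x = qT^j$, truncated.\<close>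

definition qbin_series :: "nat \<Rightarrow> nat \<Rightarrow> 'a fps" where
  "qbin_series K j = (\<Sum>k\<le>K. qbin k * (fps_const (q ^ k) * fps_X ^ (j * k)))"

text \<open>The functional equation $f(x)(1-x) = f(xT)(1-tx)$ of the $q$-binomial series $f$, at $x = qT^{j+1}$ with
  $qt = 1$. The two differences $f(x) - f(xT)$ and $f(x) - t f(xT)$ have the same terms up to a shift by
  one; the truncation leaves a remainder divisible by $T^{K+1}$.\<close>

lemma qbin_series_step:
  "eq_upto K (qbin_series K (Suc j) * efac q j) (qbin_series K (Suc (Suc j)) * efac 1 j)"
proof -
  let ?J = "Suc j"
  define F G where "F = qbin_series K ?J" and "G = qbin_series K (Suc ?J)"
  have rec: "qbin (Suc k) * (1 - fps_X ^ Suc k) = qbin k * (1 - fps_const t * fps_X ^ k)" for k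
  proof -
    have "qbin (Suc k) * (1 - fps_X ^ Suc k) =
        qbin k * (1 - fps_const t * fps_X ^ k) * (inverse (efac 1 k) * efac 1 k)"
      by (simp add: qbin_def mult_ac del: power_Suc)
    thus ?thesis by (simp only: efac_inverse mult_1_right)
  qed
  let ?term = "\<lambda>k. qbin k * (1 - fps_const t * fps_X ^ k) * (fps_const (q ^ k) * fps_X ^ (?J * k))"
  have FG: "F - G = (\<Sum>k\<le>K. qbin k * (1 - fps_X ^ k) * (fps_const (q ^ k) * fps_X ^ (?J * k)))"
    unfolding F_def G_def qbin_series_def sum_subtractf[symmetric]
    by (intro sum.cong refl) (simp add: algebra_simps power_add)
  also have "\<dots> = (\<Sum>k<K. qbin (Suc k) * (1 - fps_X ^ Suc k) * (fps_const (q ^ Suc k) * fps_X ^ (?J * Suc k)))"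
  proof -
    have "{..K} = insert 0 {..<Suc K} " by auto
    show ?thesis by (simp only: lessThan_Suc_atMost[symmetric] sum.lessThan_Suc_shift) simp
  qed
  also have "\<dots> = fps_const q * fps_X ^ ?J * (\<Sum>k<K. ?term k)"
    unfolding rec sum_distrib_left
    by (intro sum.cong refl) (simp add: power_add mult_ac flip: fps_const_mult)
  finally have 1: "F - G = fps_const q * fps_X ^ ?J * (\<Sum>k<K. ?term k)" .
  have 2: "F - fps_const t * G = (\<Sum>k<K. ?term k) + ?term K"
  proof -
    have "F - fps_const t * G = (\<Sum>k\<le>K. ?term k)"
      unfolding F_def G_def qbin_series_def sum_distrib_left sum_subtractf[symmetric]
      by (intro sum.cong refl) (simp add: algebra_simps power_add)
    thus ?thesis by (simp only: lessThan_Suc_atMost[symmetric] sum.lessThan_Suc)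
  qed
  have qt': "fps_const q * fps_const t = 1" by (simp add: qt)
  have "F * efac q j - G * efac 1 j = (F - G) - fps_const q * fps_X ^ ?J * (F - fps_const t * G)"
  proof -
    have "fps_const q * fps_X ^ ?J * (fps_const t * G) = (fps_const q * fps_const t) * (fps_X ^ ?J * G)"
      by (simp only: mult_ac)
    thus ?thesis by (simp add: qt qt' algebra_simps del: power_Suc)
  qed
  also have "\<dots> = - (fps_const q * fps_X ^ ?J * ?term K)"
    unfolding 1 2 by (simp add: distrib_left)
  also have "\<dots> = fps_X ^ (?J * Suc K) * (- (fps_const q * (qbin K * (1 - fps_const t * fps_X ^ K) * fps_const (q ^ K))))"
    by (simp add: power_add mult_ac)
  finally have 3: "F * efac q j - G * efac 1 j =
      fps_X ^ (?J * Suc K) * (- (fps_const q * (qbin K * (1 - fps_const t * fps_X ^ K) * fps_const (q ^ K))))" .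
  have "fps_nth (F * efac q j - G * efac 1 j) i = 0" if "i \<le> K" for i
    unfolding 3 fps_X_power_mult_nth using that by simp
  thus ?thesis unfolding eq_upto_def F_def[symmetric] G_def[symmetric] by simp
qed

lemma qbin_series_prod:
  "eq_upto K (qbin_series K 1 * eprod J q) (qbin_series K (Suc J) * eprod J 1)"
proof (induction J)
  case (Suc J)
  have "eq_upto K (qbin_series K 1 * eprod J q * efac q J) (qbin_series K (Suc J) * eprod J 1 * efac q J)"
    by (rule eq_upto_mult[OF Suc eq_upto_refl])
  also have "qbin_series K (Suc J) * eprod J 1 * efac q J = qbin_series K (Suc J) * efac q J * eprod J 1"
    by (simp only: mult_ac)
  also have "eq_upto K \<dots> (qbin_series K (Suc (Suc J)) * efac 1 J * eprod J 1)"
    by (rule eq_upto_mult[OF qbin_series_step eq_upto_refl])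
  finally show ?case unfolding eprod_def prod.lessThan_Suc by (simp only: mult_ac)
qed (simp add: eprod_def)

lemma qbin_series_trivial: "eq_upto K (qbin_series K (Suc K)) 1"
  unfolding eq_upto_def
proof (intro allI impI)
  fix i assume i: "i \<le> K"
  have "fps_nth (qbin k * (fps_const (q ^ k) * fps_X ^ (Suc K * k))) i = 0" if "k \<noteq> 0" for k
  proof -
    have "i < Suc K * 1" using i by simp
    also have "\<dots> \<le> Suc K * k" using that by (intro mult_le_mono2) simp
    finally have "i < Suc K * k" .
    thus ?thesis by (simp add: fps_X_power_mult_right_nth flip: mult.assoc del: mult_Suc)
  qed
  hence "(\<Sum>k\<in>{..K}. fps_nth (qbin k * (fps_const (q ^ k) * fps_X ^ (Suc K * k))) i) =
      (\<Sum>k\<in>{0}. fps_nth (qbin k * (fps_const (q ^ k) * fps_X ^ (Suc K * k))) i)"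
    by (intro sum.mono_neutral_right) auto
  thus "fps_nth (qbin_series K (Suc K)) i = fps_nth 1 i"
    by (simp add: qbin_series_def fps_sum_nth qbin_def del: mult_Suc)
qed

text \<open>Iterating the functional equation from $x = qT$ down to $x = 0$ gives the $q$-binomial theorem.\<close>

lemma dval_series:
  "eq_upto N (part_sum (dval q t) * (eprod N t * eprod N q)) (eprod N 1)"
proof -
  have 1: "eq_upto N (part_sum (dval q t))
      (fps_const (q ^ N) * colgf N N + fps_const (1 - q) * (\<Sum>j<N. fps_const (q ^ j) * colgf N j))"
    unfolding eq_upto_def
  proof (intro allI impI)
    fix i assume i: "i \<le> N"
    have col: "fps_nth (colgf N j) i = (\<Sum>l\<in>parts_le N i. col_prod N t j l)" for j
      by (simp add: colgf_def pgf_def col_prod_def)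
    have "fps_nth (part_sum (dval q t)) i = (\<Sum>l\<in>parts_le N i. dval q t l)"
      using i by (simp add: part_sum_def parts_le_all)
    also have "\<dots> = (\<Sum>l\<in>parts_le N i. q ^ N * col_prod N t N l + (1 - q) * (\<Sum>j<N. q ^ j * col_prod N t j l))"
      by (intro sum.cong refl) (auto simp: parts_le_def dval_columns[of _ N] col_prod_eq_1)
    also have "\<dots> = q ^ N * (\<Sum>l\<in>parts_le N i. col_prod N t N l) +
        (1 - q) * (\<Sum>j<N. q ^ j * (\<Sum>l\<in>parts_le N i. col_prod N t j l))"
      unfolding sum.distrib sum_distrib_left by (subst sum.swap) (rule refl)
    also have "\<dots> = fps_nth (fps_const (q ^ N) * colgf N N + fps_const (1 - q) * (\<Sum>j<N. fps_const (q ^ j) * colgf N j)) i"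
      by (simp add: col fps_sum_nth)
    finally show "fps_nth (part_sum (dval q t)) i = \<dots>" .
  qed
  have "(fps_const (q ^ N) * colgf N N + fps_const (1 - q) * (\<Sum>j<N. fps_const (q ^ j) * colgf N j)) * eprod N t =
      fps_const (q ^ N) * (colgf N N * eprod N t) + fps_const (1 - q) * (\<Sum>j<N. fps_const (q ^ j) * (colgf N j * eprod N t))"
    by (simp only: distrib_right sum_distrib_right mult.assoc)
  also have "\<dots> = fps_const (q ^ N) * iprod N + fps_const (1 - q) * (\<Sum>j<N. fps_const (q ^ j) * iprod j)"
    by (simp add: colgf_mult)
  also have "\<dots> = qbin_series N 1" unfolding iprod_telescope by (simp add: qbin_series_def)
  finally have 2: "(fps_const (q ^ N) * colgf N N + fps_const (1 - q) * (\<Sum>j<N. fps_const (q ^ j) * colgf N j)) * eprod N t =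
      qbin_series N 1" .
  have "eq_upto N (part_sum (dval q t) * (eprod N t * eprod N q)) (qbin_series N 1 * eprod N q)"
    using eq_upto_mult[OF 1 eq_upto_refl, of "eprod N t * eprod N q"] by (simp only: 2 flip: mult.assoc)
  also have "eq_upto N \<dots> (qbin_series N (Suc N) * eprod N 1)" by (rule qbin_series_prod)
  also have "eq_upto N \<dots> (1 * eprod N 1)" by (rule eq_upto_mult[OF qbin_series_trivial eq_upto_refl])
  finally show ?thesis by simp
qed

end

lemma count_series: "eq_upto N (part_sum (\<lambda>_. 1) * eprod N 1) (1 :: 'a::field fps)"
proof -
  have "eq_upto N (part_sum (\<lambda>_. 1)) (pgf N (\<lambda>_ _. 1 :: 'a))" by (rule eq_upto_part_sum) simp
  hence "eq_upto N (part_sum (\<lambda>_. 1) * eprod N 1) (pgf N (\<lambda>_ _. 1 :: 'a) * eprod N 1)"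
    by (rule eq_upto_mult[OF _ eq_upto_refl])
  also have "pgf N (\<lambda>_ _. 1 :: 'a) * eprod N 1 = 1"
  proof -
    have "mult_gf (Suc i) (\<lambda>_. 1 :: 'a) * efac 1 i = 1" for i
      using mult_gf_geometric[of "Suc i" "1 :: 'a"] by (simp del: power_Suc)
    thus ?thesis by (simp only: pgf_eq_prod eprod_def prod.distrib[symmetric] prod.neutral_const)
  qed
  finally show ?thesis .
qed

text \<open>The weight $(q-1)(1-t)B_\lambda$ is the eigenvalue of $\lambda$ minus $1$.\<close>

lemma hyperbola_identity:
  fixes w :: "'a::field"
  assumes w: "w \<noteq> 0" and n: "n \<ge> 1"
  shows "fps_nth (part_sum (\<lambda>l. ((inverse w)\<^sup>2 - 1) * (1 - w\<^sup>2) * (1 * Bsum ((inverse w)\<^sup>2) (w\<^sup>2) l)) *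
      inverse (part_sum (\<lambda>_. 1))) n = fps_nth (\<Prod>i<n. hilb_factor (inverse w) w i) n"
proof -
  define q t where "q = (inverse w)\<^sup>2" and "t = w\<^sup>2"
  have qt: "q * t = 1" using w by (simp add: q_def t_def flip: power_mult_distrib)
  define P where "P = (\<Prod>i<n. hilb_factor (inverse w) w i)"
  let ?K = "part_sum (\<lambda>_. 1 :: 'a)" and ?e = "eprod n (1 :: 'a)" and ?H = "eprod n t * eprod n q * eprod n (1 :: 'a)"
  have P: "P * (eprod n t * eprod n q) = ?e ^ 2"
    using hilb_prod[of "inverse w" w n] w by (simp add: P_def q_def t_def mult.commute)
  show ?thesis unfolding P_def[symmetric] q_def[symmetric] t_def[symmetric]
  proof (rule near_row_ratio[OF _ _ _ _ n])
    show "part_sum (\<lambda>l. (q - 1) * (1 - t) * (1 * Bsum q t l)) = part_sum (dval q t) - ?K"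
      unfolding part_sum_diff[symmetric] by (rule part_sum_cong) (simp add: dval_Bsum algebra_simps)
    show "fps_nth ?K 0 = 1" by (simp add: part_sum_0)
    show "fps_nth ?H 0 \<noteq> 0" by (simp add: eprod_0)
    have "eq_upto n (part_sum (dval q t) * (eprod n t * eprod n q) * ?e) (?e * ?e)"
      by (rule eq_upto_mult[OF dval_series[OF qt] eq_upto_refl])
    hence A: "eq_upto n (part_sum (dval q t) * ?H) (?e * ?e)" by (simp only: mult.assoc)
    have "P * ?K * ?H = (P * (eprod n t * eprod n q)) * (?K * ?e)" by (simp only: mult_ac)
    also have "\<dots> = ?e * ?e * (?K * ?e)" by (simp only: P power2_eq_square)
    finally have eq: "P * ?K * ?H = ?e * ?e * (?K * ?e)" .
    have "eq_upto n (P * ?K * ?H) (?e * ?e * 1)" unfolding eq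
      by (rule eq_upto_mult[OF eq_upto_refl count_series])
    hence B: "eq_upto n (P * ?K * ?H) (?e * ?e)" by (simp only: mult_1_right)
    show "eq_upto n (part_sum (dval q t) * ?H) (P * ?K * ?H)"
      by (rule eq_upto_trans[OF A eq_upto_sym[OF B]])
  qed
qed

section \<open>The two identities\<close>

lemma var_w1_power_neq:
  assumes "i \<noteq> j"
  shows "var_w1 ^ i \<noteq> var_w1 ^ j"
proof -
  have aux: "var_w1 ^ i \<noteq> var_w1 ^ j" if ij: "i < j" for i j
  proof
    assume eq: "var_w1 ^ i = var_w1 ^ j"
    obtain k where k: "j = i + Suc k" using less_imp_Suc_add[OF ij] by auto
    have "var_w1 ^ i * 1 = var_w1 ^ i * var_w1 ^ Suc k" using eq by (simp add: k power_add)
    hence "1 = var_w1 ^ Suc k" using var_w1_neq_0 by (metis mult_left_cancel power_not_zero)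
    thus False using var_w1_power_neq_1 by metis
  qed
  show ?thesis using assms aux by (metis linorder_neqE_nat)
qed

lemma values_agree:
  assumes "has_value F a b u" "has_value G a b v" "u = v"
  shows "regular_at F a b \<and> regular_at G a b \<and> rat_at F a b = rat_at G a b"
  using assms by (auto simp: regular_at_def rat_at_eq)

lemma agree_at_zero:
  assumes "n \<ge> 1"
  shows "regular_at (HH_hilb n) 0 var_w1 \<and> regular_at (HH_part (near_row n)) 0 var_w1 \<and>
          rat_at (HH_hilb n) 0 var_w1 = rat_at (HH_part (near_row n)) 0 var_w1"
proof (rule values_agree[OF HH_hilb_value[OF order_refl] HH_part_value])
  let ?h = "\<lambda>l. \<Prod>s\<in>cells l. if arm l s = 0 then inverse (1 - inverse (var_w1\<^sup>2) ^ Suc (leg l s)) else 1"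
  show "has_value (hook_fun l) 0 var_w1 (?h l)" for l
  proof -
    have "has_value (hook_fun l) 0 var_w1 (\<Prod>s\<in>cells l. cell_weight 0 var_w1 (arm l s) (leg l s))"
    proof (rule hook_fun_value)
      fix a l :: nat
      show "(0 :: rat poly fract) ^ (2 * a + 2) \<noteq> var_w1 ^ (2 * l)" using var_w1_neq_0 by simp
      show "(0 :: rat poly fract) ^ (2 * a) \<noteq> var_w1 ^ (2 * l + 2)"
        using var_w1_neq_0 var_w1_power_neq[of 0 "2 * l + 2"] by (cases a) simp_all
    qed
    thus ?thesis by (simp only: cell_weight_0[OF var_w1_neq_0])
  qed
  show "?h [] = 1" by simp
  show "n \<ge> 1" by fact
  show "fps_nth (\<Prod>i<n. hilb_factor 0 var_w1 i) n =
      fps_nth (part_sum (\<lambda>l. (0\<^sup>2 - 1) * (1 - var_w1\<^sup>2) * (?h l * Bsum (0\<^sup>2) (var_w1\<^sup>2) l)) * inverse (part_sum ?h)) n"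
    by (rule zero_identity[symmetric]) (use var_w1_neq_0 var_w1_power_neq_1 assms in auto)
qed

lemma agree_on_hyperbola:
  assumes "n \<ge> 1"
  shows "regular_at (HH_hilb n) (inverse var_w1) var_w1 \<and>
          regular_at (HH_part (near_row n)) (inverse var_w1) var_w1 \<and>
          rat_at (HH_hilb n) (inverse var_w1) var_w1 = rat_at (HH_part (near_row n)) (inverse var_w1) var_w1"
proof (rule values_agree[OF HH_hilb_value[OF order_refl] HH_part_value])
  show "has_value (hook_fun l) (inverse var_w1) var_w1 1" for l
  proof -
    have "has_value (hook_fun l) (inverse var_w1) var_w1
        (\<Prod>s\<in>cells l. cell_weight (inverse var_w1) var_w1 (arm l s) (leg l s))"
    proof (rule hook_fun_value)
      fix a l :: nat
      have *: "inverse var_w1 ^ i \<noteq> var_w1 ^ j" if "i + j \<noteq> 0" for i j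
      proof
        assume "inverse var_w1 ^ i = var_w1 ^ j"
        hence "var_w1 ^ i * inverse var_w1 ^ i = var_w1 ^ (i + j)" by (simp add: power_add)
        moreover have "var_w1 ^ i * inverse var_w1 ^ i = var_w1 ^ 0"
          using var_w1_neq_0 by (simp flip: power_mult_distrib)
        ultimately show False using var_w1_power_neq[OF that] by simp
      qed
      show "inverse var_w1 ^ (2 * a + 2) \<noteq> var_w1 ^ (2 * l)" by (rule *) simp
      show "inverse var_w1 ^ (2 * a) \<noteq> var_w1 ^ (2 * l + 2)" by (rule *) simp
    qed
    thus ?thesis by (simp only: cell_weight_inverse[OF var_w1_neq_0 var_w1_power_neq_1] prod.neutral_const)
  qed
  show "(1 :: rat poly fract) = 1" ..
  show "n \<ge> 1" by fact
  show "fps_nth (\<Prod>i<n. hilb_factor (inverse var_w1) var_w1 i) n =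
      fps_nth (part_sum (\<lambda>l. ((inverse var_w1)\<^sup>2 - 1) * (1 - var_w1\<^sup>2) *
        (1 * Bsum ((inverse var_w1)\<^sup>2) (var_w1\<^sup>2) l)) * inverse (part_sum (\<lambda>_. 1))) n"
    by (rule hyperbola_identity[symmetric]) (use var_w1_neq_0 assms in auto)
qed

theorem theorem1p2p2:
  fixes n :: nat
  assumes "n \<ge> 1"
  shows "(regular_at (HH_hilb n) 0 var_w1 \<and> regular_at (HH_part (near_row n)) 0 var_w1 \<and>
          rat_at (HH_hilb n) 0 var_w1 = rat_at (HH_part (near_row n)) 0 var_w1) \<and>
         (regular_at (HH_hilb n) (inverse var_w1) var_w1 \<and>
          regular_at (HH_part (near_row n)) (inverse var_w1) var_w1 \<and>
          rat_at (HH_hilb n) (inverse var_w1) var_w1 =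
            rat_at (HH_part (near_row n)) (inverse var_w1) var_w1)"
  using agree_at_zero[OF assms] agree_on_hyperbola[OF assms] by blast

end
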